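(* Let $\mathcal{O}_1\subset(0,\pi)$ be a nonempty open set and let $$T>\frac{4\pi}{\sqrt{a\gamma\rho_s^{\gamma-1}+\frac{\mu}{\kappa\rho_s}}}.$$ Then the control system $$\begin{cases}\partial_t\rho+\rho_s\partial_x u=\mathbf 1_{\mathcal{O}_1}f_1 & \text{in }(0,T)\times(0,\pi),\\ \partial_t u+a\gamma\rho_s^{\gamma-2}\partial_x\rho-\frac1{\rho_s}\partial_x S=0 & \text{in }(0,T)\times(0,\pi),\\ \partial_t S+\frac1\kappa S-\frac\mu\kappa\partial_x u=0 & \text{in }(0,T)\times(0,\pi),\\ u(t,0)=u(t,\pi)=0 & t\in(0,T),\\ \rho(0)=\rho_0,\ u(0)=u_0,\ S(0)=S_0 & \text{in }(0,\pi)\end{cases}$$ is approximately controllable in $L^2(0,\pi)\times L^2(0,\pi)\times L^2_m(0,\pi)$ at time $T$ by a localized interior control $f_1\in L^2(0,T;L^2(\mathcal{O}_1))$ for the density.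
   Context: The constants satisfy $a>0$, $\gamma\ge1$, $\rho_s>0$, $\mu>0$, $\kappa>0$. $\mathbf 1_{\mathcal{O}}$ is the characteristic function of $\mathcal{O}$; function spaces are complex-valued. $L^2_m(0,\pi)=\{f\in L^2(0,\pi):\int_0^\pi f\,dx=0\}$. Put $b=a\gamma\rho_s^{\gamma-2}$. Solutions are understood as mild solutions $z=(\rho,u,S)^\top\in C([0,T];(L^2(0,\pi))^3)$ of $\dot z=\mathcal{A}z+(\mathbf 1_{\mathcal{O}_1}f_1,0,0)^\top$, where $\mathcal{A}(\rho,u,S)^\top=(-\rho_s u',\,-b\rho'+\frac1{\rho_s}S',\,\frac\mu\kappa u'-\frac1\kappa S)^\top$ with domain $\{(\rho,u,S)\in(L^2(0,\pi))^3: u\in H^1_0(0,\pi),\ -b\rho+\frac1{\rho_s}S\in H^1(0,\pi)\}$ ($\mathcal{A}$ generates a strongly continuous semigroup on $(L^2(0,\pi))^3$). The system is approximately controllable in $X=L^2(0,\pi)\times L^2(0,\pi)\times L^2_m(0,\pi)$ at time $T$ if for every initial datum $(\rho_0,u_0,S_0)^\top\in X$, every target $(\rho_T,u_T,S_T)^\top\in X$ and every $\epsilon>0$, there exists a control $f_1\in L^2(0,T;L^2(\mathcal{O}_1))$ such that the corresponding solution satisfies $\|(\rho,u,S)^\top(T,\cdot)-(\rho_T,u_T,S_T)^\top\|_{(L^2(0,\pi))^3}<\epsilon$. *)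

theory Defs
  imports "HOL-Analysis.Analysis"
begin

section \<open>The Hilbert space of square integrable complex functions on the interval from 0 to pi\<close>

abbreviation Mpi :: "real measure" where
  "Mpi \<equiv> lebesgue_on {0<..<pi}"

definition sqint :: "(real \<Rightarrow> complex) \<Rightarrow> bool" where
  "sqint f \<longleftrightarrow> f \<in> borel_measurable Mpi \<and> integrable Mpi (\<lambda>x. (cmod (f x))\<^sup>2)"

definition eqae :: "(real \<Rightarrow> complex) \<Rightarrow> (real \<Rightarrow> complex) \<Rightarrow> bool" where
  "eqae f g \<longleftrightarrow> sqint f \<and> sqint g \<and> (AE x in Mpi. f x = g x)"

lemma finite_measure_Mpi: "finite_measure Mpi"
  by (intro finite_measureI) (simp add: emeasure_restrict_space)

interpretation Mpi: finite_measure Mpi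
  by (rule finite_measure_Mpi)

lemma part_equivp_eqae: "part_equivp eqae"
proof (rule part_equivpI)
  have "sqint (\<lambda>x. 0)" by (simp add: sqint_def)
  then show "\<exists>f. eqae f f" by (auto simp: eqae_def)
  show "symp eqae" by (auto simp: symp_def eqae_def)
  show "transp eqae" by (auto simp: transp_def eqae_def)
qed

quotient_type l2 = "real \<Rightarrow> complex" / partial: eqae
  morphisms rep_l2 abs_l2
  by (rule part_equivp_eqae)

lemma sqint_measurable [measurable_dest]: "sqint f \<Longrightarrow> f \<in> borel_measurable Mpi"
  by (simp add: sqint_def)

lemma sqint_integrable: "sqint f \<Longrightarrow> integrable Mpi (\<lambda>x. (cmod (f x))\<^sup>2)"
  by (simp add: sqint_def)

lemma sqint_zero: "sqint (\<lambda>x. 0)"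
  by (simp add: sqint_def)

lemma sqint_bound:
  assumes "f \<in> borel_measurable Mpi" "integrable Mpi w"
    "AE x in Mpi. (cmod (f x))\<^sup>2 \<le> w x"
  shows "sqint f"
  unfolding sqint_def
proof
  show "integrable Mpi (\<lambda>x. (cmod (f x))\<^sup>2)"
    by (rule Bochner_Integration.integrable_bound[OF assms(2)]) (use assms in auto)
qed fact

lemma sqint_cong_AE:
  assumes g: "sqint g" and f: "f \<in> borel_measurable Mpi" and ae: "AE x in Mpi. f x = g x"
  shows "sqint f"
proof (rule sqint_bound[OF f sqint_integrable[OF g]])
  show "AE x in Mpi. (cmod (f x))\<^sup>2 \<le> (cmod (g x))\<^sup>2"
    using ae by (rule AE_mp) (rule AE_I2, simp)
qed

lemma cmod_add_sq: "(cmod (a + b))\<^sup>2 \<le> 2 * (cmod a)\<^sup>2 + 2 * (cmod b)\<^sup>2"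
proof -
  have "(cmod (a + b))\<^sup>2 \<le> (cmod a + cmod b)\<^sup>2"
    by (simp add: norm_triangle_ineq power_mono)
  also have "\<dots> \<le> 2 * (cmod a)\<^sup>2 + 2 * (cmod b)\<^sup>2"
    using zero_le_power2[of "cmod a - cmod b"] by (simp add: power2_eq_square algebra_simps)
  finally show ?thesis .
qed

lemma sqint_add: "sqint f \<Longrightarrow> sqint g \<Longrightarrow> sqint (\<lambda>x. f x + g x)"
  by (rule sqint_bound[where w = "\<lambda>x. 2 * (cmod (f x))\<^sup>2 + 2 * (cmod (g x))\<^sup>2"])
     (auto simp: sqint_def cmod_add_sq)

lemma sqint_scaleR: "sqint f \<Longrightarrow> sqint (\<lambda>x. r *\<^sub>R f x)"
  by (auto simp: sqint_def power_mult_distrib)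

lemma sqint_uminus: "sqint f \<Longrightarrow> sqint (\<lambda>x. - f x)"
  by (auto simp: sqint_def)

lemma sqint_diff: "sqint f \<Longrightarrow> sqint g \<Longrightarrow> sqint (\<lambda>x. f x - g x)"
  using sqint_add[of f "\<lambda>x. - g x"] sqint_uminus[of g] by simp

lemma integrable_inner_l2:
  assumes "sqint f" "sqint g"
  shows "integrable Mpi (\<lambda>x. f x * cnj (g x))"
proof (rule Bochner_Integration.integrable_bound[where f = "\<lambda>x. (cmod (f x))\<^sup>2 + (cmod (g x))\<^sup>2"])
  show "AE x in Mpi. norm (f x * cnj (g x)) \<le> norm ((cmod (f x))\<^sup>2 + (cmod (g x))\<^sup>2)"
  proof (rule AE_I2)
    fix x
    have "2 * (cmod (f x) * cmod (g x)) \<le> (cmod (f x))\<^sup>2 + (cmod (g x))\<^sup>2"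
      using sum_squares_bound[of "cmod (f x)" "cmod (g x)"] by (simp add: mult.assoc)
    moreover have "0 \<le> cmod (f x) * cmod (g x)" by simp
    ultimately show "norm (f x * cnj (g x)) \<le> norm ((cmod (f x))\<^sup>2 + (cmod (g x))\<^sup>2)"
      by (simp add: norm_mult del: mult_nonneg_nonneg zero_le_mult_iff)
  qed
next
  have "(\<lambda>x. cnj (g x)) \<in> borel_measurable Mpi"
    by (rule measurable_compose[OF sqint_measurable[OF assms(2)]])
       (intro borel_measurable_continuous_onI continuous_intros)
  then show "(\<lambda>x. f x * cnj (g x)) \<in> borel_measurable Mpi"
    using sqint_measurable[OF assms(1)] by measurable
qed (use assms in \<open>auto simp: sqint_def\<close>)

instantiation l2 :: real_vector
begin

lift_definition zero_l2 :: l2 is "\<lambda>x. 0"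
  by (simp add: eqae_def sqint_zero)

lift_definition plus_l2 :: "l2 \<Rightarrow> l2 \<Rightarrow> l2" is "\<lambda>f g x. f x + g x"
  by (auto simp: eqae_def sqint_add)

lift_definition uminus_l2 :: "l2 \<Rightarrow> l2" is "\<lambda>f x. - f x"
  by (auto simp: eqae_def sqint_uminus)

lift_definition minus_l2 :: "l2 \<Rightarrow> l2 \<Rightarrow> l2" is "\<lambda>f g x. f x - g x"
  by (auto simp: eqae_def sqint_diff)

lift_definition scaleR_l2 :: "real \<Rightarrow> l2 \<Rightarrow> l2" is "\<lambda>r f x. r *\<^sub>R f x"
  by (auto simp: eqae_def sqint_scaleR elim: AE_mp)

instance
proof
  fix x y z :: l2 and r s :: real
  show "x + y + z = x + (y + z)"
    by transfer (auto simp: eqae_def sqint_add add.assoc)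
  show "x + y = y + x"
    by transfer (auto simp: eqae_def sqint_add add.commute)
  show "0 + x = x"
    by transfer (auto simp: eqae_def)
  show "- x + x = 0"
    by transfer (auto simp: eqae_def sqint_zero)
  show "x - y = x + - y"
    by transfer (auto simp: eqae_def sqint_diff)
  show "r *\<^sub>R (x + y) = r *\<^sub>R x + r *\<^sub>R y"
    by transfer (auto simp: eqae_def scaleR_add_right intro!: sqint_add sqint_scaleR)
  show "(r + s) *\<^sub>R x = r *\<^sub>R x + s *\<^sub>R x"
    by transfer (auto simp: eqae_def scaleR_add_left intro!: sqint_add sqint_scaleR)
  show "r *\<^sub>R s *\<^sub>R x = (r * s) *\<^sub>R x"
    by transfer (auto simp: eqae_def sqint_scaleR simp del: scaleR_conv_of_real)
  show "1 *\<^sub>R x = x"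
    by transfer (auto simp: eqae_def)
qed

end

text \<open>Only real scalars are part of the type class structure; the inner product below is the
  real part of the Hermitian inner product and induces the usual norm.\<close>

instantiation l2 :: real_inner
begin

lift_definition inner_l2 :: "l2 \<Rightarrow> l2 \<Rightarrow> real" is "\<lambda>f g. Re (\<integral>x. f x * cnj (g x) \<partial>Mpi)"
proof -
  fix f1 f2 g1 g2 assume *: "eqae f1 f2" "eqae g1 g2"
  have "(\<integral>x. f1 x * cnj (g1 x) \<partial>Mpi) = (\<integral>x. f2 x * cnj (g2 x) \<partial>Mpi)"
    using * integrable_inner_l2[of f1 g1] integrable_inner_l2[of f2 g2]
    by (intro integral_cong_AE) (auto simp: eqae_def borel_measurable_integrable)
  then show "Re (\<integral>x. f1 x * cnj (g1 x) \<partial>Mpi) = Re (\<integral>x. f2 x * cnj (g2 x) \<partial>Mpi)" by simp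
qed

definition "norm (f::l2) = sqrt (inner f f)"
definition "sgn (f::l2) = f /\<^sub>R norm f"
definition "dist (f::l2) g = norm (f - g)"
definition "(uniformity :: (l2 \<times> l2) filter) = (INF e\<in>{0 <..}. principal {(x, y). dist x y < e})"
definition "open (U :: l2 set) = (\<forall>x\<in>U. eventually (\<lambda>(x', y). x' = x \<longrightarrow> y \<in> U) uniformity)"

lemma Re_self: "(\<integral>x. f x * cnj (f x) \<partial>Mpi) = of_real (\<integral>x. (cmod (f x))\<^sup>2 \<partial>Mpi)"
  unfolding integral_complex_of_real[symmetric]
  by (simp only: complex_norm_square)

instance
proof
  fix x y z :: l2 and r :: real
  show "sgn x = x /\<^sub>R norm x" by (simp add: sgn_l2_def)
  show "dist x y = norm (x - y)" by (simp add: dist_l2_def)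
  show "norm x = sqrt (inner x x)" by (simp add: norm_l2_def)
  show "(uniformity :: (l2 \<times> l2) filter) = (INF e\<in>{0 <..}. principal {(x, y). dist x y < e})"
    by (simp add: uniformity_l2_def)
  show "open U = (\<forall>x\<in>U. eventually (\<lambda>(x', y). x' = x \<longrightarrow> y \<in> U) uniformity)" for U :: "l2 set"
    by (simp add: open_l2_def)
  show "inner x y = inner y x"
  proof transfer
    fix f g assume "eqae f f" "eqae g g"
    have "(\<integral>x. g x * cnj (f x) \<partial>Mpi) = cnj (\<integral>x. f x * cnj (g x) \<partial>Mpi)"
      by (subst Bochner_Integration.integral_cnj[symmetric]) (simp add: mult.commute)
    then show "Re (\<integral>x. f x * cnj (g x) \<partial>Mpi) = Re (\<integral>x. g x * cnj (f x) \<partial>Mpi)" by simp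
  qed
  show "inner (x + y) z = inner x z + inner y z"
    by transfer (auto simp: eqae_def distrib_right integrable_inner_l2)
  show "inner (r *\<^sub>R x) y = r * inner x y"
    by transfer auto
  show "0 \<le> inner x x"
    by transfer (simp add: Re_self)
  show "(inner x x = 0) = (x = 0)"
    by transfer (auto simp: Re_self eqae_def sqint_def integral_nonneg_eq_0_iff_AE)
qed

end

lemma norm_abs_l2: "sqint f \<Longrightarrow> (norm (abs_l2 f))\<^sup>2 = (\<integral>x. (cmod (f x))\<^sup>2 \<partial>Mpi)"
proof -
  assume f: "sqint f"
  then have "eqae f f" by (simp add: eqae_def)
  then have "inner (abs_l2 f) (abs_l2 f) = (\<integral>x. (cmod (f x))\<^sup>2 \<partial>Mpi)"
    by (simp add: inner_l2.abs_eq Re_self)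
  then show ?thesis by (simp add: power2_norm_eq_inner)
qed

lemma sqint_rep_l2: "sqint (rep_l2 f)"
  using Quotient_rep_reflp[OF Quotient_l2, of f] by (simp add: eqae_def)

lemma abs_rep_l2: "abs_l2 (rep_l2 f) = f"
  by (rule Quotient_abs_rep[OF Quotient_l2])

lemma abs_l2_eq_iff: "sqint f \<Longrightarrow> sqint g \<Longrightarrow> abs_l2 f = abs_l2 g \<longleftrightarrow> (AE x in Mpi. f x = g x)"
  using Quotient_rel[OF Quotient_l2, of f g] by (auto simp: eqae_def)

lemma rep_abs_l2: "sqint f \<Longrightarrow> AE x in Mpi. rep_l2 (abs_l2 f) x = f x"
  using abs_l2_eq_iff[of "rep_l2 (abs_l2 f)" f] by (simp add: sqint_rep_l2 abs_rep_l2)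

lemma abs_l2_diff: "sqint f \<Longrightarrow> sqint g \<Longrightarrow> abs_l2 f - abs_l2 g = abs_l2 (\<lambda>x. f x - g x)"
  by (rule minus_l2.abs_eq) (auto simp: eqae_def)

lemma abs_l2_add: "sqint f \<Longrightarrow> sqint g \<Longrightarrow> abs_l2 f + abs_l2 g = abs_l2 (\<lambda>x. f x + g x)"
  by (rule plus_l2.abs_eq) (auto simp: eqae_def)

lemma abs_l2_scaleR: "sqint f \<Longrightarrow> r *\<^sub>R abs_l2 f = abs_l2 (\<lambda>x. r *\<^sub>R f x)"
  by (rule scaleR_l2.abs_eq) (auto simp: eqae_def)

lemma l2_cases:
  obtains g where "sqint g" "f = abs_l2 g"
  using sqint_rep_l2 abs_rep_l2 by metis

lemma abs_l2_tendsto_dominated: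
  assumes "\<And>n. F n \<in> borel_measurable Mpi" "sqint f" "integrable Mpi w"
    "\<And>n. AE x in Mpi. (cmod (F n x - f x))\<^sup>2 \<le> w x"
    "AE x in Mpi. (\<lambda>n. F n x) \<longlonglongrightarrow> f x"
  shows "(\<lambda>n. abs_l2 (F n)) \<longlonglongrightarrow> abs_l2 f" "sqint (F n)"
proof -
  have [measurable]: "F n \<in> borel_measurable Mpi" "f \<in> borel_measurable Mpi" for n
    using assms by (auto simp: sqint_def)
  have d: "sqint (\<lambda>x. F n x - f x)" for n
    by (rule sqint_bound[OF _ assms(3,4)]) measurable
  show F: "sqint (F n)" for n
    using sqint_add[OF d assms(2)] by simp
  have "(\<lambda>n. \<integral>x. (cmod (F n x - f x))\<^sup>2 \<partial>Mpi) \<longlonglongrightarrow> (\<integral>x. 0 \<partial>Mpi)"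
  proof (rule integral_dominated_convergence[where w = w])
    show "AE x in Mpi. (\<lambda>n. (cmod (F n x - f x))\<^sup>2) \<longlonglongrightarrow> 0"
      using assms(5)
    proof (rule AE_mp, intro AE_I2 impI)
      fix x assume "(\<lambda>n. F n x) \<longlonglongrightarrow> f x"
      then have "(\<lambda>n. (cmod (F n x - f x))\<^sup>2) \<longlonglongrightarrow> (cmod (f x - f x))\<^sup>2"
        by (intro tendsto_intros)
      then show "(\<lambda>n. (cmod (F n x - f x))\<^sup>2) \<longlonglongrightarrow> 0" by simp
    qed
  qed (use assms in auto)
  then have "(\<lambda>n. (norm (abs_l2 (F n) - abs_l2 f))\<^sup>2) \<longlonglongrightarrow> 0"
    by (simp add: abs_l2_diff F assms d norm_abs_l2)
  then have "(\<lambda>n. sqrt ((norm (abs_l2 (F n) - abs_l2 f))\<^sup>2)) \<longlonglongrightarrow> sqrt 0"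
    by (rule tendsto_real_sqrt)
  then have "(\<lambda>n. norm (abs_l2 (F n) - abs_l2 f)) \<longlonglongrightarrow> 0" by simp
  from LIM_zero_cancel[OF tendsto_norm_zero_cancel[OF this]]
  show "(\<lambda>n. abs_l2 (F n)) \<longlonglongrightarrow> abs_l2 f" .
qed

lemma sqint_const: "sqint (\<lambda>x. c)"
  by (simp add: sqint_def)

lemma integrable_sqint: "sqint f \<Longrightarrow> integrable Mpi f"
  using integrable_inner_l2[OF _ sqint_const[of 1]] by simp

lemma sqint_cmod: "sqint f \<Longrightarrow> sqint (\<lambda>x. complex_of_real (cmod (f x)))"
proof -
  assume f: "sqint f"
  have "(\<lambda>x. complex_of_real (cmod (f x))) \<in> borel_measurable Mpi"
    by (rule measurable_compose[OF sqint_measurable[OF f]])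
       (intro borel_measurable_continuous_onI continuous_intros)
  with f show ?thesis by (simp add: sqint_def)
qed

lemma L1_le_L2:
  assumes "sqint f"
  shows "(\<integral>x. cmod (f x) \<partial>Mpi) \<le> norm (abs_l2 f) * norm (abs_l2 (\<lambda>x. 1))"
proof -
  let ?h = "\<lambda>x. complex_of_real (cmod (f x))"
  have h: "sqint ?h" "eqae ?h ?h" using sqint_cmod[OF assms] by (auto simp: eqae_def)
  have 1: "eqae (\<lambda>x. 1) (\<lambda>x. 1)" by (simp add: eqae_def sqint_const)
  have "inner (abs_l2 ?h) (abs_l2 (\<lambda>x. 1)) = (\<integral>x. cmod (f x) \<partial>Mpi)"
    by (simp add: inner_l2.abs_eq[OF h(2) 1])
  moreover have "norm (abs_l2 ?h) = norm (abs_l2 f)"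
    
    by (rule power2_eq_imp_eq) (simp_all add: norm_abs_l2 h(1) assms)
  ultimately show ?thesis
    using norm_cauchy_schwarz[of "abs_l2 ?h" "abs_l2 (\<lambda>x. 1)"] by simp
qed

instance l2 :: complete_space
proof
  fix X :: "nat \<Rightarrow> l2" assume X: "Cauchy X"
  define g where "g n = rep_l2 (X n)" for n
  have g: "sqint (g n)" "X n = abs_l2 (g n)" for n
    by (auto simp: g_def sqint_rep_l2 abs_rep_l2)
  have [measurable]: "g n \<in> borel_measurable Mpi" for n using g by (auto simp: sqint_def)
  have d: "sqint (\<lambda>x. g i x - g j x)" "X i - X j = abs_l2 (\<lambda>x. g i x - g j x)" for i j
    by (simp_all add: g abs_l2_diff sqint_diff)
  let ?C = "norm (abs_l2 (\<lambda>x. 1))"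
  have L1n: "(\<integral>x. cmod (g i x - g j x) \<partial>Mpi) \<le> norm (X i - X j) * ?C" for i j
    using L1_le_L2[OF d(1)] by (simp add: d(2))
  obtain r where r: "strict_mono r" "AE x in Mpi. Cauchy (\<lambda>i. g (r i) x)"
  proof (rule cauchy_L1_AE_cauchy_subseq[of Mpi g])
    show "integrable Mpi (g n)" for n by (rule integrable_sqint[OF g(1)])
    fix e :: real assume e: "e > 0"
    have C: "?C + 1 > 0" by (simp add: add_nonneg_pos)
    then obtain N where N: "\<And>i j. i \<ge> N \<Longrightarrow> j \<ge> N \<Longrightarrow> norm (X i - X j) < e / (?C + 1)"
      using CauchyD[OF X, of "e / (?C + 1)"] e by auto
    have "(\<integral>x. norm (g i x - g j x) \<partial>Mpi) < e" if "i \<ge> N" "j \<ge> N" for i j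
    proof -
      have "norm (X i - X j) * ?C \<le> norm (X i - X j) * (?C + 1)"
        by (simp add: mult_left_mono)
      also have "\<dots> < e"
        using N[OF that] C by (simp add: pos_less_divide_eq)
      finally show ?thesis using L1n[of i j] by simp
    qed
    then show "\<exists>N. \<forall>i\<ge>N. \<forall>j\<ge>N. (\<integral>x. norm (g i x - g j x) \<partial>Mpi) < e" by blast
  qed
  define f where "f x = lim (\<lambda>i. g (r i) x)" for x
  have [measurable]: "f \<in> borel_measurable Mpi"
    unfolding f_def by (rule borel_measurable_lim_metric) measurable
  have lim: "AE x in Mpi. (\<lambda>i. g (r i) x) \<longlonglongrightarrow> f x"
    using r(2) by (rule AE_mp) (auto simp: f_def Cauchy_convergent_iff convergent_LIMSEQ_iff)
  have key: "sqint (\<lambda>x. g n x - f x) \<and> (\<integral>x. (cmod (g n x - f x))\<^sup>2 \<partial>Mpi) \<le> e\<^sup>2"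
    if N: "\<And>i j. i \<ge> N \<Longrightarrow> j \<ge> N \<Longrightarrow> norm (X i - X j) \<le> e" and n: "n \<ge> N" and e: "e \<ge> 0" for n N e
  proof -
    have le: "(\<integral>\<^sup>+x. ennreal ((cmod (g n x - g (r i) x))\<^sup>2) \<partial>Mpi) \<le> ennreal (e\<^sup>2)" if "i \<ge> N" for i
    proof -
      have "r i \<ge> N" using seq_suble[OF r(1), of i] that by linarith
      then have "norm (X n - X (r i)) \<le> e" using N n by auto
      then have "(norm (X n - X (r i)))\<^sup>2 \<le> e\<^sup>2" by (simp add: power_mono)
      then show ?thesis
        using d(1)[of n "r i"]
        by (subst nn_integral_eq_integral)
           (auto simp: sqint_def d(2) norm_abs_l2[OF d(1)] ennreal_leI)
    qed
    have "(\<integral>\<^sup>+x. ennreal ((cmod (g n x - f x))\<^sup>2) \<partial>Mpi)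
        = (\<integral>\<^sup>+x. liminf (\<lambda>i. ennreal ((cmod (g n x - g (r i) x))\<^sup>2)) \<partial>Mpi)"
    proof (rule nn_integral_cong_AE, rule AE_mp[OF lim], intro AE_I2 impI)
      fix x assume "(\<lambda>i. g (r i) x) \<longlonglongrightarrow> f x"
      then have "(\<lambda>i. ennreal ((cmod (g n x - g (r i) x))\<^sup>2)) \<longlonglongrightarrow> ennreal ((cmod (g n x - f x))\<^sup>2)"
        by (intro tendsto_intros tendsto_ennrealI)
      then show "ennreal ((cmod (g n x - f x))\<^sup>2)
          = liminf (\<lambda>i. ennreal ((cmod (g n x - g (r i) x))\<^sup>2))"
        by (rule lim_imp_Liminf[OF sequentially_bot, symmetric])
    qed
    also have "\<dots> \<le> liminf (\<lambda>i. \<integral>\<^sup>+x. ennreal ((cmod (g n x - g (r i) x))\<^sup>2) \<partial>Mpi)"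
      by (rule nn_integral_liminf) measurable
    also have "\<dots> \<le> liminf (\<lambda>i::nat. ennreal (e\<^sup>2))"
      by (rule Liminf_mono) (use le in \<open>auto simp: eventually_sequentially\<close>)
    also have "\<dots> = ennreal (e\<^sup>2)" by (simp add: Liminf_const)
    finally have *: "(\<integral>\<^sup>+x. ennreal ((cmod (g n x - f x))\<^sup>2) \<partial>Mpi) \<le> ennreal (e\<^sup>2)" .
    have int: "integrable Mpi (\<lambda>x. (cmod (g n x - f x))\<^sup>2)"
      by (rule integrableI_nonneg) (use * in \<open>auto simp: order_le_less_trans\<close>)
    then have "ennreal (\<integral>x. (cmod (g n x - f x))\<^sup>2 \<partial>Mpi) \<le> ennreal (e\<^sup>2)"
      using * by (simp add: nn_integral_eq_integral)
    then show ?thesis using int by (simp add: sqint_def)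
  qed
  have ex: "\<exists>N. \<forall>n\<ge>N. sqint (\<lambda>x. g n x - f x) \<and> (\<integral>x. (cmod (g n x - f x))\<^sup>2 \<partial>Mpi) \<le> e\<^sup>2"
    if e: "e > 0" for e
  proof -
    obtain N where "\<And>i j. i \<ge> N \<Longrightarrow> j \<ge> N \<Longrightarrow> norm (X i - X j) < e"
      using CauchyD[OF X e] by auto
    then show ?thesis using key[of N e] e by (metis less_imp_le)
  qed
  obtain N where "sqint (\<lambda>x. g N x - f x)" using ex[of 1] by auto
  from sqint_diff[OF g(1)[of N] this] have f: "sqint f" by simp
  have "X \<longlonglongrightarrow> abs_l2 f"
  proof (rule LIMSEQ_I)
    fix e :: real assume e: "e > 0"
    obtain N where N: "\<And>n. n \<ge> N \<Longrightarrow> sqint (\<lambda>x. g n x - f x) \<and> (\<integral>x. (cmod (g n x - f x))\<^sup>2 \<partial>Mpi) \<le> (e/2)\<^sup>2"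
      using ex[of "e/2"] e by auto
    have "norm (X n - abs_l2 f) < e" if "n \<ge> N" for n
    proof -
      have "(norm (X n - abs_l2 f))\<^sup>2 \<le> (e/2)\<^sup>2"
        using N[OF that] by (simp add: g abs_l2_diff f norm_abs_l2)
      then have "norm (X n - abs_l2 f) \<le> e/2"
        by (rule power2_le_imp_le) (use e in simp)
      then show ?thesis using e by simp
    qed
    then show "\<exists>N. \<forall>n\<ge>N. norm (X n - abs_l2 f) < e" by blast
  qed
  then show "convergent X" by (rule convergentI)
qed

instance l2 :: banach ..

lemma countable_dense_span:
  fixes E :: "'a::real_normed_vector set"
  assumes "countable E"
  obtains D where "countable D" "E \<subseteq> closure D" "subspace (closure D)"
proof -
  define D where "D = (\<lambda>l::(rat \<times> 'a) list. \<Sum>(q, e)\<leftarrow>l. of_rat q *\<^sub>R e) ` lists (UNIV \<times> E)"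
  have D1: "countable D"
    unfolding D_def using assms by (intro countable_image countable_lists countable_SIGMA) auto
  have E: "E \<subseteq> D"
  proof
    fix e assume "e \<in> E"
    then have "[(1, e)] \<in> lists (UNIV \<times> E)" by auto
    moreover have "e = (\<Sum>(q, e)\<leftarrow>[(1::rat, e)]. of_rat q *\<^sub>R e)" by simp
    ultimately show "e \<in> D" unfolding D_def by (rule rev_image_eqI)
  qed
  have Dadd: "x + y \<in> D" if xy: "x \<in> D" "y \<in> D" for x y
  proof -
    obtain l m where lm: "l \<in> lists (UNIV \<times> E)" "m \<in> lists (UNIV \<times> E)"
      "x = (\<Sum>(q, e)\<leftarrow>l. of_rat q *\<^sub>R e)" "y = (\<Sum>(q, e)\<leftarrow>m. of_rat q *\<^sub>R e)"
      using xy unfolding D_def by blast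
    then have "x + y = (\<Sum>(q, e)\<leftarrow>l @ m. of_rat q *\<^sub>R e)" "l @ m \<in> lists (UNIV \<times> E)" by auto
    then show ?thesis unfolding D_def by blast
  qed
  have Dscale: "of_rat p *\<^sub>R x \<in> D" if x: "x \<in> D" for p x
  proof -
    obtain l where l: "l \<in> lists (UNIV \<times> E)" "x = (\<Sum>(q, e)\<leftarrow>l. of_rat q *\<^sub>R e)"
      using x unfolding D_def by blast
    have "of_rat p *\<^sub>R (\<Sum>(q, e)\<leftarrow>l. of_rat q *\<^sub>R e)
        = (\<Sum>(q, e)\<leftarrow>map (\<lambda>(q, e). (p * q, e)) l. of_rat q *\<^sub>R e)"
      by (induction l) (auto simp: scaleR_add_right of_rat_mult)
    moreover have "map (\<lambda>(q, e). (p * q, e)) l \<in> lists (UNIV \<times> E)"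
      using l(1) by (induction l) auto
    ultimately show ?thesis unfolding D_def using l(2) by blast
  qed
  have "[] \<in> lists (UNIV \<times> E)" by simp
  then have D0: "0 \<in> D" unfolding D_def by (rule rev_image_eqI) simp
  have "subspace (closure D)"
  proof (rule subspaceI)
    show "0 \<in> closure D" using D0 closure_subset by blast
    fix x y assume "x \<in> closure D" "y \<in> closure D"
    then obtain X Y where "\<And>n. X n \<in> D" "X \<longlonglongrightarrow> x" "\<And>n. Y n \<in> D" "Y \<longlonglongrightarrow> y"
      unfolding closure_sequential by blast
    then have "\<And>n. X n + Y n \<in> D" "(\<lambda>n. X n + Y n) \<longlonglongrightarrow> x + y"
      by (auto intro: Dadd tendsto_add)
    then show "x + y \<in> closure D"
      unfolding closure_sequential by (intro exI[of _ "\<lambda>n. X n + Y n"] conjI allI) auto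
  next
    fix c :: real and x assume "x \<in> closure D"
    then obtain X where X: "\<And>n. X n \<in> D" "X \<longlonglongrightarrow> x"
      unfolding closure_sequential by blast
    have "\<exists>q. \<bar>of_rat q - c\<bar> < inverse (real (Suc n))" for n
    proof -
      obtain q where "of_rat q > c" "of_rat q < c + inverse (real (Suc n))"
        using of_rat_dense[of c "c + inverse (real (Suc n))"] by auto
      then show ?thesis by (intro exI[of _ q]) auto
    qed
    then obtain q where q: "\<And>n. \<bar>of_rat (q n) - c\<bar> < inverse (real (Suc n))" by metis
    have "(\<lambda>n. of_rat (q n) - c) \<longlonglongrightarrow> 0"
      by (rule Lim_null_comparison[OF _ LIMSEQ_inverse_real_of_nat])
         (use q in \<open>auto intro!: always_eventually less_imp_le\<close>)
    then have "(\<lambda>n. of_rat (q n)) \<longlonglongrightarrow> c" by (rule LIM_zero_cancel)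
    then have "(\<lambda>n. of_rat (q n) *\<^sub>R X n) \<longlonglongrightarrow> c *\<^sub>R x" by (rule tendsto_scaleR[OF _ X(2)])
    moreover have "\<And>n. of_rat (q n) *\<^sub>R X n \<in> D" by (rule Dscale[OF X(1)])
    ultimately show "c *\<^sub>R x \<in> closure D"
      unfolding closure_sequential by (intro exI[of _ "\<lambda>n. of_rat (q n) *\<^sub>R X n"] conjI allI) auto
  qed
  then show thesis using that[OF D1] E closure_subset[of D] by blast
qed

lemma sqint_indicator:
  assumes "A \<in> sets lebesgue"
  shows "sqint (\<lambda>x. c * indicator A x)"
proof (rule sqint_bound[where w = "\<lambda>x. (cmod c)\<^sup>2"])
  have "indicator A \<in> borel_measurable lebesgue" using assms by simp
  then have "(\<lambda>x. indicator A x :: complex) \<in> borel_measurable Mpi"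
    using assms by (intro measurable_restrict_space1 borel_measurable_indicator) 
  then show "(\<lambda>x. c * indicator A x) \<in> borel_measurable Mpi" by measurable
qed (auto simp: indicator_def)

lemma l2_separable: "\<exists>D::l2 set. countable D \<and> closure D = UNIV"
proof -
  obtain B :: "real set set" where B: "countable B" "topological_basis B"
    using ex_countable_basis by blast
  define G where "G = {F. finite F \<and> F \<subseteq> B}"
  have "countable G" unfolding G_def using B(1) by (rule countable_Collect_finite_subset)
  define E where "E = (\<lambda>(F, c). abs_l2 (\<lambda>x. c * indicator (\<Union>F) x)) ` (G \<times> {1, \<i>})"
  have "countable E" unfolding E_def using \<open>countable G\<close> by (intro countable_image countable_SIGMA) auto
  then obtain D where D: "countable D" "E \<subseteq> closure D" "subspace (closure D)"
    by (rule countable_dense_span)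
  let ?V = "closure D"
  have lim_in: "y \<in> ?V" if "\<And>n. Y n \<in> ?V" "Y \<longlonglongrightarrow> y" for Y y
    using closed_sequentially[OF closed_closure that] .
  have Bopen: "open b" if "b \<in> B" for b using B(2) that by (rule topological_basis_open)
  have V_open: "abs_l2 (\<lambda>x. c * indicator U x) \<in> ?V" if "open U" and c: "c \<in> {1, \<i>}" for U c
  proof -
    obtain B' where B': "B' \<subseteq> B" "U = \<Union>B'"
      using B(2) \<open>open U\<close> unfolding topological_basis_def by blast
    show ?thesis
    proof (cases "B' = {}")
      case True
      then have "U = \<Union>{}" "{} \<in> G" using B' by (auto simp: G_def)
      then show ?thesis using c D(2) unfolding E_def by force
    next
      case False
      define b where "b = from_nat_into B'"
      have rng: "range b = B'"
        unfolding b_def using False B' B(1) by (intro range_from_nat_into) (auto intro: countable_subset)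
      define F where "F n = b ` {..n}" for n
      have F: "F n \<in> G" for n using rng B' unfolding F_def G_def by auto
      have inV: "abs_l2 (\<lambda>x. c * indicator (\<Union>(F n)) x) \<in> ?V" for n
        using F[of n] c D(2) unfolding E_def by force
      have op: "open (\<Union>(F n))" for n using F[of n] Bopen unfolding G_def by blast
      have "(\<lambda>n. abs_l2 (\<lambda>x. c * indicator (\<Union>(F n)) x)) \<longlonglongrightarrow> abs_l2 (\<lambda>x. c * indicator U x)"
      proof (rule abs_l2_tendsto_dominated(1)[where w = "\<lambda>x. (cmod c)\<^sup>2"])
        show "(\<lambda>x. c * indicator (\<Union>(F n)) x) \<in> borel_measurable Mpi" for n
          by (rule sqint_measurable[OF sqint_indicator]) (use op in simp)
        show "sqint (\<lambda>x. c * indicator U x)"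
          by (rule sqint_indicator) (use \<open>open U\<close> in simp)
        show "AE x in Mpi. (cmod (c * indicator (\<Union>(F n)) x - c * indicator U x))\<^sup>2 \<le> (cmod c)\<^sup>2" for n
          by (auto simp: indicator_def)
        show "AE x in Mpi. (\<lambda>n. c * indicator (\<Union>(F n)) x) \<longlonglongrightarrow> c * indicator U x"
        proof (rule AE_I2, rule tendsto_mult_left)
          fix x
          show "(\<lambda>n. indicator (\<Union>(F n)) x :: complex) \<longlonglongrightarrow> indicator U x"
          proof (cases "x \<in> U")
            case True
            then obtain k where "x \<in> b k" using rng B'(2) by blast
            then have "x \<in> \<Union>(F n)" if "n \<ge> k" for n using that unfolding F_def by auto
            then have "eventually (\<lambda>n. indicator (\<Union>(F n)) x = (indicator U x :: complex)) sequentially"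
              using True by (auto simp: eventually_sequentially indicator_def intro!: exI[of _ k])
            then show ?thesis by (rule tendsto_eventually)
          next
            case False
            then have "x \<notin> \<Union>(F n)" for n using rng B'(2) unfolding F_def by blast
            then show ?thesis using False by simp
          qed
        qed
      qed simp
      then show ?thesis by (rule lim_in[OF inV])
    qed
  qed
  have V_set: "abs_l2 (\<lambda>x. c * indicator A x) \<in> ?V" if A: "A \<in> sets lebesgue" and c: "c \<in> {1, \<i>}" for A c
  proof -
    have "\<exists>T. open T \<and> A \<subseteq> T \<and> emeasure lebesgue (T - A) < ennreal (inverse (real (Suc n)))" for n
      using sets_lebesgue_outer_open[OF A, of "inverse (real (Suc n))"] by (metis inverse_positive_iff_positive of_nat_0_less_iff zero_less_Suc)
    then obtain T where T: "\<And>n. open (T n)" "\<And>n. A \<subseteq> T n"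
      "\<And>n. emeasure lebesgue (T n - A) < ennreal (inverse (real (Suc n)))" by metis
    let ?f = "\<lambda>A x. c * indicator A x :: complex"
    have sq: "sqint (?f A)" "sqint (?f (T n))" for n
      using A T(1) by (auto intro!: sqint_indicator)
    have nc: "cmod c = 1" using c by auto
    have "(norm (abs_l2 (?f (T n)) - abs_l2 (?f A)))\<^sup>2 \<le> inverse (real (Suc n))" for n
    proof -
      have TA: "T n - A \<in> sets lebesgue" using A T(1) by (intro sets.Diff) auto
      have m: "{0<..<pi} \<inter> (T n - A) \<in> sets Mpi"
        using TA by (simp add: sets_restrict_space)
      have "(norm (abs_l2 (?f (T n)) - abs_l2 (?f A)))\<^sup>2 = (\<integral>x. (cmod (?f (T n) x - ?f A x))\<^sup>2 \<partial>Mpi)"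
        by (simp add: abs_l2_diff sq norm_abs_l2 sqint_diff)
      also have "\<dots> = (\<integral>x. indicator ({0<..<pi} \<inter> (T n - A)) x \<partial>Mpi)"
        by (rule Bochner_Integration.integral_cong) (use T(2)[of n] nc in \<open>auto simp: indicator_def\<close>)
      also have "\<dots> = measure Mpi ({0<..<pi} \<inter> (T n - A))"
        using m by (simp add: Int_ac)
      also have "\<dots> \<le> inverse (real (Suc n))"
      proof -
        have "emeasure Mpi ({0<..<pi} \<inter> (T n - A)) = emeasure lebesgue ({0<..<pi} \<inter> (T n - A))"
          by (rule emeasure_restrict_space) auto
        also have "\<dots> \<le> emeasure lebesgue (T n - A)" by (rule emeasure_mono) (use TA in auto)
        also have "\<dots> \<le> ennreal (inverse (real (Suc n)))" using T(3) by (rule less_imp_le)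
        finally show ?thesis by (simp add: Mpi.emeasure_eq_measure)
      qed
      finally show ?thesis .
    qed
    then have "(\<lambda>n. (norm (abs_l2 (?f (T n)) - abs_l2 (?f A)))\<^sup>2) \<longlonglongrightarrow> 0"
      by (intro Lim_null_comparison[OF _ LIMSEQ_inverse_real_of_nat]) auto
    from tendsto_real_sqrt[OF this]
    have "(\<lambda>n. norm (abs_l2 (?f (T n)) - abs_l2 (?f A))) \<longlonglongrightarrow> 0" by simp
    from LIM_zero_cancel[OF tendsto_norm_zero_cancel[OF this]]
    show ?thesis by (rule lim_in[OF V_open[OF T(1) c]])
  qed
  have V_setc: "abs_l2 (\<lambda>x. z * indicator A x) \<in> ?V" if A: "A \<in> sets lebesgue" for A z
  proof -
    have "abs_l2 (\<lambda>x. z * indicator A x)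
        = Re z *\<^sub>R abs_l2 (\<lambda>x. 1 * indicator A x) + Im z *\<^sub>R abs_l2 (\<lambda>x. \<i> * indicator A x)"
      unfolding abs_l2_scaleR[OF sqint_indicator[OF A]]
      by (subst abs_l2_add[OF sqint_scaleR[OF sqint_indicator[OF A]] sqint_scaleR[OF sqint_indicator[OF A]]])
         (rule arg_cong[where f = abs_l2], rule ext, simp add: complex_eq_iff indicator_def)
    also have "\<dots> \<in> ?V"
      by (intro subspace_add[OF D(3)] subspace_scale[OF D(3)] V_set[OF A]) auto
    finally show ?thesis .
  qed
  have V_simple: "abs_l2 s \<in> ?V" if s: "simple_function Mpi s" for s
  proof -
    let ?A = "\<lambda>y. s -` {y} \<inter> {0<..<pi}"
    have fin: "finite (s ` {0<..<pi})" using simple_functionD(1)[OF s] by simp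
    have A: "?A y \<in> sets lebesgue" for y
    proof -
      have "?A y \<in> sets Mpi" using simple_functionD(2)[OF s, of "{y}"] by simp
      then show ?thesis by (simp add: sets_restrict_space_iff)
    qed
    have sum: "sqint (\<lambda>x. \<Sum>y\<in>Y. y * indicator (?A y) x)
        \<and> abs_l2 (\<lambda>x. \<Sum>y\<in>Y. y * indicator (?A y) x) \<in> ?V" if "finite Y" for Y :: "complex set"
      using that
    proof induction
      case empty
      have "abs_l2 (\<lambda>x. 0) = 0" by (simp add: zero_l2.abs_eq)
      then show ?case using subspace_0[OF D(3)] by (simp add: sqint_zero)
    next
      case (insert y Y)
      let ?i = "\<lambda>x. y * indicator (?A y) x" and ?t = "\<lambda>x. \<Sum>y\<in>Y. y * indicator (?A y) x"
      have eq: "(\<lambda>x. \<Sum>y\<in>insert y Y. y * indicator (?A y) x) = (\<lambda>x. ?i x + ?t x)"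
        by (rule ext, rule sum.insert[OF insert.hyps])
      have t: "sqint ?t" "abs_l2 ?t \<in> ?V" by (rule insert.IH[THEN conjunct1], rule insert.IH[THEN conjunct2])
      have "abs_l2 ?i + abs_l2 ?t \<in> ?V" by (rule subspace_add[OF D(3) V_setc[OF A] t(2)])
      then have "abs_l2 (\<lambda>x. ?i x + ?t x) \<in> ?V"
        by (simp only: abs_l2_add[OF sqint_indicator[OF A] t(1)])
      with sqint_add[OF sqint_indicator[OF A] t(1)] show ?case unfolding eq by (rule conjI)
    qed
    have eq: "s x = (\<Sum>y\<in>s ` {0<..<pi}. y * indicator (?A y) x)" if "x \<in> {0<..<pi}" for x
    proof -
      have "(\<Sum>y\<in>s ` {0<..<pi}. y * indicator (?A y) x) = (\<Sum>y\<in>{s x}. y * indicator (?A y) x)"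
        by (rule sum.mono_neutral_right) (use that fin in \<open>auto simp: indicator_def\<close>)
      then show ?thesis using that by (simp add: indicator_def)
    qed
    let ?s = "\<lambda>x. \<Sum>y\<in>s ` {0<..<pi}. y * indicator (?A y) x"
    have sm: "s \<in> borel_measurable Mpi" by (rule borel_measurable_simple_function[OF s])
    have ae: "AE x in Mpi. s x = ?s x"
      by (rule AE_I2) (rule eq, simp)
    have "sqint s"
      by (rule sqint_cong_AE[OF sum[OF fin, THEN conjunct1] sm ae])
    then have "abs_l2 s = abs_l2 ?s"
      by (rule iffD2[OF abs_l2_eq_iff[OF _ sum[OF fin, THEN conjunct1]] ae])
    with sum[OF fin, THEN conjunct2] show ?thesis by (simp only:)
  qed
  have "f \<in> ?V" for f
  proof -
    obtain g where g: "sqint g" "f = abs_l2 g" by (rule l2_cases)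
    obtain s where s: "\<And>i. simple_function Mpi (s i)" "\<And>x. x \<in> space Mpi \<Longrightarrow> (\<lambda>i. s i x) \<longlonglongrightarrow> g x"
      "\<And>i x. x \<in> space Mpi \<Longrightarrow> dist (s i x) 0 \<le> 2 * dist (g x) 0"
      using borel_measurable_implies_sequence_metric[OF sqint_measurable[OF g(1)], of 0] by blast
    have "(\<lambda>i. abs_l2 (s i)) \<longlonglongrightarrow> abs_l2 g"
    proof (rule abs_l2_tendsto_dominated(1)[where w = "\<lambda>x. 9 * (cmod (g x))\<^sup>2"])
      show "AE x in Mpi. (cmod (s n x - g x))\<^sup>2 \<le> 9 * (cmod (g x))\<^sup>2" for n
      proof (rule AE_I2)
        fix x assume x: "x \<in> space Mpi"
        have "cmod (s n x - g x) \<le> cmod (s n x) + cmod (g x)" by (rule norm_triangle_ineq4)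
        also have "\<dots> \<le> 3 * cmod (g x)" using s(3)[OF x, of n] by simp
        finally have "(cmod (s n x - g x))\<^sup>2 \<le> (3 * cmod (g x))\<^sup>2" by (rule power_mono) simp
        then show "(cmod (s n x - g x))\<^sup>2 \<le> 9 * (cmod (g x))\<^sup>2" by (simp add: power_mult_distrib)
      qed
      show "AE x in Mpi. (\<lambda>i. s i x) \<longlonglongrightarrow> g x" by (rule AE_I2) (rule s(2))
    qed (use g s(1) in \<open>auto simp: sqint_integrable intro: borel_measurable_simple_function\<close>)
    then show ?thesis unfolding g(2) by (rule lim_in[OF V_simple[OF s(1)]])
  qed
  then show ?thesis using D(1) by blast
qed

instance l2 :: second_countable_topology
proof
  obtain D :: "l2 set" where D: "countable D" "closure D = UNIV" using l2_separable by blast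
  let ?B = "(\<lambda>(d, n). ball d (inverse (real (Suc n)))) ` (D \<times> UNIV)"
  have "topological_basis ?B"
  proof (rule topological_basisI)
    fix U and x :: l2 assume "open U" "x \<in> U"
    then obtain e where e: "e > 0" "ball x e \<subseteq> U" using open_contains_ball by blast
    obtain n where n: "inverse (real (Suc n)) < e / 2" using reals_Archimedean[of "e/2"] e by auto
    have "x \<in> closure D" using D by simp
    then obtain d where d: "d \<in> D" "dist d x < inverse (real (Suc n))"
      unfolding closure_approachable by (metis inverse_positive_iff_positive of_nat_0_less_iff zero_less_Suc)
    have "ball d (inverse (real (Suc n))) \<subseteq> ball x e"
    proof
      fix y assume "y \<in> ball d (inverse (real (Suc n)))"
      then have "dist d y < inverse (real (Suc n))" by simp
      then have "dist x y < e" using d(2) n dist_triangle[of x y d] dist_commute[of x d] by linarith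
      then show "y \<in> ball x e" by simp
    qed
    moreover have "x \<in> ball d (inverse (real (Suc n)))" using d by simp
    ultimately show "\<exists>B'\<in>?B. x \<in> B' \<and> B' \<subseteq> U"
      using d e by (intro bexI[of _ "ball d (inverse (real (Suc n)))"]) auto
  qed auto
  moreover have "countable ?B" using D by (intro countable_image countable_SIGMA) auto
  ultimately show "\<exists>B::l2 set set. countable B \<and> open = generate_topology B"
    using topological_basis_imp_subbasis by blast
qed


section \<open>Weak derivatives and Sobolev spaces\<close>

definition vderiv :: "(real \<Rightarrow> complex) \<Rightarrow> real \<Rightarrow> complex" where
  "vderiv \<phi> x = vector_derivative \<phi> (at x)"

definition test_function :: "(real \<Rightarrow> complex) \<Rightarrow> bool" where
  "test_function \<phi> \<longleftrightarrow>
     (\<forall>n x. (vderiv ^^ n) \<phi> differentiable (at x)) \<and> closure {x. \<phi> x \<noteq> 0} \<subseteq> {0<..<pi}"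

definition has_wderiv :: "l2 \<Rightarrow> l2 \<Rightarrow> bool" where
  "has_wderiv f g \<longleftrightarrow> (\<forall>\<phi>. test_function \<phi> \<longrightarrow>
     (\<integral>x. rep_l2 f x * vderiv \<phi> x \<partial>Mpi) = - (\<integral>x. rep_l2 g x * \<phi> x \<partial>Mpi))"

definition H1 :: "l2 set" where
  "H1 = {f. \<exists>g. has_wderiv f g}"

text \<open>A weak derivative is unique in \<^typ>\<open>l2\<close> (fundamental lemma of the calculus of variations),
  so the following value is determined for every element of \<^const>\<open>H1\<close>.\<close>

definition wderiv :: "l2 \<Rightarrow> l2" where
  "wderiv f = (THE g. has_wderiv f g)"

definition H1_norm :: "l2 \<Rightarrow> real" where
  "H1_norm f = sqrt ((norm f)\<^sup>2 + (norm (wderiv f))\<^sup>2)"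

definition H10 :: "l2 set" where
  "H10 = {f \<in> H1. \<forall>\<epsilon>>0. \<exists>\<phi>. test_function \<phi> \<and> H1_norm (f - abs_l2 \<phi>) < \<epsilon>}"

definition L2m :: "l2 set" where
  "L2m = {f. (\<integral>x. rep_l2 f x \<partial>Mpi) = 0}"

text \<open>The space of square integrable functions on a measurable subset \<open>U\<close> of the interval,
  whose elements \<open>f\<close> are identified with their extensions by zero, that is with \<open>1\<^sub>U f\<close>.\<close>

definition L2_on :: "real set \<Rightarrow> l2 set" where
  "L2_on U = {f. AE x in Mpi. x \<notin> U \<longrightarrow> rep_l2 f x = 0}"


section \<open>Semigroups and mild solutions\<close>

text \<open>A complex Banach space is regarded here as a real one. If the generator commutes with the
  multiplication by the imaginary unit, then so does the semigroup, which it determines.\<close>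

definition c0_semigroup :: "(real \<Rightarrow> 'a::real_normed_vector \<Rightarrow> 'a) \<Rightarrow> bool" where
  "c0_semigroup S \<longleftrightarrow>
     (\<forall>t\<ge>0. bounded_linear (S t)) \<and> S 0 = id \<and>
     (\<forall>s\<ge>0. \<forall>t\<ge>0. S (s + t) = S s \<circ> S t) \<and>
     (\<forall>z. ((\<lambda>t. S t z) \<longlongrightarrow> z) (at_right 0))"

definition is_generator ::
  "(real \<Rightarrow> 'a::real_normed_vector \<Rightarrow> 'a) \<Rightarrow> 'a set \<Rightarrow> ('a \<Rightarrow> 'a) \<Rightarrow> bool" where
  "is_generator S D A \<longleftrightarrow>
     (\<forall>z w. ((\<lambda>h. (1 / h) *\<^sub>R (S h z - z)) \<longlongrightarrow> w) (at_right 0) \<longleftrightarrow> z \<in> D \<and> w = A z)"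

text \<open>\<open>z\<close> is the mild solution on \<open>[0, T]\<close> of \<open>z' = A z + F\<close>, \<open>z 0 = z0\<close>, where \<open>A\<close> has domain \<open>D\<close>.
  The semigroup is unique, as it is determined by its generator.\<close>

definition mild_solution ::
  "'a::{banach, second_countable_topology} set \<Rightarrow> ('a \<Rightarrow> 'a) \<Rightarrow> (real \<Rightarrow> 'a) \<Rightarrow> 'a \<Rightarrow> real \<Rightarrow> (real \<Rightarrow> 'a) \<Rightarrow> bool" where
  "mild_solution D A F z0 T z \<longleftrightarrow>
     continuous_on {0..T} z \<and>
     (\<exists>S. c0_semigroup S \<and> is_generator S D A \<and>
       (\<forall>t\<in>{0..T}. z t = S t z0 + (\<integral>s. S (t - s) (F s) \<partial>lebesgue_on {0<..<t})))"


section \<open>The linearized Navier--Stokes system with Maxwell's law\<close>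

text \<open>The norm of the product type is the Hilbert space norm of the product.\<close>

type_synonym state = "l2 \<times> l2 \<times> l2"

definition bcoef :: "real \<Rightarrow> real \<Rightarrow> real \<Rightarrow> real" where
  "bcoef a \<gamma> \<rho>\<^sub>s = a * \<gamma> * \<rho>\<^sub>s powr (\<gamma> - 2)"

definition A_dom :: "real \<Rightarrow> real \<Rightarrow> real \<Rightarrow> state set" where
  "A_dom a \<gamma> \<rho>\<^sub>s = {(\<rho>, u, S). u \<in> H10 \<and> - bcoef a \<gamma> \<rho>\<^sub>s *\<^sub>R \<rho> + (1 / \<rho>\<^sub>s) *\<^sub>R S \<in> H1}"

text \<open>On the domain only the combination \<open>- b \<rho> + S / \<rho>\<^sub>s\<close> is weakly differentiable,
  so that \<open>- b \<rho>' + S' / \<rho>\<^sub>s\<close> means the derivative of this combination.\<close>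

definition A_op :: "real \<Rightarrow> real \<Rightarrow> real \<Rightarrow> real \<Rightarrow> real \<Rightarrow> state \<Rightarrow> state" where
  "A_op a \<gamma> \<rho>\<^sub>s \<mu> \<kappa> = (\<lambda>(\<rho>, u, S).
     (- \<rho>\<^sub>s *\<^sub>R wderiv u,
      wderiv (- bcoef a \<gamma> \<rho>\<^sub>s *\<^sub>R \<rho> + (1 / \<rho>\<^sub>s) *\<^sub>R S),
      (\<mu> / \<kappa>) *\<^sub>R wderiv u - (1 / \<kappa>) *\<^sub>R S))"

text \<open>The controls in \<open>L\<^sup>2(0, T; L\<^sup>2(U))\<close>. Borel measurability is strong measurability, since
  \<^typ>\<open>l2\<close> is separable.\<close>

definition controls :: "real \<Rightarrow> real set \<Rightarrow> (real \<Rightarrow> l2) set" where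
  "controls T U = {f. f \<in> borel_measurable (lebesgue_on {0<..<T}) \<and>
     integrable (lebesgue_on {0<..<T}) (\<lambda>t. (norm (f t))\<^sup>2) \<and> (\<forall>t\<in>{0<..<T}. f t \<in> L2_on U)}"

definition approx_controllable ::
  "real \<Rightarrow> real \<Rightarrow> real \<Rightarrow> real \<Rightarrow> real \<Rightarrow> real set \<Rightarrow> real \<Rightarrow> bool" where
  "approx_controllable a \<gamma> \<rho>\<^sub>s \<mu> \<kappa> U T \<longleftrightarrow>
     (\<forall>z0 \<in> UNIV \<times> UNIV \<times> L2m. \<forall>zT \<in> UNIV \<times> UNIV \<times> L2m. \<forall>\<epsilon>>0.
       \<exists>f\<in>controls T U. \<exists>z.
         mild_solution (A_dom a \<gamma> \<rho>\<^sub>s) (A_op a \<gamma> \<rho>\<^sub>s \<mu> \<kappa>) (\<lambda>t. (f t, 0, 0)) z0 T z \<and>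
         norm (z T - zT) < \<epsilon>)"

end

theory Submission
  imports Defs "HOL-Complex_Analysis.Complex_Analysis"
    "HOL-Computational_Algebra.Fundamental_Theorem_Algebra" "HOL-Real_Asymp.Real_Asymp"
begin

text \<open>
  In the orthonormal bases of cosines (for the density and the stress) and sines (for the velocity)
  the system splits into \<open>3 \<times> 3\<close> systems \<open>v' = M n v\<close>, uniformly dissipative in a weighted norm, and the
  semigroup acts mode by mode. By duality, controllability amounts to unique continuation: if
  \<open>\<zeta>\<close> is orthogonal to \<open>S t (f, 0, 0)\<close> for all \<open>f\<close> supported in the control region and \<open>0 \<le> t \<le> T\<close>,
  then \<open>\<zeta> = 0\<close>. For a fixed smooth \<open>f\<close> this inner product is a series \<open>H t\<close> of solutions of
  \<open>h''' + p h'' + n\<^sup>2 c\<^sup>2 h' + n\<^sup>2 c\<^sup>2 \<omega> h = 0\<close>, whose characteristic roots accumulate both at \<open>- \<omega>\<close>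
  and, along a vertical line, at infinity. Since \<open>H\<close> vanishes on \<open>[0, T]\<close>, the Laplace transforms
  of the solutions starting from the data at time \<open>0\<close> and at time \<open>T\<close> differ by the factor \<open>exp (- T z)\<close>.
  The factor \<open>k sinh (\<pi> k)\<close> with \<open>k\<^sup>2 = z\<^sup>2 (z + p) / (c\<^sup>2 (z + \<omega>))\<close> clears all poles and leaves
  functions that are holomorphic off \<open>- \<omega>\<close> and of size \<open>\<bar>z\<bar>\<^sup>2 exp (\<pi> \<bar>Re z\<bar> / c)\<close> at infinity. For
  \<open>T > 2 \<pi> / c\<close> this forces them to vanish, so no mode contributes a pole and every coefficient
  of \<open>\<zeta>\<close> vanishes.
\<close>

section \<open>Unique continuation for sums of third-order modes\<close>

text \<open>An expansion of \<open>H\<close> in exponentials is out of reach: for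
  \<open>n = 0\<close> the root 0 of the characteristic cubic is double, other modes may have
  multiple roots too, and the roots tending to the finite point \<open>- \<omega>\<close> leave no
  spectral gap. So no eigenvector appears. A mode enters only through the quotient of a quadratic
  polynomial by its cubic, and the aim is divisibility of the former by the latter, which takes care
  of multiplicities by itself. The factor \<open>k sinh (\<pi> k)\<close> comes from writing the
  cubic of mode \<open>n\<close> as a multiple of \<open>k\<^sup>2 + n\<^sup>2\<close>: its roots
  are the points where \<open>k\<close> is plus or minus \<open>\<i> n\<close>, and these are the
  zeros of one function common to all modes. The point \<open>- \<omega>\<close> may be an essential
  singularity. The vanishing argument therefore works in a neighbourhood of infinity only and
  reaches the rest of the plane by analytic continuation. What is left for a single mode is a Kalman
  condition: a vector in the density direction and its first two images under \<open>M n\<close>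
  span the mode for \<open>n \<ge> 1\<close>. For \<open>n = 0\<close> the mean of the stress
  evolves on its own, whence the restriction to \<open>L2m\<close>.\<close>

definition cosh_sqrt :: "complex \<Rightarrow> complex" where
  "cosh_sqrt w = cosh (csqrt w)"

lemma cosh_eq_cosh_sqrt: "cosh x = cosh_sqrt (x\<^sup>2)"
proof -
  have "csqrt (x\<^sup>2) = x \<or> csqrt (x\<^sup>2) = - x"
    using power2_eq_iff[of "csqrt (x\<^sup>2)" x] by simp
  then show ?thesis by (auto simp: cosh_sqrt_def)
qed

text \<open>A second formula for the same function. Here the cut lies on the positive half-line, so
  that it serves at the points of the negative one.\<close>

lemma cosh_sqrt_eq_cos: "cosh_sqrt w = cos (csqrt (- w))"
  using cosh_eq_cosh_sqrt[of "\<i> * csqrt (- w)"]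
  by (simp add: cosh_conv_cos power_mult_distrib)

text \<open>Since cosh is even, the sign jump of \<open>csqrt\<close> is invisible. The formula with
  cosh works off the negative half-line, the one with cos off the positive half-line, and continuity
  removes the singularity at 0.\<close>

lemma holomorphic_cosh_sqrt: "cosh_sqrt holomorphic_on UNIV"
proof (rule no_isolated_singularity'[where K = "{0}"])
  fix z :: complex assume "z \<in> {0}"
  then have z: "z = 0" by simp
  have "(csqrt \<longlongrightarrow> 0) (at 0)"
  proof (rule tendsto_norm_zero_cancel)
    have "((\<lambda>x::complex. sqrt (norm x)) \<longlongrightarrow> sqrt (norm (0::complex))) (at 0)"
      by (intro tendsto_real_sqrt tendsto_norm tendsto_ident_at)
    then show "((\<lambda>x. norm (csqrt x)) \<longlongrightarrow> 0) (at 0)" by simp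
  qed
  then have "((\<lambda>w. cosh (csqrt w)) \<longlongrightarrow> cosh 0) (at 0)"
    by (rule tendsto_cosh)
  then show "(cosh_sqrt \<longlongrightarrow> cosh_sqrt z) (at z within UNIV)"
    unfolding z cosh_sqrt_def by simp
next
  have "cosh_sqrt field_differentiable at w" if "w \<noteq> 0" for w
  proof (cases "w \<in> \<real>\<^sub>\<le>\<^sub>0")
    case False
    have "(\<lambda>w. cosh (csqrt w)) holomorphic_on (- \<real>\<^sub>\<le>\<^sub>0)"
      unfolding cosh_def by (intro holomorphic_intros) auto
    moreover have "open (- \<real>\<^sub>\<le>\<^sub>0 :: complex set)" by (simp add: open_Compl)
    ultimately have "(\<lambda>w. cosh (csqrt w)) field_differentiable at w"
      using False by (intro holomorphic_on_imp_differentiable_at) auto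
    then show ?thesis by (simp only: cosh_sqrt_def[abs_def])
  next
    case True
    have op: "open (- \<real>\<^sub>\<ge>\<^sub>0 :: complex set)" by (simp add: open_Compl)
    have "(\<lambda>w. cos (csqrt (- w))) holomorphic_on (- \<real>\<^sub>\<ge>\<^sub>0)"
      by (intro holomorphic_intros) (auto simp: complex_nonpos_Reals_iff complex_nonneg_Reals_iff)
    moreover have "w \<in> - \<real>\<^sub>\<ge>\<^sub>0" using True that
      by (auto simp: complex_nonpos_Reals_iff complex_nonneg_Reals_iff complex_eq_iff)
    ultimately have "(\<lambda>w. cos (csqrt (- w))) field_differentiable at w"
      using op holomorphic_on_imp_differentiable_at by blast
    then show ?thesis by (simp only: cosh_sqrt_eq_cos[abs_def])
  qed
  then show "cosh_sqrt holomorphic_on (UNIV - {0})"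
    by (auto simp: holomorphic_on_def intro: field_differentiable_at_within)
qed auto

section \<open>Cosine coefficients of hyperbolic cosines\<close>

lemma norm_cosh_le: "norm (cosh (z::complex)) \<le> exp \<bar>Re z\<bar>"
proof -
  have "norm (cosh z) \<le> (exp (Re z) + exp (- Re z)) / 2"
    unfolding cosh_def using norm_triangle_ineq[of "exp z" "exp (- z)"] by simp
  also have "\<dots> \<le> exp \<bar>Re z\<bar>" by (simp add: abs_if)
  finally show ?thesis .
qed

text \<open>For \<open>w = k\<^sup>2\<close> this is
  \<open>k sinh (\<pi> k) / (k\<^sup>2 + n\<^sup>2)\<close>. Written as a cosine coefficient of
  \<open>cosh (k (\<pi> - s))\<close>, it is entire without any discussion of removable
  singularities and bounded uniformly in \<open>n\<close>.\<close>

definition cosh_coeff :: "nat \<Rightarrow> complex \<Rightarrow> complex" where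
  "cosh_coeff n w = integral {0..pi} (\<lambda>s. of_real (cos (real n * s)) * cosh_sqrt (w * of_real ((pi - s)\<^sup>2)))"

lemma continuous_on_cosh_sqrt [continuous_intros]:
  "continuous_on A f \<Longrightarrow> continuous_on A (\<lambda>x. cosh_sqrt (f x))"
  using holomorphic_on_imp_continuous_on[OF holomorphic_cosh_sqrt]
  by (rule continuous_on_compose2) auto

lemma holomorphic_cosh_coeff: "cosh_coeff n holomorphic_on UNIV"
proof -
  let ?d = "deriv cosh_sqrt"
  have d: "(cosh_sqrt has_field_derivative ?d w) (at w)" for w
    using holomorphic_derivI[OF holomorphic_cosh_sqrt open_UNIV] by simp
  have "?d holomorphic_on UNIV"
    using holomorphic_deriv[OF holomorphic_cosh_sqrt open_UNIV] .
  from holomorphic_on_imp_continuous_on[OF this]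
  have dc: "continuous_on A f \<Longrightarrow> continuous_on A (\<lambda>x. ?d (f x))" for A and f :: "complex \<times> real \<Rightarrow> complex"
    by (rule continuous_on_compose2) auto
  have "(\<lambda>w. integral (cbox 0 pi) (\<lambda>s. of_real (cos (real n * s)) * cosh_sqrt (w * of_real ((pi - s)\<^sup>2)))) holomorphic_on UNIV"
  proof (rule leibniz_rule_holomorphic)
    show "((\<lambda>w. of_real (cos (real n * s)) * cosh_sqrt (w * of_real ((pi - s)\<^sup>2))) has_field_derivative
      of_real (cos (real n * s)) * (?d (w * of_real ((pi - s)\<^sup>2)) * of_real ((pi - s)\<^sup>2))) (at w within UNIV)" for w s
      by (intro DERIV_cmult DERIV_chain2[OF d]) (auto intro!: derivative_eq_intros)
    show "(\<lambda>s. of_real (cos (real n * s)) * cosh_sqrt (w * of_real ((pi - s)\<^sup>2))) integrable_on cbox 0 pi" for w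
      by (intro integrable_continuous continuous_intros)
    show "continuous_on (UNIV \<times> cbox 0 pi) (\<lambda>(w, s). of_real (cos (real n * s)) * (?d (w * of_real ((pi - s)\<^sup>2)) * of_real ((pi - s)\<^sup>2)))"
      unfolding case_prod_beta
      by (intro continuous_intros dc)
  qed auto
  then show ?thesis by (simp add: cosh_coeff_def[abs_def])
qed

lemma cosh_coeff_power2:
  "cosh_coeff n (k\<^sup>2) = integral {0..pi} (\<lambda>s. of_real (cos (real n * s)) * cosh (k * of_real (pi - s)))"
  unfolding cosh_coeff_def
  by (intro integral_cong) (simp add: cosh_eq_cosh_sqrt power_mult_distrib)

text \<open>Stated for an arbitrary square root \<open>k\<close> of the argument: near infinity a
  root close to \<open>z / c\<close> will be inserted, which need not be the principal one.\<close>

lemma norm_cosh_coeff_le: "norm (cosh_coeff n (k\<^sup>2)) \<le> pi * exp (pi * \<bar>Re k\<bar>)"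
proof -
  have "norm (integral {0..pi} (\<lambda>s. of_real (cos (real n * s)) * cosh (k * of_real (pi - s))))
      \<le> exp (pi * \<bar>Re k\<bar>) * (pi - 0)"
  proof (rule integral_bound)
    show "continuous_on {0..pi} (\<lambda>s. of_real (cos (real n * s)) * cosh (k * of_real (pi - s)))"
      by (simp only: cosh_def) (intro continuous_intros)
    fix s assume s: "s \<in> {0..pi}"
    have "norm (complex_of_real (cos (real n * s)) * cosh (k * of_real (pi - s))) \<le> 1 * exp \<bar>Re (k * of_real (pi - s))\<bar>"
      unfolding norm_mult by (intro mult_mono norm_cosh_le) auto
    also have "\<dots> \<le> exp (pi * \<bar>Re k\<bar>)"
      using s mult_right_mono[of "pi - s" pi "\<bar>Re k\<bar>"] by (simp add: abs_mult mult.commute)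
    finally show "norm (complex_of_real (cos (real n * s)) * cosh (k * of_real (pi - s))) \<le> exp (pi * \<bar>Re k\<bar>)" .
  qed simp
  then show ?thesis unfolding cosh_coeff_power2 by (simp add: mult.commute)
qed

text \<open>The right-hand side does not depend on \<open>n\<close>, so that one factor clears the poles of all modes.\<close>

lemma cosh_coeff_mult: "cosh_coeff n w * (w + of_nat n ^ 2) = csqrt w * sinh (csqrt w * pi)"
proof -
  define k where "k = csqrt w"
  have w: "w = k\<^sup>2" by (simp add: k_def)
  \<comment> \<open>The antiderivative that two integrations by parts produce. At \<open>pi\<close>
    both terms vanish, at 0 the value is \<open>- k sinh (\<pi> k)\<close>.\<close>
  let ?F = "\<lambda>s::real. - k * sinh (k * of_real (pi - s)) * of_real (cos (real n * s))
     + of_nat n * of_real (sin (real n * s)) * cosh (k * of_real (pi - s))"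
  have "((\<lambda>s. of_real (cos (real n * s)) * cosh (k * of_real (pi - s)) * (k\<^sup>2 + of_nat n ^ 2)) has_integral ?F pi - ?F 0) {0..pi}"
  proof (rule fundamental_theorem_of_calculus)
    fix s assume "s \<in> {0..pi}"
    show "(?F has_vector_derivative of_real (cos (real n * s)) * cosh (k * of_real (pi - s)) * (k\<^sup>2 + of_nat n ^ 2)) (at s within {0..pi})"
    proof -
      have "((\<lambda>z. sinh (k * (of_real pi - z))) has_field_derivative - k * cosh (k * (of_real pi - of_real s))) (at (of_real s))"
        by (auto intro!: derivative_eq_intros simp: algebra_simps)
      from has_vector_derivative_real_field[OF this]
      have 1: "((\<lambda>s::real. sinh (k * of_real (pi - s))) has_vector_derivative - k * cosh (k * of_real (pi - s))) (at s within {0..pi})"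
        by (simp only: of_real_diff)
      have "((\<lambda>z. cosh (k * (of_real pi - z))) has_field_derivative - k * sinh (k * (of_real pi - of_real s))) (at (of_real s))"
        by (auto intro!: derivative_eq_intros simp: algebra_simps)
      from has_vector_derivative_real_field[OF this]
      have 2: "((\<lambda>s::real. cosh (k * of_real (pi - s))) has_vector_derivative - k * sinh (k * of_real (pi - s))) (at s within {0..pi})"
        by (simp only: of_real_diff)
      have 3: "((\<lambda>s. complex_of_real (cos (real n * s))) has_vector_derivative of_real (- sin (real n * s) * n)) (at s within {0..pi})"
        by (rule has_vector_derivative_of_real) (auto intro!: derivative_eq_intros simp: has_real_derivative_iff_has_vector_derivative[symmetric])
      have 4: "((\<lambda>s. complex_of_real (sin (real n * s))) has_vector_derivative of_real (cos (real n * s) * n)) (at s within {0..pi})"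
        by (rule has_vector_derivative_of_real) (auto intro!: derivative_eq_intros simp: has_real_derivative_iff_has_vector_derivative[symmetric])
      show ?thesis
        using has_vector_derivative_add[OF
          has_vector_derivative_mult[OF has_vector_derivative_mult_right[OF 1, of "- k"] 3]
          has_vector_derivative_mult[OF has_vector_derivative_mult_right[OF 4, of "of_nat n"] 2]]
        by (simp add: algebra_simps power2_eq_square)
    qed
  qed simp
  then have "integral {0..pi} (\<lambda>s. of_real (cos (real n * s)) * cosh (k * of_real (pi - s)) * (k\<^sup>2 + of_nat n ^ 2)) = ?F pi - ?F 0"
    by (rule integral_unique)
  then have "cosh_coeff n (k\<^sup>2) * (k\<^sup>2 + of_nat n ^ 2) = k * sinh (k * pi)"
    unfolding cosh_coeff_power2 by simp
  then show ?thesis unfolding k_def by simp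
qed

text \<open>With \<open>k = \<i> n\<close> the hyperbolic cosine becomes
  \<open>(-1) ^ n * cos (n s)\<close>, and the integral of \<open>cos\<^sup>2\<close> is positive.
  Thus clearing the poles of mode \<open>n\<close> leaves a nonzero coefficient there, and the mode
  stays visible in the cleared series.\<close>

lemma cosh_coeff_neg_square_nz: "cosh_coeff n (- (of_nat n ^ 2)) \<noteq> 0"
proof -
  have "cosh_coeff n ((\<i> * of_nat n)\<^sup>2) = integral {0..pi} (\<lambda>s. of_real ((-1) ^ n * (cos (real n * s))\<^sup>2))"
    unfolding cosh_coeff_power2
  proof (rule integral_cong)
    fix s assume "s \<in> {0..pi}"
    have "cosh (\<i> * of_nat n * of_real (pi - s)) = cosh (\<i> * complex_of_real (real n * (pi - s)))"
      by (simp add: mult.assoc)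
    also have "\<dots> = of_real (cos (real n * (pi - s)))"
      unfolding cosh_conv_cos by (simp add: cos_of_real del: of_real_mult of_real_diff)
    also have "cos (real n * (pi - s)) = (-1) ^ n * cos (real n * s)"
      unfolding right_diff_distrib cos_diff by simp
    finally show "of_real (cos (real n * s)) * cosh (\<i> * of_nat n * of_real (pi - s)) = complex_of_real ((-1) ^ n * (cos (real n * s))\<^sup>2)"
      by (simp only: power2_eq_square of_real_mult mult_ac)
  qed
  also have "\<dots> = of_real (integral {0..pi} (\<lambda>s. (-1) ^ n * (cos (real n * s))\<^sup>2))"
    by (rule integral_linear[OF integrable_continuous_real bounded_linear_of_real, unfolded o_def])
       (intro continuous_intros)
  also have "\<dots> = of_real ((-1) ^ n * integral {0..pi} (\<lambda>s. (cos (real n * s))\<^sup>2))"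
    by simp
  finally have eq: "cosh_coeff n ((\<i> * of_nat n)\<^sup>2) = of_real ((-1) ^ n * integral {0..pi} (\<lambda>s. (cos (real n * s))\<^sup>2))" .
  have "integral {0..pi} (\<lambda>s. (cos (real n * s))\<^sup>2) \<noteq> 0"
  proof
    assume "integral {0..pi} (\<lambda>s. (cos (real n * s))\<^sup>2) = 0"
    moreover have "continuous_on {0..pi} (\<lambda>s. (cos (real n * s))\<^sup>2)"
      by (intro continuous_intros)
    ultimately have "\<forall>s\<in>{0..pi}. (cos (real n * s))\<^sup>2 = 0"
      by (subst (asm) integral_eq_0_iff) auto
    from this[rule_format, of 0] show False by simp
  qed
  then show ?thesis using eq by (simp add: power_mult_distrib)
qed

text \<open>Linear factors of \<open>Q\<close> are split off one at a time: the local bound forces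
  \<open>P\<close> to vanish at a root of \<open>Q\<close>, and cancelling the common factor
  preserves the bound near every point. A multiple root is simply met several times, so that no
  order of vanishing has to be computed.\<close>

lemma poly_dvd_if_locally_bounded_quotient:
  fixes P Q :: "complex poly"
  assumes "Q \<noteq> 0"
    and "\<And>l. poly Q l = 0 \<Longrightarrow> \<exists>C. \<forall>\<^sub>F z in at l. norm (poly P z) \<le> C * norm (poly Q z)"
  shows "Q dvd P"
  using assms
proof (induction "degree Q" arbitrary: P Q)
  case 0
  then show ?case by (metis is_unit_iff_degree unit_imp_dvd)
next
  case (Suc n)
  then have "\<not> constant (poly Q)" by (simp add: constant_degree)
  then obtain l where l: "poly Q l = 0" using fundamental_theorem_of_algebra by blast
  then obtain Q' where Q': "Q = [:-l, 1:] * Q'" unfolding poly_eq_0_iff_dvd by (auto elim: dvdE)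
  obtain C where C: "\<forall>\<^sub>F z in at l. norm (poly P z) \<le> C * norm (poly Q z)" using Suc.prems(2)[OF l] by blast
  \<comment> \<open>The bound is given near \<open>l\<close> but not at \<open>l\<close>; continuity
    carries it there, where the right-hand side is 0.\<close>
  have "norm (poly P l) \<le> C * norm (poly Q l)"
    by (rule tendsto_le[OF _ _ _ C]) (auto intro!: tendsto_intros isContD[OF poly_isCont])
  then have "poly P l = 0" using l by simp
  then obtain P' where P': "P = [:-l, 1:] * P'" unfolding poly_eq_0_iff_dvd by (auto elim: dvdE)
  have "Q' \<noteq> 0" using Q' Suc.prems(1) by auto
  then have "degree Q = 1 + degree Q'" unfolding Q' by (subst degree_mult_eq) auto
  then have dQ': "n = degree Q'" using Suc.hyps(2) by simp
  have "Q' dvd P'"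
  proof (rule Suc.hyps(1)[OF dQ' \<open>Q' \<noteq> 0\<close>])
    fix m assume "poly Q' m = 0"
    then obtain C where "\<forall>\<^sub>F z in at m. norm (poly P z) \<le> C * norm (poly Q z)"
      using Suc.prems(2)[of m] Q' by auto
    moreover have "\<forall>\<^sub>F z in at m. z \<noteq> l"
      by (rule eventually_neq_at_within)
    ultimately have "\<forall>\<^sub>F z in at m. norm (poly P' z) \<le> C * norm (poly Q' z)"
    proof eventually_elim
      case (elim z)
      then have "norm (z - l) * norm (poly P' z) \<le> norm (z - l) * (C * norm (poly Q' z))"
        by (simp add: P' Q' norm_mult algebra_simps flip: norm_mult)
      then show ?case using elim by simp
    qed
    then show "\<exists>C. \<forall>\<^sub>F z in at m. norm (poly P' z) \<le> C * norm (poly Q' z)" by blast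
  qed
  then show ?case unfolding P' Q' by (rule mult_dvd_mono[OF dvd_refl])
qed

text \<open>In the variable \<open>1 / z\<close> polynomial growth leaves a singularity that a power
  removes. Unless the resulting function is constant, it has a zero of finite order at 0, whereas
  \<open>exp (- e / x)\<close> tends to 0 faster than any power of \<open>x\<close>. Nothing is
  assumed inside the disc of radius \<open>R\<close>, which will contain
  \<open>- \<omega>\<close>.\<close>

lemma holomorphic_eq_0_if_decaying_at_infinity:
  fixes f :: "complex \<Rightarrow> complex"
  assumes hol: "f holomorphic_on {z. R < norm z}" and R: "R > 0" and e: "e > 0"
    and bound: "\<And>z. R < norm z \<Longrightarrow> norm (f z) \<le> C * (norm z)\<^sup>2"
    and decay: "\<And>x. R < x \<Longrightarrow> norm (f (of_real x)) \<le> C * x\<^sup>2 * exp (- e * x)"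
    and z: "R < norm z"
  shows "f z = 0"
proof -
  \<comment> \<open>One power more than the growth exponent 2, so that \<open>h\<close> is
    continuous at 0 with value 0.\<close>
  define h where "h w = (if w = 0 then 0 else w ^ 3 * f (1 / w))" for w
  let ?B = "ball (0::complex) (1 / R)"
  have nB: "R < norm (1 / w)" if "w \<in> ?B" "w \<noteq> 0" for w
    using that R by (simp add: norm_divide field_simps)
  have hb: "norm (h w) \<le> C * norm w" if "w \<in> ?B" for w
  proof (cases "w = 0")
    case False
    have "norm (h w) = norm w ^ 3 * norm (f (1 / w))"
      using False by (simp add: h_def norm_mult norm_power)
    also have "\<dots> \<le> norm w ^ 3 * (C * (norm (1 / w))\<^sup>2)"
      by (intro mult_left_mono bound nB that False) simp
    also have "\<dots> = C * norm w"
      using False by (simp add: norm_divide field_simps power2_eq_square power3_eq_cube)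
    finally show ?thesis .
  qed (simp add: h_def)
  have hol_h: "h holomorphic_on ?B"
  proof (rule no_isolated_singularity'[where K = "{0}"])
    fix w :: complex assume "w \<in> {0}"
    then have w: "w = 0" by simp
    have "(h \<longlongrightarrow> 0) (at 0 within ?B)"
    proof (rule Lim_null_comparison)
      show "\<forall>\<^sub>F w in at 0 within ?B. norm (h w) \<le> C * norm w"
        using hb by (auto simp: eventually_at_filter)
      show "((\<lambda>w::complex. C * norm w) \<longlongrightarrow> 0) (at 0 within ?B)"
        by (auto intro!: tendsto_eq_intros)
    qed
    then show "(h \<longlongrightarrow> h w) (at w within ?B)" by (simp add: w h_def)
  next
    have "(\<lambda>w. w ^ 3 * f (1 / w)) holomorphic_on (?B - {0})"
    proof (intro holomorphic_intros)
      have "(\<lambda>w::complex. 1 / w) holomorphic_on (?B - {0})" by (intro holomorphic_intros) auto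
      moreover have "(\<lambda>w. 1 / w) ` (?B - {0}) \<subseteq> {z. R < norm z}" using nB by blast
      ultimately show "(\<lambda>w. f (1 / w)) holomorphic_on (?B - {0})"
        using holomorphic_on_compose_gen[OF _ hol] by (simp add: o_def)
    qed
    then show "h holomorphic_on (?B - {0})"
      by (rule holomorphic_transform) (auto simp: h_def)
  qed auto
  have "h constant_on ?B"
  proof (rule ccontr)
    assume nc: "\<not> h constant_on ?B"
    obtain g r n where g: "0 < n" "0 < r" "ball 0 r \<subseteq> ?B" "g holomorphic_on ball 0 r"
      "\<And>w. w \<in> ball 0 r \<Longrightarrow> h w = (w - 0) ^ n * g w" "\<And>w. w \<in> ball 0 r \<Longrightarrow> g w \<noteq> 0"
      by (rule holomorphic_factor_zero_nonconstant[OF hol_h _ _ _ _ nc, of 0])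
         (use R in \<open>auto simp: h_def\<close>)
    have "isCont g 0"
      using g(2,4) by (intro continuous_on_interior[OF holomorphic_on_imp_continuous_on[OF g(4)]]) auto
    then have 1: "(\<lambda>x::real. g (of_real x)) \<midarrow>0\<rightarrow> g 0"
      by (intro isCont_tendsto_compose[of 0 g]) (auto intro!: tendsto_eq_intros)
    then have 1: "((\<lambda>x::real. g (of_real x)) \<longlongrightarrow> g 0) (at_right 0)"
      by (rule tendsto_within_subset) auto
    \<comment> \<open>Along the positive reals the exponential decay survives the division by
      \<open>x ^ n\<close>, contrary to \<open>g 0 \<noteq> 0\<close>.\<close>
    have "((\<lambda>x::real. g (of_real x)) \<longlongrightarrow> 0) (at_right 0)"
    proof (rule Lim_null_comparison)
      show "\<forall>\<^sub>F x::real in at_right 0. norm (g (of_real x)) \<le> C * inverse e ^ n * ((e / x) ^ n / exp (e / x))"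
      proof (rule eventually_at_rightI)
        fix x :: real assume "x \<in> {0<..<min 1 (min r (1 / R))}"
        then have x: "0 < x" "x < 1" "x < r" "x < 1 / R" by auto
        have xb: "complex_of_real x \<in> ball 0 r" using x by simp
        have Rx: "R < 1 / x" using x R by (simp add: field_simps)
        have "x ^ n * norm (g (of_real x)) = norm (h (of_real x))"
          using g(5)[OF xb] x by (simp add: norm_mult norm_power)
        also have "\<dots> = x ^ 3 * norm (f (of_real (1 / x)))"
          using x by (simp add: h_def norm_mult norm_power)
        also have "\<dots> \<le> x ^ 3 * (C * (1 / x)\<^sup>2 * exp (- e * (1 / x)))"
          using x by (intro mult_left_mono decay Rx) auto
        also have "\<dots> = x * (C * exp (- e / x))"
          using x by (simp add: field_simps power2_eq_square power3_eq_cube)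
        also have "\<dots> \<le> 1 * (C * exp (- e / x))"
        proof (rule mult_right_mono)
          have "0 \<le> C * (1 / x)\<^sup>2 * exp (- e * (1 / x))"
            using decay[OF Rx] norm_ge_zero order_trans by blast
          then show "0 \<le> C * exp (- e / x)" using x by (simp add: zero_le_mult_iff)
        qed (use x in auto)
        finally have "x ^ n * norm (g (of_real x)) \<le> C * exp (- e / x)" by simp
        then have "norm (g (of_real x)) \<le> C * exp (- e / x) / x ^ n"
          using x by (simp add: field_simps)
        also have "\<dots> = C * inverse e ^ n * ((e / x) ^ n / exp (e / x))"
          using x e by (simp add: field_simps exp_minus)
        finally show "norm (g (of_real x)) \<le> C * inverse e ^ n * ((e / x) ^ n / exp (e / x))" .
      qed (use R g(2) in simp)
      have "filterlim (\<lambda>x::real. e / x) at_top (at_right 0)"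
        using e by real_asymp
      from filterlim_compose[OF tendsto_power_div_exp_0[of n] this]
      show "((\<lambda>x. C * inverse e ^ n * ((e / x) ^ n / exp (e / x))) \<longlongrightarrow> 0) (at_right 0)"
        by (rule tendsto_mult_right_zero)
    qed
    with 1 have "g 0 = 0" by (intro tendsto_unique[of "at_right (0::real)"]) auto
    with g(2,6) show False by auto
  qed
  then obtain y where y: "\<And>w. w \<in> ?B \<Longrightarrow> h w = y" unfolding constant_on_def by blast
  have "y = 0" using y[of 0] R by (simp add: h_def)
  have "norm z > 0" using z R by linarith
  then have "z \<noteq> 0" "1 / z \<in> ?B" using z R by (auto simp: norm_divide field_simps)
  with y[of "1 / z"] show ?thesis by (simp add: h_def \<open>y = 0\<close>)
qed

text \<open>The difference \<open>m - 1\<close> is the product of \<open>csqrt m - 1\<close> and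
  \<open>csqrt m + 1\<close>, and the second factor has real part at least 1 because the principal
  root lies in the right half plane.\<close>

lemma norm_csqrt_minus_1_le: "norm (csqrt m - 1) \<le> norm (m - 1)"
proof -
  have "1 \<le> Re (csqrt m + 1)" using Re_csqrt[of m] by simp
  then have "1 \<le> norm (csqrt m + 1)" using complex_Re_le_cmod order_trans by blast
  then have "norm (csqrt m - 1) * 1 \<le> norm (csqrt m - 1) * norm (csqrt m + 1)"
    by (intro mult_left_mono) auto
  also have "\<dots> = norm ((csqrt m)\<^sup>2 - 1)"
    by (simp add: norm_mult[symmetric] power2_eq_square algebra_simps)
  finally show ?thesis by simp
qed

text \<open>Here \<open>f1\<close> and \<open>f2\<close> are the first two derivatives of the mode
  \<open>f0\<close>, and \<open>g\<close> stands for the coefficients of a smooth control profile.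
  Each derivative may cost one power of \<open>1 + n\<close>; the decay of order 4 of
  \<open>g\<close> then still leaves absolutely convergent series.\<close>

locale third_order_modes =
  fixes c p \<omega> T K :: real and f0 f1 f2 :: "nat \<Rightarrow> real \<Rightarrow> complex" and g :: "nat \<Rightarrow> complex"
  assumes c: "0 < c" and \<omega>: "0 < \<omega>" "\<omega> < p" and T: "2 * pi / c < T"
    and deriv_f0: "\<And>n t. t \<in> {0..T} \<Longrightarrow> (f0 n has_vector_derivative f1 n t) (at t within {0..T})"
    and deriv_f1: "\<And>n t. t \<in> {0..T} \<Longrightarrow> (f1 n has_vector_derivative f2 n t) (at t within {0..T})"
    and deriv_f2: "\<And>n t. t \<in> {0..T} \<Longrightarrow> (f2 n has_vector_derivative
          - (of_real p * f2 n t + of_real ((n * c)\<^sup>2) * f1 n t + of_real ((n * c)\<^sup>2 * \<omega>) * f0 n t)) (at t within {0..T})"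
    and f0_le: "\<And>n t. t \<in> {0..T} \<Longrightarrow> norm (f0 n t) \<le> K"
    and f1_le: "\<And>n t. t \<in> {0..T} \<Longrightarrow> norm (f1 n t) \<le> K * (1 + real n)"
    and f2_le: "\<And>n t. t \<in> {0..T} \<Longrightarrow> norm (f2 n t) \<le> K * (1 + real n)\<^sup>2"
    and g_le: "\<And>n. norm (g n) \<le> K / (1 + real n) ^ 4"
    and sums_0: "\<And>t. t \<in> {0..T} \<Longrightarrow> (\<lambda>n. g n * f0 n t) sums 0"
begin

section \<open>Laplace transforms of single modes\<close>

lemma T_pos: "0 < T"
proof -
  have "0 < 2 * pi / c" using c by simp
  then show ?thesis using T by linarith
qed

lemma K_nonneg: "0 \<le> K"
  using order_trans[OF norm_ge_zero f0_le[of 0 0]] T_pos by simp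

definition charpoly :: "nat \<Rightarrow> complex \<Rightarrow> complex" where
  "charpoly n z = z ^ 3 + of_real p * z\<^sup>2 + of_real ((n * c)\<^sup>2) * (z + of_real \<omega>)"

text \<open>The numerator, over the denominator \<open>charpoly n\<close>, of the Laplace transform
  of the solution that starts at time 0 with the data of mode \<open>n\<close> at time
  \<open>t\<close>.\<close>

definition P :: "nat \<Rightarrow> real \<Rightarrow> complex \<Rightarrow> complex" where
  "P n t z = (z\<^sup>2 + of_real p * z + of_real ((n * c)\<^sup>2)) * f0 n t + (z + of_real p) * f1 n t + f2 n t"

text \<open>The equation \<open>charpoly n z = 0\<close> solved for \<open>- n\<^sup>2\<close>: one
  function describes the roots of all modes. The \<open>k\<close> of the overview is a square root
  of it.\<close>

definition q :: "complex \<Rightarrow> complex" where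
  "q z = z\<^sup>2 * (z + of_real p) / (of_real (c\<^sup>2) * (z + of_real \<omega>))"

text \<open>The sum of the transforms \<open>g n * P n t z / charpoly n z\<close>, multiplied by
  \<open>c\<^sup>2 (z + \<omega>) k sinh (\<pi> k)\<close>. In this form no term has a pole away
  from \<open>- \<omega>\<close>.\<close>

definition G :: "real \<Rightarrow> complex \<Rightarrow> complex" where
  "G t z = (\<Sum>n. g n * P n t z * cosh_coeff n (q z))"

lemma charpoly_eq: "z \<noteq> - of_real \<omega> \<Longrightarrow> charpoly n z = of_real (c\<^sup>2) * (z + of_real \<omega>) * (q z + of_nat n ^ 2)"
proof -
  assume "z \<noteq> - of_real \<omega>"
  then have "of_real (c\<^sup>2) * (z + of_real \<omega>) \<noteq> 0"
    using c by (simp add: add_eq_0_iff2)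
  then have "of_real (c\<^sup>2) * (z + of_real \<omega>) * q z = z\<^sup>2 * (z + of_real p)"
    unfolding q_def by simp
  then show ?thesis
    by (simp add: charpoly_def distrib_left power2_eq_square power3_eq_cube mult_ac)
qed

lemma cosh_coeff_charpoly:
  "z \<noteq> - of_real \<omega> \<Longrightarrow> cosh_coeff n (q z) * charpoly n z
     = of_real (c\<^sup>2) * (z + of_real \<omega>) * (csqrt (q z) * sinh (csqrt (q z) * pi))"
  using cosh_coeff_mult[of n "q z"] by (simp add: charpoly_eq mult_ac)

text \<open>By the differential equation, the derivative of \<open>exp (- z t) * P n t z\<close> in
  \<open>t\<close> is \<open>- charpoly n z * exp (- z t) * f0 n t\<close>. This packs three
  integrations by parts into one application of the fundamental theorem.\<close>

lemma laplace_f0: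
  "charpoly n z * integral {0..T} (\<lambda>t. exp (- z * of_real t) * f0 n t) = P n 0 z - exp (- z * of_real T) * P n T z"
proof -
  have "((\<lambda>t. - (charpoly n z * (exp (- z * of_real t) * f0 n t))) has_integral
      exp (- z * of_real T) * P n T z - exp (- z * of_real 0) * P n 0 z) {0..T}"
  proof (rule fundamental_theorem_of_calculus)
    show "0 \<le> T" using T_pos by simp
    fix t assume t: "t \<in> {0..T}"
    have "((\<lambda>w. exp (- z * w)) has_field_derivative - z * exp (- z * of_real t)) (at (of_real t))"
      by (auto intro!: derivative_eq_intros)
    from has_vector_derivative_real_field[OF this]
    have e: "((\<lambda>t::real. exp (- z * of_real t)) has_vector_derivative - z * exp (- z * of_real t)) (at t within {0..T})" .
    have "((\<lambda>t. P n t z) has_vector_derivative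
       (z\<^sup>2 + of_real p * z + of_real ((n * c)\<^sup>2)) * f1 n t + (z + of_real p) * f2 n t
       + - (of_real p * f2 n t + of_real ((n * c)\<^sup>2) * f1 n t + of_real ((n * c)\<^sup>2 * \<omega>) * f0 n t)) (at t within {0..T})"
      unfolding P_def
      by (intro has_vector_derivative_add has_vector_derivative_mult_right deriv_f0 deriv_f1 deriv_f2 t)
    from has_vector_derivative_mult[OF e this]
    show "((\<lambda>t. exp (- z * of_real t) * P n t z) has_vector_derivative
        - (charpoly n z * (exp (- z * of_real t) * f0 n t))) (at t within {0..T})"
      by (rule has_vector_derivative_eq_rhs)
         (simp add: P_def charpoly_def algebra_simps power2_eq_square power3_eq_cube)
  qed
  from integral_unique[OF this] show ?thesis
    unfolding integral_neg integral_mult_right by (simp add: algebra_simps)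
qed

text \<open>The decay of order 4 of \<open>g\<close> absorbs the growth of order 2 of
  \<open>P\<close> in \<open>n\<close> and leaves a summable factor. The growth in \<open>z\<close>
  is quadratic, which is the exponent in
  \<open>holomorphic_eq_0_if_decaying_at_infinity\<close>.\<close>

lemma norm_gP_le:
  assumes t: "t \<in> {0..T}"
  shows "norm (g n * P n t z) \<le> K\<^sup>2 * (c\<^sup>2 + p + 1) * (1 + norm z)\<^sup>2 * inverse ((real (Suc n))\<^sup>2)"
proof -
  let ?N = "1 + real n" and ?r = "norm z"
  have p: "p > 0" using \<omega> by linarith
  have N: "1 \<le> ?N" "?N \<le> ?N\<^sup>2" "(real n)\<^sup>2 \<le> ?N\<^sup>2" "1 \<le> ?N\<^sup>2"
    using power_increasing[of 1 2 ?N] by (auto intro!: power_mono)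
  have "norm (P n t z) \<le> norm (z\<^sup>2 + of_real p * z + of_real ((n * c)\<^sup>2)) * norm (f0 n t)
        + norm (z + of_real p) * norm (f1 n t) + norm (f2 n t)"
    unfolding P_def norm_mult[symmetric] by (intro norm_triangle_le add_mono order_refl)
  also have "\<dots> \<le> (?r\<^sup>2 + p * ?r + (n * c)\<^sup>2) * K + (?r + p) * (K * ?N) + K * ?N\<^sup>2"
  proof (intro add_mono mult_mono f0_le f1_le f2_le t)
    show "norm (z\<^sup>2 + of_real p * z + of_real ((n * c)\<^sup>2)) \<le> ?r\<^sup>2 + p * ?r + (n * c)\<^sup>2"
      using p by (intro norm_triangle_le add_mono) (auto simp: norm_power norm_mult power_mult_distrib)
    show "norm (z + of_real p) \<le> ?r + p" using p by (intro norm_triangle_le) auto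
  qed (use p in auto)
  also have "\<dots> \<le> (?r\<^sup>2 * ?N\<^sup>2 + p * ?r * ?N\<^sup>2 + c\<^sup>2 * ?N\<^sup>2) * K + (?r + p) * (K * ?N\<^sup>2) + K * ?N\<^sup>2"
  proof (intro add_mono mult_right_mono mult_left_mono)
    show "?r\<^sup>2 \<le> ?r\<^sup>2 * ?N\<^sup>2" "p * ?r \<le> p * ?r * ?N\<^sup>2"
      using mult_left_mono[OF N(4), of "?r\<^sup>2"] mult_left_mono[OF N(4), of "p * ?r"] p by simp_all
    show "(real n * c)\<^sup>2 \<le> c\<^sup>2 * ?N\<^sup>2"
      using mult_right_mono[OF N(3), of "c\<^sup>2"] by (simp add: power_mult_distrib mult.commute)
  qed (use N p K_nonneg in auto)
  also have "\<dots> = K * ?N\<^sup>2 * (?r\<^sup>2 + (p + 1) * ?r + (c\<^sup>2 + p + 1))"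
    by (simp add: algebra_simps)
  also have "\<dots> \<le> K * ?N\<^sup>2 * ((c\<^sup>2 + p + 1) * (1 + ?r)\<^sup>2)"
  proof (rule mult_left_mono)
    have "(c\<^sup>2 + p + 1) * (1 + ?r)\<^sup>2 - (?r\<^sup>2 + (p + 1) * ?r + (c\<^sup>2 + p + 1))
        = (c\<^sup>2 + p) * ?r\<^sup>2 + (2 * c\<^sup>2 + p + 1) * ?r"
      by (simp add: power2_eq_square algebra_simps)
    moreover have "\<dots> \<ge> 0" using p by (intro add_nonneg_nonneg mult_nonneg_nonneg) auto
    ultimately show "?r\<^sup>2 + (p + 1) * ?r + (c\<^sup>2 + p + 1) \<le> (c\<^sup>2 + p + 1) * (1 + ?r)\<^sup>2" by linarith
  qed (use K_nonneg in auto)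
  finally have P: "norm (P n t z) \<le> K * ?N\<^sup>2 * ((c\<^sup>2 + p + 1) * (1 + ?r)\<^sup>2)" .
  have "norm (g n * P n t z) \<le> (K / ?N ^ 4) * (K * ?N\<^sup>2 * ((c\<^sup>2 + p + 1) * (1 + ?r)\<^sup>2))"
    unfolding norm_mult using K_nonneg by (intro mult_mono g_le P) auto
  also have "\<dots> = K\<^sup>2 * (c\<^sup>2 + p + 1) * (1 + ?r)\<^sup>2 * inverse ((real (Suc n))\<^sup>2)"
  proof -
    have "?N ^ 4 = ?N\<^sup>2 * ?N\<^sup>2" by (simp flip: power_add)
    then show ?thesis by (simp add: power2_eq_square[of K] divide_simps)
  qed
  finally show ?thesis .
qed

section \<open>The cleared series: holomorphy, functional equation and behaviour at infinity\<close>

lemma summable_inverse_Suc_squares: "summable (\<lambda>n. inverse ((real (Suc n))\<^sup>2))"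
  using inverse_power_summable[of 2, where 'a = real] by (subst summable_Suc_iff) auto

lemma norm_gPD_le:
  assumes "t \<in> {0..T}" "k\<^sup>2 = q z"
  shows "norm (g n * P n t z * cosh_coeff n (q z))
     \<le> K\<^sup>2 * (c\<^sup>2 + p + 1) * (1 + norm z)\<^sup>2 * (pi * exp (pi * \<bar>Re k\<bar>)) * inverse ((real (Suc n))\<^sup>2)"
proof -
  have "norm (g n * P n t z) * norm (cosh_coeff n (q z))
     \<le> (K\<^sup>2 * (c\<^sup>2 + p + 1) * (1 + norm z)\<^sup>2 * inverse ((real (Suc n))\<^sup>2)) * (pi * exp (pi * \<bar>Re k\<bar>))"
    using \<omega> by (intro mult_mono norm_gP_le assms) (auto simp: norm_cosh_coeff_le assms(2)[symmetric])
  then show ?thesis by (simp add: norm_mult mult_ac)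
qed

lemma summable_G: "t \<in> {0..T} \<Longrightarrow> summable (\<lambda>n. g n * P n t z * cosh_coeff n (q z))"
  using norm_gPD_le[of t "csqrt (q z)" z]
  by (intro summable_comparison_test'[OF summable_mult[OF summable_inverse_Suc_squares]]) auto

lemma norm_G_le:
  assumes "t \<in> {0..T}" "k\<^sup>2 = q z"
  shows "norm (G t z) \<le> K\<^sup>2 * (c\<^sup>2 + p + 1) * (1 + norm z)\<^sup>2 * (pi * exp (pi * \<bar>Re k\<bar>)) * (\<Sum>n. inverse ((real (Suc n))\<^sup>2))"
  unfolding G_def suminf_mult[OF summable_inverse_Suc_squares, symmetric]
  by (intro norm_suminf_le norm_gPD_le assms summable_mult summable_inverse_Suc_squares)

lemma holomorphic_q: "q holomorphic_on - {- of_real \<omega>}"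
  unfolding q_def[abs_def] using c by (intro holomorphic_intros) (auto simp: add_eq_0_iff2)

text \<open>On a closed disc that avoids \<open>- \<omega>\<close> the function \<open>q\<close> is
  bounded, hence so are the coefficients, uniformly in \<open>n\<close>, and the series converges
  uniformly. At \<open>- \<omega>\<close> itself \<open>q\<close> has a pole.\<close>

lemma holomorphic_G:
  assumes t: "t \<in> {0..T}"
  shows "G t holomorphic_on - {- of_real \<omega>}"
proof (rule holomorphic_uniform_sequence)
  show "open (- {- complex_of_real \<omega>})" by auto
  have "(\<lambda>z. cosh_coeff n (q z)) holomorphic_on - {- of_real \<omega>}" for n
    using holomorphic_on_compose_gen[OF holomorphic_q holomorphic_cosh_coeff[of n]] by (simp add: o_def)
  then show "(\<lambda>z. \<Sum>n<N. g n * P n t z * cosh_coeff n (q z)) holomorphic_on - {- of_real \<omega>}" for N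
    unfolding P_def by (intro holomorphic_intros)
  fix x assume x: "x \<in> - {- complex_of_real \<omega>}"
  then obtain d where d: "d > 0" "cball x d \<subseteq> - {- complex_of_real \<omega>}"
    using open_contains_cball[of "- {- complex_of_real \<omega>}"] by auto
  have "compact (q ` cball x d)"
    by (intro compact_continuous_image holomorphic_on_imp_continuous_on holomorphic_on_subset[OF holomorphic_q d(2)]) auto
  then obtain B where B: "\<And>z. z \<in> cball x d \<Longrightarrow> norm (q z) \<le> B"
    using compact_imp_bounded bounded_pos by (metis image_eqI)
  let ?C = "K\<^sup>2 * (c\<^sup>2 + p + 1) * (1 + (norm x + d))\<^sup>2 * (pi * exp (pi * sqrt B))"
  have "uniform_limit (cball x d) (\<lambda>N z. \<Sum>n<N. g n * P n t z * cosh_coeff n (q z))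
      (\<lambda>z. \<Sum>n. g n * P n t z * cosh_coeff n (q z)) sequentially"
  proof (rule Weierstrass_m_test)
    show "summable (\<lambda>n. ?C * inverse ((real (Suc n))\<^sup>2))"
      by (intro summable_mult summable_inverse_Suc_squares)
    fix n z assume z: "z \<in> cball x d"
    have "\<bar>Re (csqrt (q z))\<bar> \<le> norm (csqrt (q z))" by (rule abs_Re_le_cmod)
    also have "\<dots> \<le> sqrt B" using B[OF z] by simp
    finally have 1: "\<bar>Re (csqrt (q z))\<bar> \<le> sqrt B" .
    have "norm z \<le> norm x + norm (z - x)" by (rule norm_triangle_sub)
    then have 2: "norm z \<le> norm x + d" using z by (simp add: dist_norm norm_minus_commute)
    have "norm (g n * P n t z * cosh_coeff n (q z))
      \<le> K\<^sup>2 * (c\<^sup>2 + p + 1) * (1 + norm z)\<^sup>2 * (pi * exp (pi * \<bar>Re (csqrt (q z))\<bar>)) * inverse ((real (Suc n))\<^sup>2)"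
      using t by (intro norm_gPD_le) auto
    also have "\<dots> \<le> ?C * inverse ((real (Suc n))\<^sup>2)"
      using 1 2 \<omega> d(1) by (intro mult_mono mult_left_mono power_mono) auto
    finally show "norm (g n * P n t z * cosh_coeff n (q z)) \<le> ?C * inverse ((real (Suc n))\<^sup>2)" .
  qed
  with d show "\<exists>d>0. cball x d \<subseteq> - {- complex_of_real \<omega>} \<and>
      uniform_limit (cball x d) (\<lambda>N z. \<Sum>n<N. g n * P n t z * cosh_coeff n (q z)) (G t) sequentially"
    unfolding G_def[abs_def] by blast
qed

text \<open>The decay of \<open>g\<close> makes the vanishing sum uniformly convergent in
  \<open>t\<close>, so it may be integrated term by term.\<close>

lemma sums_laplace: "(\<lambda>n. g n * integral {0..T} (\<lambda>t. exp (- z * of_real t) * f0 n t)) sums 0"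
proof -
  have cont: "continuous_on {0..T} (f0 n)" for n
    by (rule continuous_on_vector_derivative[OF deriv_f0])
  have cont2: "continuous_on {0..T} (\<lambda>t. exp (- z * of_real t) * f0 n t)" for n
    by (intro continuous_intros cont)
  have "uniform_limit {0..T} (\<lambda>N t. \<Sum>n<N. g n * (exp (- z * of_real t) * f0 n t))
     (\<lambda>t. \<Sum>n. g n * (exp (- z * of_real t) * f0 n t)) sequentially"
  proof (rule Weierstrass_m_test)
    show "summable (\<lambda>n. K * (exp (norm z * T) * K) * inverse ((real (Suc n))\<^sup>2))"
      by (intro summable_mult summable_inverse_Suc_squares)
    fix n t assume t: "t \<in> {0..T}"
    have "Re (- z * of_real t) \<le> norm (- z * of_real t)" by (rule complex_Re_le_cmod)
    also have "\<dots> \<le> norm z * T" using t by (auto simp: norm_mult intro!: mult_left_mono)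
    finally have e: "norm (exp (- z * of_real t)) \<le> exp (norm z * T)" by (simp only: norm_exp_eq_Re exp_le_cancel_iff)
    have "norm (g n) \<le> K * inverse ((real (Suc n)) ^ 4)" using g_le[of n] by (simp add: divide_inverse)
    also have "\<dots> \<le> K * inverse ((real (Suc n)) ^ 2)"
      using K_nonneg by (intro mult_left_mono le_imp_inverse_le power_increasing) auto
    finally have "norm (g n * (exp (- z * of_real t) * f0 n t)) \<le> (K * inverse ((real (Suc n)) ^ 2)) * (exp (norm z * T) * K)"
      unfolding norm_mult using K_nonneg by (intro mult_mono e f0_le t) auto
    then show "norm (g n * (exp (- z * of_real t) * f0 n t)) \<le> K * (exp (norm z * T) * K) * inverse ((real (Suc n))\<^sup>2)"
      by (simp add: mult_ac)
  qed
  note ul = this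
  have eq: "(\<Sum>n. g n * (exp (- z * of_real t) * f0 n t)) = 0" if "t \<in> {0..T}" for t
    using sums_unique[OF sums_mult[OF sums_0[OF that], of "exp (- z * of_real t)"]] by (simp add: mult_ac)
  have "uniform_limit {0..T} (\<lambda>N t. \<Sum>n<N. g n * (exp (- z * of_real t) * f0 n t)) (\<lambda>t. 0) sequentially"
    by (rule uniform_limit_cong'[OF refl eq, THEN iffD1, OF _ ul])
  then obtain I J where IJ: "\<And>N. ((\<lambda>t. \<Sum>n<N. g n * (exp (- z * of_real t) * f0 n t)) has_integral I N) {0..T}"
    "((\<lambda>t. 0 :: complex) has_integral J) {0..T}" "I \<longlonglongrightarrow> J"
    by (rule uniform_limit_integral) (auto intro!: continuous_intros cont)
  have J: "J = 0" using IJ(2) by simp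
  have "I N = (\<Sum>n<N. g n * integral {0..T} (\<lambda>t. exp (- z * of_real t) * f0 n t))" for N
    using integral_unique[OF IJ(1)[of N]]
    by (subst (asm) integral_sum) (auto intro!: integrable_continuous_real continuous_intros cont)
  then have "I = (\<lambda>N. \<Sum>n<N. g n * integral {0..T} (\<lambda>t. exp (- z * of_real t) * f0 n t))"
    by (rule ext)
  then show ?thesis using IJ(3) unfolding J sums_def by (simp only:)
qed

text \<open>Since the clearing factor is the same for every mode, it can be pulled out of the sum of
  the identities \<open>laplace_f0\<close>. What remains is the transform of a function that
  vanishes on the whole of \<open>{0..T}\<close>.\<close>

lemma G_0_eq: "z \<noteq> - of_real \<omega> \<Longrightarrow> G 0 z = exp (- z * of_real T) * G T z"
proof -
  assume z: "z \<noteq> - of_real \<omega>"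
  let ?\<Theta> = "of_real (c\<^sup>2) * (z + of_real \<omega>) * (csqrt (q z) * sinh (csqrt (q z) * pi))"
  let ?I = "\<lambda>n. integral {0..T} (\<lambda>t. exp (- z * of_real t) * f0 n t)"
  have T': "0 \<in> {0..T}" "T \<in> {0..T}" using T_pos by auto
  have "(\<lambda>n. g n * P n 0 z * cosh_coeff n (q z) - exp (- z * of_real T) * (g n * P n T z * cosh_coeff n (q z)))
     sums (G 0 z - exp (- z * of_real T) * G T z)"
    unfolding G_def by (intro sums_diff sums_mult summable_sums summable_G T')
  moreover have "g n * P n 0 z * cosh_coeff n (q z) - exp (- z * of_real T) * (g n * P n T z * cosh_coeff n (q z))
     = ?\<Theta> * (g n * ?I n)" for n
  proof -
    have "g n * P n 0 z * cosh_coeff n (q z) - exp (- z * of_real T) * (g n * P n T z * cosh_coeff n (q z))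
      = g n * cosh_coeff n (q z) * (P n 0 z - exp (- z * of_real T) * P n T z)"
      by (simp add: algebra_simps)
    also have "\<dots> = (cosh_coeff n (q z) * charpoly n z) * (g n * ?I n)"
      unfolding laplace_f0[symmetric] by (simp only: mult_ac)
    finally show ?thesis unfolding cosh_coeff_charpoly[OF z] .
  qed
  ultimately have "(\<lambda>n. ?\<Theta> * (g n * ?I n)) sums (G 0 z - exp (- z * of_real T) * G T z)" by simp
  moreover have "(\<lambda>n. ?\<Theta> * (g n * ?I n)) sums (?\<Theta> * 0)"
    by (intro sums_mult sums_laplace)
  ultimately show ?thesis using sums_unique2 by force
qed

text \<open>At infinity \<open>q z\<close> behaves like the square of \<open>z / c\<close>, and the
  root \<open>z / c * csqrt m\<close> stays within a bounded distance of \<open>z / c\<close>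
  because \<open>m - 1\<close> is of order \<open>1 / z\<close>.\<close>

lemma exists_sqrt_q:
  assumes z: "2 * \<omega> \<le> norm z" "z \<noteq> - of_real \<omega>"
  obtains k where "k\<^sup>2 = q z" "\<bar>Re k\<bar> \<le> \<bar>Re z\<bar> / c + 2 * (p - \<omega>) / c"
proof -
  define m where "m = (z + of_real p) / (z + of_real \<omega>)"
  define k where "k = z / of_real c * csqrt m"
  have nz: "z + of_real \<omega> \<noteq> 0" using z(2) by (simp add: add_eq_0_iff2)
  have "norm z \<le> norm (z + of_real \<omega>) + \<omega>"
    using norm_triangle_ineq4[of "z + of_real \<omega>" "of_real \<omega>"] \<omega> by simp
  \<comment> \<open>Beyond the radius \<open>2 * \<omega>\<close> at least half of
    \<open>norm z\<close> is left as distance to the pole, the origin of the factor 2 in the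
    bound.\<close>
  then have h: "norm z / 2 \<le> norm (z + of_real \<omega>)" using z(1) by linarith
  have "m - 1 = of_real (p - \<omega>) / (z + of_real \<omega>)" using nz by (simp add: m_def field_simps)
  then have "norm (m - 1) = (p - \<omega>) / norm (z + of_real \<omega>)" using \<omega> by (simp add: norm_divide del: of_real_diff)
  then have "norm z * norm (csqrt m - 1) \<le> norm z * ((p - \<omega>) / norm (z + of_real \<omega>))"
    using norm_csqrt_minus_1_le[of m] by (intro mult_left_mono) auto
  also have "\<dots> \<le> 2 * (p - \<omega>)"
  proof -
    have "norm z * (p - \<omega>) \<le> (2 * norm (z + of_real \<omega>)) * (p - \<omega>)"
      using h \<omega> by (intro mult_right_mono) auto
    then show ?thesis using nz by (simp add: field_simps)
  qed
  finally have d: "norm z * norm (csqrt m - 1) \<le> 2 * (p - \<omega>)" .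
  show thesis
  proof
    show "k\<^sup>2 = q z"
      using nz c by (simp add: k_def m_def q_def power_mult_distrib power_divide)
    have k: "k = of_real (inverse c) * (z + z * (csqrt m - 1))"
      using c by (simp add: k_def field_simps)
    have "\<bar>Re (z + z * (csqrt m - 1))\<bar> \<le> \<bar>Re z\<bar> + \<bar>Re (z * (csqrt m - 1))\<bar>"
      unfolding plus_complex.sel by (rule abs_triangle_ineq)
    also have "\<dots> \<le> \<bar>Re z\<bar> + 2 * (p - \<omega>)"
      using abs_Re_le_cmod[of "z * (csqrt m - 1)"] d by (simp add: norm_mult)
    finally have "inverse c * \<bar>Re (z + z * (csqrt m - 1))\<bar> \<le> inverse c * (\<bar>Re z\<bar> + 2 * (p - \<omega>))"
      using c by (intro mult_left_mono) auto
    moreover have "Re k = inverse c * Re (z + z * (csqrt m - 1))"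
      unfolding k scaleR_conv_of_real[symmetric] by (simp only: scaleR_complex.sel)
    then have "\<bar>Re k\<bar> = inverse c * \<bar>Re (z + z * (csqrt m - 1))\<bar>" using c by (simp only: abs_mult) simp
    ultimately have "\<bar>Re k\<bar> \<le> inverse c * (\<bar>Re z\<bar> + 2 * (p - \<omega>))" by (simp only:)
    also have "\<dots> = \<bar>Re z\<bar> / c + 2 * (p - \<omega>) / c" by (simp add: divide_inverse distrib_left mult.commute)
    finally show "\<bar>Re k\<bar> \<le> \<bar>Re z\<bar> / c + 2 * (p - \<omega>) / c" .
  qed
qed

lemma norm_G_at_infinity:
  obtains C where "C \<ge> 0"
    and "\<And>t z. t \<in> {0..T} \<Longrightarrow> 2 * \<omega> + 1 < norm (z::complex) \<Longrightarrow> norm (G t z) \<le> C * (norm z)\<^sup>2 * exp (pi * \<bar>Re z\<bar> / c)"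
proof
  let ?S = "\<Sum>n. inverse ((real (Suc n))\<^sup>2)"
  let ?A = "K\<^sup>2 * (c\<^sup>2 + p + 1)" and ?E = "exp (pi * (2 * (p - \<omega>) / c))"
  have S: "?S \<ge> 0" by (intro suminf_nonneg summable_inverse_Suc_squares) auto
  have A: "?A \<ge> 0" using \<omega> by simp
  show "?A * 4 * (pi * ?E) * ?S \<ge> 0" using S A by simp
  fix t and z :: complex assume t: "t \<in> {0..T}" and z: "2 * \<omega> + 1 < norm z"
  have "z \<noteq> - of_real \<omega>" using z \<omega> by auto
  then obtain k where k: "k\<^sup>2 = q z" "\<bar>Re k\<bar> \<le> \<bar>Re z\<bar> / c + 2 * (p - \<omega>) / c"
    using exists_sqrt_q[of z] z by auto
  have "norm (G t z) \<le> ?A * (1 + norm z)\<^sup>2 * (pi * exp (pi * \<bar>Re k\<bar>)) * ?S"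
    by (rule norm_G_le[OF t k(1)])
  \<comment> \<open>The radius \<open>2 * \<omega> + 1\<close> exceeds 1, hence
    \<open>1 + norm z\<close> is at most \<open>2 * norm z\<close>. The bounded part of
    \<open>Re k\<close> ends up in the constant \<open>?E\<close>.\<close>
  also have "\<dots> \<le> ?A * (2 * norm z)\<^sup>2 * (pi * exp (pi * (\<bar>Re z\<bar> / c + 2 * (p - \<omega>) / c))) * ?S"
    using z \<omega> S A k(2) by (intro mult_right_mono mult_mono mult_left_mono power_mono) auto
  also have "\<dots> = ?A * 4 * (pi * ?E) * ?S * (norm z)\<^sup>2 * exp (pi * \<bar>Re z\<bar> / c)"
    by (simp add: power_mult_distrib exp_add distrib_left mult_ac)
  finally show "norm (G t z) \<le> ?A * 4 * (pi * ?E) * ?S * (norm z)\<^sup>2 * exp (pi * \<bar>Re z\<bar> / c)" .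
qed

text \<open>In the right half plane \<open>G_0_eq\<close> gains the factor \<open>exp (- T * Re z)\<close>, which beats the growth
  \<open>exp (2 * pi * Re z / c)\<close>; in the left half plane the factor \<open>exp (pi * z / c)\<close> suffices.\<close>

lemma G_0_eq_0: "z \<noteq> - of_real \<omega> \<Longrightarrow> G 0 z = 0"
proof -
  obtain C where C: "C \<ge> 0"
    "\<And>t z. t \<in> {0..T} \<Longrightarrow> 2 * \<omega> + 1 < norm (z::complex) \<Longrightarrow> norm (G t z) \<le> C * (norm z)\<^sup>2 * exp (pi * \<bar>Re z\<bar> / c)"
    using norm_G_at_infinity by blast
  let ?R = "2 * \<omega> + 1"
  let ?E = "\<lambda>z. exp (of_real (pi / c) * z) * G 0 z"
  have T': "0 \<in> {0..T}" "T \<in> {0..T}" using T_pos by auto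
  have nz: "z \<noteq> - of_real \<omega>" if "?R < norm z" for z :: complex using that \<omega> by auto
  have right: "norm (?E z) \<le> C * (norm z)\<^sup>2 * exp (- (T - 2 * pi / c) * Re z)" if z: "?R < norm z" "Re z \<ge> 0" for z
  proof -
    have "norm (?E z) = exp (pi / c * Re z) * (exp (- (T * Re z)) * norm (G T z))"
      unfolding G_0_eq[OF nz[OF z(1)]] by (simp add: norm_mult mult.commute)
    also have "\<dots> \<le> exp (pi / c * Re z) * (exp (- (T * Re z)) * (C * (norm z)\<^sup>2 * exp (pi * \<bar>Re z\<bar> / c)))"
      by (intro mult_left_mono C T' z) auto
    also have "\<dots> = C * (norm z)\<^sup>2 * (exp (pi / c * Re z) * exp (- (T * Re z)) * exp (pi * \<bar>Re z\<bar> / c))"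
      by (simp only: mult_ac)
    also have "exp (pi / c * Re z) * exp (- (T * Re z)) * exp (pi * \<bar>Re z\<bar> / c) = exp (- (T - 2 * pi / c) * Re z)"
      unfolding exp_add[symmetric] using z(2) by (intro arg_cong[where f = exp]) (simp add: algebra_simps)
    finally show ?thesis .
  qed
  have Eb: "norm (?E z) \<le> C * (norm z)\<^sup>2" if z: "?R < norm z" for z
  proof (cases "Re z \<ge> 0")
    case True
    have "exp (- (T - 2 * pi / c) * Re z) \<le> 1" using True T by (simp add: mult_nonpos_nonneg)
    then have "C * (norm z)\<^sup>2 * exp (- (T - 2 * pi / c) * Re z) \<le> C * (norm z)\<^sup>2 * 1"
      using C(1) by (intro mult_left_mono) auto
    with right[OF z True] show ?thesis by simp
  next
    case False
    have "norm (?E z) = exp (pi / c * Re z) * norm (G 0 z)" by (simp add: norm_mult)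
    also have "\<dots> \<le> exp (pi / c * Re z) * (C * (norm z)\<^sup>2 * exp (pi * \<bar>Re z\<bar> / c))"
      by (intro mult_left_mono C T' z) auto
    also have "\<dots> = C * (norm z)\<^sup>2 * (exp (pi / c * Re z) * exp (pi * \<bar>Re z\<bar> / c))"
      by (simp only: mult_ac)
    also have "exp (pi / c * Re z) * exp (pi * \<bar>Re z\<bar> / c) = 1"
      unfolding exp_add[symmetric] using False by simp
    finally show ?thesis by simp
  qed
  have "?E holomorphic_on - {- of_real \<omega>}"
    by (intro holomorphic_intros holomorphic_G T')
  then have hol: "?E holomorphic_on {z. ?R < norm z}"
    by (rule holomorphic_on_subset) (use \<omega> in auto)
  have E0: "?E z = 0" if z: "?R < norm z" for z
  proof (rule holomorphic_eq_0_if_decaying_at_infinity[OF hol _ _ Eb _ z])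
    show "0 < T - 2 * pi / c" using T by simp
    fix x assume "?R < x"
    then have "?R < norm (complex_of_real x)" "0 \<le> Re (complex_of_real x)" using \<omega> by auto
    from right[OF this] show "norm (?E (of_real x)) \<le> C * x\<^sup>2 * exp (- (T - 2 * pi / c) * x)"
      by (simp only: norm_of_real power2_abs Re_complex_of_real)
  next
    show "0 < ?R" using \<omega> by simp
  qed
  have 0: "G 0 z = 0" if "?R < norm z" for z
    using E0[OF that] by simp
  assume z: "z \<noteq> - of_real \<omega>"
  \<comment> \<open>The punctured plane is connected, so vanishing near infinity spreads up to
    \<open>- \<omega>\<close>, whatever kind of singularity sits there.\<close>
  show "G 0 z = 0"
  proof (rule analytic_continuation_open[of "{z. ?R < norm z}" "- {- of_real \<omega>}" "G 0" "\<lambda>_. 0"])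
    show "open {z::complex. ?R < norm z}" by (intro open_Collect_less continuous_intros)
    have "?R < norm (complex_of_real (?R + 1))" unfolding norm_of_real by simp
    then show "{z::complex. ?R < norm z} \<noteq> {}" by blast
    show "connected (- {- complex_of_real \<omega>})"
      by (rule connected_punctured_universe) simp
    show "G 0 holomorphic_on - {- of_real \<omega>}" by (rule holomorphic_G[OF T'(1)])
    show "{z. ?R < norm z} \<subseteq> - {- complex_of_real \<omega>}" using \<omega> by auto
    show "\<And>z. z \<in> {z. ?R < norm z} \<Longrightarrow> G 0 z = 0" using 0 by simp
    show "z \<in> - {- complex_of_real \<omega>}" using z by simp
  qed auto
qed

text \<open>Near a root \<open>l\<close> of \<open>charpoly m\<close>, division of
  \<open>G 0 z = 0\<close> by the nonzero \<open>cosh_coeff m (q z)\<close> leaves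
  \<open>g m * P m 0 z\<close> as a multiple of \<open>charpoly m z\<close>, the cofactor being a
  sum over the other modes that is bounded near \<open>l\<close>. So a cubic divides a polynomial of
  degree at most 2, which must be zero; its coefficients determine the three initial values.\<close>

theorem initial_values_eq_0:
  assumes gm: "g m \<noteq> 0"
  shows "f0 m 0 = 0 \<and> f1 m 0 = 0 \<and> f2 m 0 = 0"
proof -
  define Q where "Q = [:of_real ((m * c)\<^sup>2 * \<omega>), of_real ((m * c)\<^sup>2), of_real p, 1 :: complex:]"
  define R where "R = [:of_real ((m * c)\<^sup>2) * f0 m 0 + of_real p * f1 m 0 + f2 m 0, of_real p * f0 m 0 + f1 m 0, f0 m 0:]"
  have Q: "poly Q z = charpoly m z" for z
    by (simp add: Q_def charpoly_def algebra_simps power2_eq_square power3_eq_cube)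
  have R: "poly R z = P m 0 z" for z
    by (simp add: R_def P_def algebra_simps power2_eq_square)
  have "Q dvd R"
  proof (rule poly_dvd_if_locally_bounded_quotient)
    show "Q \<noteq> 0" by (simp add: Q_def)
    fix l assume "poly Q l = 0"
    then have l: "charpoly m l = 0" by (simp add: Q)
    \<comment> \<open>The value of \<open>charpoly m\<close> at \<open>- \<omega>\<close> is
      \<open>\<omega>\<^sup>2 (p - \<omega>)\<close>, which is positive because
      \<open>\<omega> < p\<close>.\<close>
    have l\<omega>: "l \<noteq> - of_real \<omega>"
    proof
      assume "l = - of_real \<omega>"
      then have "of_real (\<omega>\<^sup>2 * (p - \<omega>)) = (0::complex)"
        using l by (simp add: charpoly_def algebra_simps power2_eq_square power3_eq_cube)
      then have "\<omega>\<^sup>2 * (p - \<omega>) = 0" using of_real_eq_0_iff by blast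
      then show False using \<omega> by simp
    qed
    then have l\<omega>': "l + of_real \<omega> \<noteq> 0" by (simp add: add_eq_0_iff2)
    then have ql: "q l = - (of_nat m ^ 2)"
      using l c by (simp add: charpoly_eq[OF l\<omega>] eq_neg_iff_add_eq_0)
    let ?S = "\<Sum>n. inverse ((real (Suc n))\<^sup>2)"
    let ?A = "K\<^sup>2 * (c\<^sup>2 + p + 1) * (1 + (norm l + 1))\<^sup>2"
    \<comment> \<open>A lower bound for every other cubic near \<open>l\<close>: half of the
      distance from \<open>l\<close> to \<open>- \<omega>\<close> survives, and since distinct
      squares differ by at least 1, a point within 1/2 of \<open>- m\<^sup>2\<close> keeps distance
      1/2 from every other \<open>- n\<^sup>2\<close>.\<close>
    let ?B = "c\<^sup>2 * (norm (l + of_real \<omega>) / 2) * (1 / 2)"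
    have Bpos: "?B > 0" using c l\<omega>' by simp
    have A: "?A \<ge> 0" using \<omega> by simp
    have opS: "open (- {- complex_of_real \<omega>})" by auto
    have qc: "isCont q l"
      by (rule continuous_on_interior[OF holomorphic_on_imp_continuous_on[OF holomorphic_q]])
         (use l\<omega> in \<open>simp add: interior_open opS\<close>)
    then have "((\<lambda>z. norm (q z - q l)) \<longlongrightarrow> norm (q l - q l)) (at l)"
      by (intro tendsto_intros) (simp add: isCont_def)
    then have e1: "\<forall>\<^sub>F z in at l. norm (q z - q l) < 1 / 2"
      by (rule order_tendstoD) simp
    have "((\<lambda>z. cosh_coeff m (q z)) \<longlongrightarrow> cosh_coeff m (q l)) (at l)"
      using qc holomorphic_on_imp_continuous_on[OF holomorphic_cosh_coeff[of m]]
      by (intro isCont_tendsto_compose[of "q l" "cosh_coeff m"]) (auto simp: isCont_def continuous_on_eq_continuous_at)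
    then have e2: "\<forall>\<^sub>F z in at l. cosh_coeff m (q z) \<noteq> 0"
      by (rule tendsto_imp_eventually_ne) (simp add: ql cosh_coeff_neg_square_nz)
    have "((\<lambda>z. norm (z - l)) \<longlongrightarrow> norm (l - l)) (at l)" by (intro tendsto_intros)
    then have e3: "\<forall>\<^sub>F z in at l. norm (z - l) < min 1 (norm (l + of_real \<omega>) / 2)"
      by (rule order_tendstoD) (use l\<omega>' in simp)
    have "\<forall>\<^sub>F z in at l. norm (poly R z) \<le> (?A * ?S / ?B / norm (g m)) * norm (poly Q z)"
      using e1 e2 e3
    proof eventually_elim
      case (elim z)
      have "norm (l + of_real \<omega>) \<le> norm (z + of_real \<omega>) + norm (z - l)"
        using norm_triangle_ineq4[of "z + of_real \<omega>" "z - l"] by (simp add: algebra_simps)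
      then have z\<omega>: "norm (l + of_real \<omega>) / 2 \<le> norm (z + of_real \<omega>)" using elim(3) by linarith
      then have z: "z \<noteq> - of_real \<omega>" using l\<omega>' by auto
      have nz: "norm z \<le> norm l + 1"
        using norm_triangle_ineq2[of z l] elim(3) by linarith
      have charpoly_ge: "?B \<le> norm (charpoly n z)" if "n \<noteq> m" for n
      proof -
        have "(1::int) \<le> \<bar>(int n)\<^sup>2 - (int m)\<^sup>2\<bar>" using that by (auto simp: int_one_le_iff_zero_less power2_eq_iff)
        then have "(1::real) \<le> real_of_int \<bar>(int n)\<^sup>2 - (int m)\<^sup>2\<bar>" by linarith
        then have "1 \<le> norm (complex_of_real ((real n)\<^sup>2 - (real m)\<^sup>2))"
          by (simp only: norm_of_real) simp
        also have "complex_of_real ((real n)\<^sup>2 - (real m)\<^sup>2) = (q z + of_nat n ^ 2) - (q z - q l)"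
          by (simp add: ql)
        also have "norm \<dots> \<le> norm (q z + of_nat n ^ 2) + norm (q z - q l)"
          by (rule norm_triangle_ineq4)
        finally have "1 / 2 \<le> norm (q z + of_nat n ^ 2)" using elim(1) by linarith
        then show ?thesis
          unfolding charpoly_eq[OF z] norm_mult using z\<omega> c by (intro mult_mono) (auto simp: norm_power)
      qed
      let ?h = "\<lambda>n. if n = m then 0 else g n * P n 0 z / charpoly n z"
      have T': "0 \<in> {0..T}" using T_pos by simp
      have h_le: "norm (?h n) \<le> ?A / ?B * inverse ((real (Suc n))\<^sup>2)" for n
      proof (cases "n = m")
        case False
        have "norm (?h n) = norm (g n * P n 0 z) / norm (charpoly n z)" using False by (simp add: norm_divide)
        also have "\<dots> \<le> (?A * inverse ((real (Suc n))\<^sup>2)) / ?B"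
        proof (rule frac_le)
          have "norm (g n * P n 0 z) \<le> K\<^sup>2 * (c\<^sup>2 + p + 1) * (1 + norm z)\<^sup>2 * inverse ((real (Suc n))\<^sup>2)"
            by (rule norm_gP_le[OF T'])
          also have "\<dots> \<le> ?A * inverse ((real (Suc n))\<^sup>2)"
            using nz \<omega> by (intro mult_right_mono mult_left_mono power_mono) auto
          finally show "norm (g n * P n 0 z) \<le> ?A * inverse ((real (Suc n))\<^sup>2)" .
        qed (use A Bpos charpoly_ge[OF False] in auto)
        finally show ?thesis by (simp add: field_simps)
      qed (use A Bpos in simp)
      have sumh: "summable ?h"
        by (rule summable_comparison_test'[OF summable_mult[OF summable_inverse_Suc_squares]], rule h_le)
      \<comment> \<open>The products \<open>cosh_coeff n (q z) * charpoly n z\<close> agree for all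
        \<open>n\<close>, so every coefficient can be expressed through that of mode
        \<open>m\<close>.\<close>
      have eq: "g n * P n 0 z * cosh_coeff n (q z) = (if n = m then g m * P m 0 z * cosh_coeff m (q z) else 0)
          + cosh_coeff m (q z) * charpoly m z * ?h n" for n
      proof (cases "n = m")
        case False
        have "charpoly n z \<noteq> 0" using charpoly_ge[OF False] Bpos by auto
        moreover have "cosh_coeff n (q z) * charpoly n z = cosh_coeff m (q z) * charpoly m z"
          by (simp only: cosh_coeff_charpoly[OF z])
        ultimately have "cosh_coeff n (q z) = cosh_coeff m (q z) * charpoly m z / charpoly n z"
          by (simp add: field_simps)
        then show ?thesis using False by simp
      qed simp
      have "(\<lambda>n. g n * P n 0 z * cosh_coeff n (q z)) sums
         (g m * P m 0 z * cosh_coeff m (q z) + cosh_coeff m (q z) * charpoly m z * suminf ?h)"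
        by (rule sums_cong[THEN iffD2, OF eq]) (intro sums_add sums_mult summable_sums sumh sums_single)
      then have "g m * P m 0 z * cosh_coeff m (q z) + cosh_coeff m (q z) * charpoly m z * suminf ?h = 0"
        using G_0_eq_0[OF z] by (simp add: G_def sums_iff)
      then have "cosh_coeff m (q z) * (g m * P m 0 z + charpoly m z * suminf ?h) = 0"
        by (simp add: algebra_simps)
      then have "g m * P m 0 z = - (charpoly m z * suminf ?h)"
        using elim(2) by (simp add: eq_neg_iff_add_eq_0)
      then have "norm (g m) * norm (P m 0 z) = norm (charpoly m z) * norm (suminf ?h)"
        by (simp flip: norm_mult)
      also have "\<dots> \<le> norm (charpoly m z) * (?A / ?B * ?S)"
        unfolding suminf_mult[OF summable_inverse_Suc_squares, symmetric]
        by (intro mult_left_mono norm_suminf_le h_le summable_mult summable_inverse_Suc_squares) auto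
      finally have fin: "norm (g m) * norm (P m 0 z) \<le> norm (charpoly m z) * (?A / ?B * ?S)" .
      have aux: "x \<le> (A * S / B / a) * y" if "0 < a" "a * x \<le> y * (A / B * S)" for a x y A B S :: real
      proof -
        have "x \<le> (y * (A / B * S)) / a" using that(2) unfolding pos_le_divide_eq[OF that(1)] by (simp only: mult.commute)
        then show ?thesis by (simp add: mult_ac)
      qed
      show ?case unfolding Q R by (rule aux[OF _ fin]) (use gm in simp)
    qed
    then show "\<exists>C. \<forall>\<^sub>F z in at l. norm (poly R z) \<le> C * norm (poly Q z)" by blast
  qed
  moreover have "degree Q = 3" unfolding Q_def by simp
  moreover have "degree [:x, y, w:] \<le> 2" for x y w :: complex by (simp add: degree_pCons_eq_if)
  then have "degree R \<le> 2" unfolding R_def .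
  ultimately have "R = 0" using dvd_imp_degree_le[of Q R] by linarith
  then have "of_real ((m * c)\<^sup>2) * f0 m 0 + of_real p * f1 m 0 + f2 m 0 = 0 \<and> of_real p * f0 m 0 + f1 m 0 = 0 \<and> f0 m 0 = 0"
    unfolding R_def pCons_eq_0_iff by blast
  then show ?thesis by auto
qed

end

section \<open>Mode decompositions of Hilbert spaces and semigroups\<close>

lemma subspace_closure:
  fixes V :: "'a::real_normed_vector set"
  assumes V: "subspace V"
  shows "subspace (closure V)"
proof (rule subspaceI)
  show "0 \<in> closure V" using subspace_0[OF V] closure_subset by blast
  fix x y assume "x \<in> closure V" "y \<in> closure V"
  then obtain X Y where "\<And>n. X n \<in> V" "X \<longlonglongrightarrow> x" "\<And>n. Y n \<in> V" "Y \<longlonglongrightarrow> y"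
    unfolding closure_sequential by blast
  then have "\<And>n. X n + Y n \<in> V" "(\<lambda>n. X n + Y n) \<longlonglongrightarrow> x + y"
    by (auto intro: subspace_add[OF V] tendsto_add)
  then show "x + y \<in> closure V"
    unfolding closure_sequential by (intro exI[of _ "\<lambda>n. X n + Y n"] conjI allI) auto
next
  fix c :: real and x assume "x \<in> closure V"
  then obtain X where "\<And>n. X n \<in> V" "X \<longlonglongrightarrow> x"
    unfolding closure_sequential by blast
  then have "\<And>n. c *\<^sub>R X n \<in> V" "(\<lambda>n. c *\<^sub>R X n) \<longlonglongrightarrow> c *\<^sub>R x"
    by (auto intro: subspace_scale[OF V] tendsto_scaleR)
  then show "c *\<^sub>R x \<in> closure V"
    unfolding closure_sequential by (intro exI[of _ "\<lambda>n. c *\<^sub>R X n"] conjI allI) auto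
qed

text \<open>Midpoints stay in \<open>V\<close>, so the parallelogram law makes a minimising sequence
  Cauchy. From its limit no step along a vector of \<open>V\<close> can reduce the distance, and
  this forces orthogonality.\<close>

lemma exists_orthogonal_projection:
  fixes V :: "'a::{real_inner, banach} set"
  assumes V: "subspace V" "closed V"
  obtains p where "p \<in> V" "\<And>v. v \<in> V \<Longrightarrow> inner (x - p) v = 0"
proof -
  have ne: "V \<noteq> {}" using subspace_0[OF V(1)] by auto
  define d where "d = infdist x V"
  have d0: "d \<ge> 0" by (simp add: d_def infdist_nonneg)
  have d: "d \<le> norm (x - v)" if "v \<in> V" for v
    using infdist_le[OF that, of x] by (simp add: d_def dist_norm)
  have "\<exists>v\<in>V. norm (x - v) < d + inverse (real (Suc n))" for n
  proof -
    have "(INF v\<in>V. dist x v) < d + inverse (real (Suc n))"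
      using ne by (simp add: d_def infdist_def)
    then show ?thesis using ne by (subst (asm) cINF_less_iff) (auto simp: dist_norm intro: bdd_belowI[of _ 0])
  qed
  then obtain v where v: "\<And>n. v n \<in> V" "\<And>n. norm (x - v n) < d + inverse (real (Suc n))" by metis
  have par: "(norm (v m - v n))\<^sup>2 \<le> (8 * d + 4) * inverse (real (Suc N))" if "m \<ge> N" "n \<ge> N" for m n N
  proof -
    let ?e = "inverse (real (Suc N))"
    have e: "0 \<le> ?e" "?e \<le> 1" by (auto simp: field_simps)
    have "inverse (real (Suc m)) \<le> ?e" "inverse (real (Suc n)) \<le> ?e"
      using that by (auto intro!: le_imp_inverse_le)
    then have "norm (x - v m) \<le> d + ?e" "norm (x - v n) \<le> d + ?e"
      using v(2)[of m] v(2)[of n] by linarith+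
    then have 1: "(norm (x - v m))\<^sup>2 \<le> (d + ?e)\<^sup>2" "(norm (x - v n))\<^sup>2 \<le> (d + ?e)\<^sup>2"
      by (auto intro!: power_mono)
    have "(1/2) *\<^sub>R (v m + v n) \<in> V" using V(1) v(1) by (intro subspace_scale subspace_add)
    from d[OF this] have "d\<^sup>2 \<le> (norm (x - (1/2) *\<^sub>R (v m + v n)))\<^sup>2" using d0 by (intro power_mono)
    moreover have "(norm (v m - v n))\<^sup>2 = 2 * (norm (x - v m))\<^sup>2 + 2 * (norm (x - v n))\<^sup>2
        - 4 * (norm (x - (1/2) *\<^sub>R (v m + v n)))\<^sup>2"
      unfolding power2_norm_eq_inner by (simp add: inner_simps inner_commute algebra_simps)
    ultimately have "(norm (v m - v n))\<^sup>2 \<le> 4 * (d + ?e)\<^sup>2 - 4 * d\<^sup>2" using 1 by linarith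
    also have "\<dots> = 8 * d * ?e + 4 * (?e * ?e)" by (simp add: power2_eq_square algebra_simps)
    also have "\<dots> \<le> 8 * d * ?e + 4 * (?e * 1)" using e d0 by (intro add_mono mult_left_mono) auto
    finally show ?thesis by (simp add: algebra_simps)
  qed
  have "Cauchy v"
  proof (rule CauchyI)
    fix e :: real assume e: "e > 0"
    have "(\<lambda>N. (8 * d + 4) * inverse (real (Suc N))) \<longlonglongrightarrow> (8 * d + 4) * 0"
      by (intro tendsto_intros LIMSEQ_inverse_real_of_nat)
    then have "\<forall>\<^sub>F N in sequentially. (8 * d + 4) * inverse (real (Suc N)) < e\<^sup>2"
      by (rule order_tendstoD) (use e in simp)
    then obtain N where N: "(8 * d + 4) * inverse (real (Suc N)) < e\<^sup>2"
      by (auto simp: eventually_sequentially)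
    have "norm (v m - v n) < e" if "m \<ge> N" "n \<ge> N" for m n
    proof (rule power2_less_imp_less)
      show "(norm (v m - v n))\<^sup>2 < e\<^sup>2" using par[OF that] N by linarith
    qed (use e in simp)
    then show "\<exists>M. \<forall>m\<ge>M. \<forall>n\<ge>M. norm (v m - v n) < e" by blast
  qed
  then obtain p where p: "v \<longlonglongrightarrow> p" by (meson Cauchy_convergent convergent_def)
  have pV: "p \<in> V" by (rule closed_sequentially[OF V(2) v(1) p])
  have "norm (x - p) \<le> d"
  proof (rule LIMSEQ_le)
    show "(\<lambda>n. norm (x - v n)) \<longlonglongrightarrow> norm (x - p)" by (intro tendsto_intros p)
    show "(\<lambda>n. d + inverse (real (Suc n))) \<longlonglongrightarrow> d"
      using tendsto_add[OF tendsto_const LIMSEQ_inverse_real_of_nat] by simp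
    show "\<exists>N. \<forall>n\<ge>N. norm (x - v n) \<le> d + inverse (real (Suc n))" using v(2) less_imp_le by blast
  qed
  then have pd: "norm (x - p) = d" using d[OF pV] by simp
  have "inner (x - p) w = 0" if w: "w \<in> V" for w
  proof (cases "w = 0")
    case False
    \<comment> \<open>The step length that minimises the distance to \<open>x\<close> along
      \<open>w\<close>.\<close>
    define t where "t = inner (x - p) w / inner w w"
    have "p + t *\<^sub>R w \<in> V" using V(1) pV w by (intro subspace_add subspace_scale)
    from d[OF this] have "d\<^sup>2 \<le> (norm (x - (p + t *\<^sub>R w)))\<^sup>2" using d0 by (intro power_mono)
    also have "\<dots> = (norm (x - p))\<^sup>2 - 2 * t * inner (x - p) w + t * (t * inner w w)"
      unfolding power2_norm_eq_inner by (simp add: inner_simps inner_commute algebra_simps)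
    also have "t * inner w w = inner (x - p) w" using False by (simp add: t_def)
    finally have "t * inner (x - p) w \<le> 0" using pd by simp
    then have "(inner (x - p) w)\<^sup>2 / inner w w \<le> 0" by (simp add: t_def power2_eq_square)
    moreover have "inner w w > 0" using False by simp
    ultimately show ?thesis by (simp add: divide_le_0_iff)
  qed simp
  with pV show thesis by (rule that)
qed

text \<open>That \<open>C n\<close> inverts \<open>J n\<close> is asked only on the range of
  \<open>C n\<close>: the sine of index 0 vanishes, so a component of a mode must be allowed to be
  void. Scalars are real throughout; complex coefficients are vectors of the coefficient
  space.\<close>

locale mode_decomposition =
  fixes C :: "nat \<Rightarrow> 'a::{real_inner, banach} \<Rightarrow> 'v::real_inner" and J :: "nat \<Rightarrow> 'v \<Rightarrow> 'a"
  assumes C_bounded_linear: "bounded_linear (C n)"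
    and J_adjoint: "inner (J n v) z = inner v (C n z)"
    and C_J_neq: "m \<noteq> n \<Longrightarrow> C m (J n v) = 0"
    and C_J_C: "C n (J n (C n z)) = C n z"
    and C_complete: "(\<And>n. C n z = 0) \<Longrightarrow> z = 0"
begin

section \<open>Synthesis, Bessel and Parseval\<close>

lemma C_simps [simp]: "C n (x + y) = C n x + C n y" "C n (x - y) = C n x - C n y" "C n (r *\<^sub>R x) = r *\<^sub>R C n x" "C n 0 = 0"
  using bounded_linear.linear[OF C_bounded_linear[of n]]
  by (simp_all add: linear_add linear_diff linear_scale linear_0)

lemma eq_if_C_eq: "(\<And>n. C n x = C n y) \<Longrightarrow> x = y"
  using C_complete[of "x - y"] by simp

lemma J_orthogonal: "m \<noteq> n \<Longrightarrow> inner (J m v) (J n w) = 0"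
  by (simp add: J_adjoint C_J_neq)

lemma norm_J: "C n (J n v) = v \<Longrightarrow> norm (J n v) = norm v"
  by (simp add: norm_eq_sqrt_inner J_adjoint)

text \<open>Riesz-Fischer: by Pythagoras, the vector sums are Cauchy as soon as the sums of squares
  are, and continuity of \<open>C m\<close> then picks out a single term.\<close>

lemma synthesis:
  assumes w: "\<And>n. C n (J n (w n)) = w n" and summable: "summable (\<lambda>n. (norm (w n))\<^sup>2)"
  shows "summable (\<lambda>n. J n (w n))" and "C m (\<Sum>n. J n (w n)) = w m"
proof -
  have pyth: "(norm (\<Sum>n\<in>I. J n (w n)))\<^sup>2 = (\<Sum>n\<in>I. (norm (w n))\<^sup>2)" if "finite I" for I
    using norm_sum_Pythagorean[OF that, of "\<lambda>n. J n (w n)"] norm_J[OF w]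
    by (simp add: pairwise_def orthogonal_def J_orthogonal)
  show *: "summable (\<lambda>n. J n (w n))"
    unfolding summable_Cauchy
  proof (intro allI impI)
    fix e :: real assume e: "e > 0"
    then obtain N where N: "\<And>m n. m \<ge> N \<Longrightarrow> norm (\<Sum>k = m..<n. (norm (w k))\<^sup>2) < e\<^sup>2"
      using summable unfolding summable_Cauchy by (metis zero_less_power)
    have "norm (\<Sum>k = m..<n. J k (w k)) < e" if "m \<ge> N" for m n
    proof (rule power2_less_imp_less)
      show "(norm (\<Sum>k = m..<n. J k (w k)))\<^sup>2 < e\<^sup>2" using N[OF that, of n] by (simp add: pyth)
    qed (use e in simp)
    then show "\<exists>N. \<forall>m\<ge>N. \<forall>n. norm (\<Sum>k = m..<n. J k (w k)) < e" by blast
  qed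
  have "(\<lambda>n. C m (J n (w n))) sums C m (\<Sum>n. J n (w n))"
    by (rule bounded_linear.sums[OF C_bounded_linear summable_sums[OF *]])
  moreover have "(\<lambda>n. C m (J n (w n))) = (\<lambda>n. if n = m then w n else 0)"
    using w C_J_neq by (intro ext) auto
  ultimately show "C m (\<Sum>n. J n (w n)) = w m"
    using sums_single[of m w] sums_unique2 by simp blast
qed

lemma bessel: "summable (\<lambda>n. (norm (C n z))\<^sup>2)"
proof (rule summableI_nonneg_bounded)
  fix N
  let ?y = "\<Sum>n<N. J n (C n z)"
  have "inner ?y z = (\<Sum>n<N. (norm (C n z))\<^sup>2)"
    by (simp add: inner_sum_left J_adjoint power2_norm_eq_inner)
  moreover have "(norm ?y)\<^sup>2 = (\<Sum>n<N. (norm (C n z))\<^sup>2)"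
    using norm_sum_Pythagorean[of "{..<N}" "\<lambda>n. J n (C n z)"] norm_J[OF C_J_C]
    by (simp add: pairwise_def orthogonal_def J_orthogonal)
  moreover have "0 \<le> (norm (z - ?y))\<^sup>2" by simp
  ultimately show "(\<Sum>n<N. (norm (C n z))\<^sup>2) \<le> (norm z)\<^sup>2"
    by (simp add: power2_norm_eq_inner inner_simps inner_commute)
qed simp

lemma expansion: "(\<lambda>n. J n (C n z)) sums z"
proof -
  have "C m (\<Sum>n. J n (C n z)) = C m z" for m by (rule synthesis(2)[OF C_J_C bessel])
  then have "(\<Sum>n. J n (C n z)) = z" by (rule eq_if_C_eq)
  with summable_sums[OF synthesis(1)[OF C_J_C bessel, of z]] show ?thesis by simp
qed

lemma inner_sums: "(\<lambda>n. inner (C n y) (C n z)) sums inner y z"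
  using bounded_linear.sums[OF bounded_linear_inner_left expansion, of y z] by (simp add: J_adjoint)

lemma parseval: "(\<lambda>n. (norm (C n z))\<^sup>2) sums (norm z)\<^sup>2"
  using inner_sums[of z z] by (simp add: power2_norm_eq_inner)

lemma norm_C_le: "norm (C n z) \<le> norm z"
proof (rule power2_le_imp_le)
  have "(\<Sum>k\<in>{n}. (norm (C k z))\<^sup>2) \<le> (\<Sum>k. (norm (C k z))\<^sup>2)"
    by (intro sum_le_suminf bessel) auto
  then show "(norm (C n z))\<^sup>2 \<le> (norm z)\<^sup>2" using parseval[of z] by (simp add: sums_iff)
qed simp

text \<open>Dominated convergence in the index, applied to Parseval's sum. It reduces strong
  continuity and the identification of the generator to single modes.\<close>

lemma tendsto_0_by_modes:
  assumes lim: "\<And>n. ((\<lambda>h. C n (x h)) \<longlongrightarrow> 0) F"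
    and bound: "\<forall>\<^sub>F h in F. \<forall>n. norm (C n (x h)) \<le> B n"
    and B: "summable (\<lambda>n. (B n)\<^sup>2)" and F: "F \<noteq> bot"
  shows "(x \<longlongrightarrow> 0) F"
proof -
  have "((\<lambda>h. \<Sum>n. (norm (C n (x h)))\<^sup>2) \<longlongrightarrow> (\<Sum>n. 0)) F"
  proof (rule tannerys_theorem[THEN conjunct2, THEN conjunct2])
    show "((\<lambda>h. (norm (C n (x h)))\<^sup>2) \<longlongrightarrow> 0) F" for n
      using tendsto_power[OF tendsto_norm[OF lim[of n]], of 2] by simp
    have "\<forall>\<^sub>F h in F. \<forall>n. norm ((norm (C n (x h)))\<^sup>2) \<le> (B n)\<^sup>2"
      using bound by (rule eventually_mono) (auto intro: power_mono)
    from eventually_prodI[OF eventually_True this, of at_top]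
    show "\<forall>\<^sub>F (n, h) in at_top \<times>\<^sub>F F. norm ((norm (C n (x h)))\<^sup>2) \<le> (B n)\<^sup>2"
      by (rule eventually_mono) auto
  qed (use B F in auto)
  then have "((\<lambda>h. (norm (x h))\<^sup>2) \<longlongrightarrow> 0) F"
    using parseval by (simp add: sums_iff)
  then have "((\<lambda>h. sqrt ((norm (x h))\<^sup>2)) \<longlongrightarrow> sqrt 0) F" by (rule tendsto_real_sqrt)
  then show ?thesis by (simp add: tendsto_norm_zero_iff)
qed

end

text \<open>The constant \<open>K\<close> does not depend on \<open>n\<close>, which is what allows
  the flows of the modes to be summed. The last assumption says that a void component of a mode
  stays void under the flow.\<close>

locale mode_semigroup = mode_decomposition C J
  for C :: "nat \<Rightarrow> 'a::{real_inner, banach, second_countable_topology} \<Rightarrow> 'v::real_inner" and J :: "nat \<Rightarrow> 'v \<Rightarrow> 'a" +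
  fixes M :: "nat \<Rightarrow> 'v \<Rightarrow> 'v" and E :: "nat \<Rightarrow> real \<Rightarrow> 'v \<Rightarrow> 'v" and K :: real
  assumes E_linear: "0 \<le> t \<Longrightarrow> linear (E n t)"
    and norm_E_le: "0 \<le> t \<Longrightarrow> norm (E n t v) \<le> K * norm v"
    and E_0: "E n 0 v = v"
    and E_add: "0 \<le> s \<Longrightarrow> 0 \<le> t \<Longrightarrow> E n (s + t) v = E n s (E n t v)"
    and E_deriv: "0 \<le> t \<Longrightarrow> ((\<lambda>t. E n t v) has_vector_derivative M n (E n t v)) (at t within {0..})"
    and M_E: "0 \<le> t \<Longrightarrow> M n (E n t v) = E n t (M n v)"
    and C_J_E: "0 \<le> t \<Longrightarrow> C n (J n v) = v \<Longrightarrow> C n (J n (E n t v)) = E n t v"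
begin

section \<open>The semigroup and its generator\<close>

definition S :: "real \<Rightarrow> 'a \<Rightarrow> 'a" where
  "S t z = (\<Sum>n. J n (E n t (C n z)))"

lemma C_S: "0 \<le> t \<Longrightarrow> C n (S t z) = E n t (C n z)"
  unfolding S_def
proof (rule synthesis(2))
  assume t: "0 \<le> t"
  show "C n (J n (E n t (C n z))) = E n t (C n z)" for n by (rule C_J_E[OF t C_J_C])
  show "summable (\<lambda>n. (norm (E n t (C n z)))\<^sup>2)"
  proof (rule summable_comparison_test'[where N = 0])
    show "summable (\<lambda>n. K\<^sup>2 * (norm (C n z))\<^sup>2)" by (intro summable_mult bessel)
    show "norm ((norm (E n t (C n z)))\<^sup>2) \<le> K\<^sup>2 * (norm (C n z))\<^sup>2" for n
      using power_mono[OF norm_E_le[OF t, of n "C n z"], of 2] by (simp add: power_mult_distrib)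
  qed
qed

lemma K_nonneg: "v \<noteq> 0 \<Longrightarrow> 0 \<le> K" for v :: 'v
  using norm_E_le[of 0 0 v] by (simp add: E_0 mult_le_cancel_right)

lemma norm_S_le: "0 \<le> t \<Longrightarrow> norm (S t z) \<le> K * norm z"
proof (cases "z = 0")
  case True
  assume t: "0 \<le> t"
  have "S t 0 = 0" by (rule C_complete) (simp add: C_S[OF t] linear_0[OF E_linear[OF t]])
  with True show ?thesis by simp
next
  case False
  then obtain n where "C n z \<noteq> 0" using C_complete by blast
  then have K: "0 \<le> K" by (rule K_nonneg)
  assume t: "0 \<le> t"
  show ?thesis
  proof (rule power2_le_imp_le)
    have "(\<Sum>n. (norm (C n (S t z)))\<^sup>2) \<le> (\<Sum>n. K\<^sup>2 * (norm (C n z))\<^sup>2)"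
      using power_mono[OF norm_E_le[OF t], of _ _ 2]
      by (intro suminf_le bessel summable_mult) (auto simp: C_S[OF t] power_mult_distrib)
    then show "(norm (S t z))\<^sup>2 \<le> (K * norm z)\<^sup>2"
      using parseval[of "S t z"] parseval[of z] by (simp add: sums_iff suminf_mult bessel power_mult_distrib)
  qed (use K in simp)
qed

lemma bounded_linear_S: "0 \<le> t \<Longrightarrow> bounded_linear (S t)"
proof (rule bounded_linear_intro)
  assume t: "0 \<le> t"
  note E = linear_add[OF E_linear[OF t]] linear_scale[OF E_linear[OF t]]
  show "S t (x + y) = S t x + S t y" for x y by (rule eq_if_C_eq) (simp add: C_S[OF t] E)
  show "S t (r *\<^sub>R x) = r *\<^sub>R S t x" for r x by (rule eq_if_C_eq) (simp add: C_S[OF t] E)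
  show "norm (S t x) \<le> norm x * K" for x using norm_S_le[OF t] by (simp add: mult.commute)
qed

lemma S_0: "S 0 z = z"
  by (rule eq_if_C_eq) (simp add: C_S E_0)

lemma S_add: "0 \<le> s \<Longrightarrow> 0 \<le> t \<Longrightarrow> S (s + t) z = S s (S t z)"
  by (rule eq_if_C_eq) (simp add: C_S E_add)

lemma E_tendsto: "((\<lambda>h. E n h v) \<longlongrightarrow> v) (at_right 0)"
proof -
  have "((\<lambda>h. E n h v) \<longlongrightarrow> E n 0 v) (at 0 within {0..})"
    using has_vector_derivative_continuous[OF E_deriv[of 0 n v]] by (simp add: continuous_within)
  then show ?thesis by (simp add: E_0) (rule tendsto_within_subset, auto)
qed

lemma S_tendsto: "((\<lambda>h. S h z) \<longlongrightarrow> z) (at_right 0)"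
proof -
  have "((\<lambda>h. S h z - z) \<longlongrightarrow> 0) (at_right 0)"
  proof (rule tendsto_0_by_modes)
    fix n
    have "((\<lambda>h. E n h (C n z) - C n z) \<longlongrightarrow> 0) (at_right 0)"
      by (intro LIM_zero E_tendsto)
    then show "((\<lambda>h. C n (S h z - z)) \<longlongrightarrow> 0) (at_right 0)"
      by (rule Lim_transform_eventually) (auto simp: C_S eventually_at_filter)
  next
    show "\<forall>\<^sub>F h in at_right 0. \<forall>n. norm (C n (S h z - z)) \<le> (K + 1) * norm (C n z)"
      unfolding eventually_at_filter
    proof (intro always_eventually allI impI)
      fix h :: real and n assume "h \<in> {0<..}"
      then have h: "0 \<le> h" by simp
      have "norm (C n (S h z - z)) \<le> norm (E n h (C n z)) + norm (C n z)"
        by (simp add: C_S[OF h] norm_triangle_ineq4)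
      also have "\<dots> \<le> (K + 1) * norm (C n z)" using norm_E_le[OF h, of n "C n z"] by (simp add: algebra_simps)
      finally show "norm (C n (S h z - z)) \<le> (K + 1) * norm (C n z)" .
    qed
    show "summable (\<lambda>n. ((K + 1) * norm (C n z))\<^sup>2)"
      unfolding power_mult_distrib by (intro summable_mult bessel)
  qed simp
  then show ?thesis by (rule LIM_zero_cancel)
qed

lemma c0_semigroup_S: "c0_semigroup S"
  unfolding c0_semigroup_def
  by (auto simp: bounded_linear_S S_tendsto S_0 S_add fun_eq_iff)

lemma norm_S_diff_le: "0 \<le> s \<Longrightarrow> s \<le> t \<Longrightarrow> norm (S t z - S s z) \<le> K * norm (S (t - s) z - z)"
proof -
  assume st: "0 \<le> s" "s \<le> t"
  have "S t z - S s z = S s (S (t - s) z - z)"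
    using S_add[of s "t - s" z] st linear_diff[OF bounded_linear.linear[OF bounded_linear_S[OF st(1)]]] by simp
  then show ?thesis using norm_S_le[OF st(1)] by simp
qed

text \<open>Joint continuity in time and state. The uniform bound on the semigroup handles the
  change of state, and it reduces a change of time to strong continuity at 0, applied to the fixed
  vector \<open>G a\<close>.\<close>

lemma continuous_on_S:
  assumes f: "continuous_on A f" "\<And>x. x \<in> A \<Longrightarrow> 0 \<le> f x" and G: "continuous_on A G"
  shows "continuous_on A (\<lambda>x. S (f x) (G x))"
  unfolding continuous_on_def
proof
  fix a assume a: "a \<in> A"
  have S0: "((\<lambda>h. norm (S \<bar>h\<bar> (G a) - G a)) \<longlongrightarrow> 0) (nhds 0)"
  proof -
    have "((\<lambda>h. S h (G a) - G a) \<longlongrightarrow> 0) (at_right 0)" by (intro LIM_zero S_tendsto)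
    then have "((\<lambda>h. norm (S h (G a) - G a)) \<longlongrightarrow> 0) (at_right 0)" by (rule tendsto_norm_zero)
    then have "\<exists>d>0. \<forall>h. \<bar>h\<bar> < d \<longrightarrow> norm (S \<bar>h\<bar> (G a) - G a) < e" if e: "e > 0" for e
    proof -
      obtain d where d: "d > 0" "\<And>h. 0 < h \<Longrightarrow> h < d \<Longrightarrow> norm (S h (G a) - G a) < e"
        using order_tendstoD(2)[OF \<open>((\<lambda>h. norm (S h (G a) - G a)) \<longlongrightarrow> 0) (at_right 0)\<close> e]
        by (auto simp: eventually_at_right_field)
      have "norm (S \<bar>h\<bar> (G a) - G a) < e" if "\<bar>h\<bar> < d" for h
        using d(2)[of "\<bar>h\<bar>"] that \<open>e > 0\<close> by (cases "h = 0") (auto simp: S_0)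
      with d(1) show ?thesis by blast
    qed
    then show ?thesis by (auto simp: tendsto_iff eventually_nhds_metric dist_norm)
  qed
  have fa: "(f \<longlongrightarrow> f a) (at a within A)" and Ga: "(G \<longlongrightarrow> G a) (at a within A)"
    using f(1) G a by (auto simp: continuous_on_def)
  show "((\<lambda>x. S (f x) (G x)) \<longlongrightarrow> S (f a) (G a)) (at a within A)"
  proof (rule LIM_zero_cancel, rule Lim_null_comparison)
    show "\<forall>\<^sub>F x in at a within A. norm (S (f x) (G x) - S (f a) (G a))
      \<le> K * norm (G x - G a) + K * norm (S \<bar>f x - f a\<bar> (G a) - G a)"
      unfolding eventually_at_filter
    proof (intro always_eventually allI impI)
      fix x assume x: "x \<in> A"
      have eq: "S (f x) (G x) - S (f a) (G a) = S (f x) (G x - G a) + (S (f x) (G a) - S (f a) (G a))"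
        using linear_diff[OF bounded_linear.linear[OF bounded_linear_S[OF f(2)[OF x]]]] by simp
      have "norm (S (f x) (G a) - S (f a) (G a)) \<le> K * norm (S \<bar>f x - f a\<bar> (G a) - G a)"
        using norm_S_diff_le[OF f(2)[OF a], of "f x" "G a"] norm_S_diff_le[OF f(2)[OF x], of "f a" "G a"]
        by (cases "f a \<le> f x") (auto simp: norm_minus_commute abs_if)
      then show "norm (S (f x) (G x) - S (f a) (G a))
        \<le> K * norm (G x - G a) + K * norm (S \<bar>f x - f a\<bar> (G a) - G a)"
        unfolding eq by (intro norm_triangle_le add_mono norm_S_le f(2)[OF x])
    qed
    have "((\<lambda>x. f x - f a) \<longlongrightarrow> 0) (at a within A)" using fa by (rule LIM_zero)
    from filterlim_compose[OF S0 this]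
    have "((\<lambda>x. norm (S \<bar>f x - f a\<bar> (G a) - G a)) \<longlongrightarrow> 0) (at a within A)" .
    moreover have "((\<lambda>x. norm (G x - G a)) \<longlongrightarrow> 0) (at a within A)"
      using Ga by (intro tendsto_norm_zero LIM_zero)
    ultimately show "((\<lambda>x. K * norm (G x - G a) + K * norm (S \<bar>f x - f a\<bar> (G a) - G a)) \<longlongrightarrow> 0) (at a within A)"
      by (intro tendsto_add_zero tendsto_mult_right_zero)
  qed
qed

lemma E_diff_quot: "((\<lambda>h. (1 / h) *\<^sub>R (E n h v - v)) \<longlongrightarrow> M n v) (at_right 0)"
proof -
  have "((\<lambda>h. E n h v) has_vector_derivative M n v) (at 0 within {0..})"
    using E_deriv[of 0 n v] by (simp add: E_0)
  then have "((\<lambda>h. (1 / norm (h - 0)) *\<^sub>R (E n h v - (E n 0 v + (h - 0) *\<^sub>R M n v))) \<longlongrightarrow> 0) (at 0 within {0..})"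
    unfolding has_vector_derivative_def has_derivative_within by blast
  then have "((\<lambda>h. (1 / norm (h - 0)) *\<^sub>R (E n h v - (E n 0 v + (h - 0) *\<^sub>R M n v))) \<longlongrightarrow> 0) (at_right 0)"
    by (rule tendsto_within_subset) auto
  then have "((\<lambda>h. (1 / h) *\<^sub>R (E n h v - v) - M n v) \<longlongrightarrow> 0) (at_right 0)"
    by (rule Lim_transform_eventually) (auto simp: E_0 eventually_at_filter algebra_simps)
  then show ?thesis by (rule LIM_zero_cancel)
qed

text \<open>Mean value inequality for \<open>E n s v - s *\<^sub>R M n v\<close>: as
  \<open>M n\<close> commutes with the flow, the derivative is controlled by \<open>M n v\<close>
  alone. The bound is uniform in \<open>h\<close>, as a dominating sequence for the generator must
  be.\<close>

lemma norm_E_diff_quot_le: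
  assumes h: "0 < h"
  shows "norm ((1 / h) *\<^sub>R (E n h v - v) - M n v) \<le> (K + 1) * norm (M n v)"
proof -
  let ?f = "\<lambda>s. E n s v - s *\<^sub>R M n v"
  have "norm (?f h - ?f 0) \<le> ((K + 1) * norm (M n v)) * norm (h - 0)"
  proof (rule differentiable_bound[of "{0..}"])
    fix s :: real assume s: "s \<in> {0..}"
    have "(?f has_vector_derivative (M n (E n s v) - M n v)) (at s within {0..})"
      by (rule derivative_eq_intros E_deriv refl | use s in simp)+
    then show "(?f has_derivative (\<lambda>x. x *\<^sub>R (M n (E n s v) - M n v))) (at s within {0..})"
      by (simp add: has_vector_derivative_def)
    have "norm (M n (E n s v) - M n v) \<le> norm (E n s (M n v)) + norm (M n v)"
      using s by (simp add: M_E norm_triangle_ineq4)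
    also have "\<dots> \<le> (K + 1) * norm (M n v)" using norm_E_le[of s n "M n v"] s by (simp add: algebra_simps)
    finally show "onorm (\<lambda>x. x *\<^sub>R (M n (E n s v) - M n v)) \<le> (K + 1) * norm (M n v)"
      by (simp add: onorm_scaleR_left onorm_id)
  qed (use h in auto)
  then have "norm (E n h v - v - h *\<^sub>R M n v) \<le> (K + 1) * norm (M n v) * h"
    using h by (simp add: E_0 algebra_simps)
  moreover have "(1 / h) *\<^sub>R (E n h v - v) - M n v = (1 / h) *\<^sub>R (E n h v - v - h *\<^sub>R M n v)"
    using h by (simp add: algebra_simps)
  ultimately show ?thesis using h by (simp only: norm_scaleR) (simp add: divide_le_eq)
qed

text \<open>Necessity is continuity of the coefficients. Conversely, the mode equations bound the
  coefficients of the error by \<open>(K + 1) * norm (C n w)\<close>, which is square summable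
  because \<open>w\<close> is an element of the space. Thus the generator is the maximal realisation
  of the mode matrices.\<close>

lemma diff_quot_S_tendsto_iff:
  "((\<lambda>h. (1 / h) *\<^sub>R (S h z - z)) \<longlongrightarrow> w) (at_right 0) \<longleftrightarrow> (\<forall>n. M n (C n z) = C n w)"
proof
  have ev: "\<forall>\<^sub>F h in at_right 0. (1 / h) *\<^sub>R (E n h (C n z) - C n z) = C n ((1 / h) *\<^sub>R (S h z - z))" for n
    by (auto simp: C_S eventually_at_filter)
  {
    assume L: "((\<lambda>h. (1 / h) *\<^sub>R (S h z - z)) \<longlongrightarrow> w) (at_right 0)"
    show "\<forall>n. M n (C n z) = C n w"
    proof
      fix n
      have "((\<lambda>h. C n ((1 / h) *\<^sub>R (S h z - z))) \<longlongrightarrow> C n w) (at_right 0)"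
        by (rule bounded_linear.tendsto[OF C_bounded_linear L])
      moreover have "((\<lambda>h. C n ((1 / h) *\<^sub>R (S h z - z))) \<longlongrightarrow> M n (C n z)) (at_right 0)"
        by (rule Lim_transform_eventually[OF E_diff_quot ev])
      ultimately show "M n (C n z) = C n w" using tendsto_unique trivial_limit_at_right_real by blast
    qed
  next
    assume M: "\<forall>n. M n (C n z) = C n w"
    have "((\<lambda>h. (1 / h) *\<^sub>R (S h z - z) - w) \<longlongrightarrow> 0) (at_right 0)"
    proof (rule tendsto_0_by_modes)
      fix n
      have "((\<lambda>h. (1 / h) *\<^sub>R (E n h (C n z) - C n z) - C n w) \<longlongrightarrow> M n (C n z) - C n w) (at_right 0)"
        by (intro tendsto_diff E_diff_quot tendsto_const)
      then have "((\<lambda>h. (1 / h) *\<^sub>R (E n h (C n z) - C n z) - C n w) \<longlongrightarrow> 0) (at_right 0)" using M by simp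
      then show "((\<lambda>h. C n ((1 / h) *\<^sub>R (S h z - z) - w)) \<longlongrightarrow> 0) (at_right 0)"
        by (rule Lim_transform_eventually) (use ev[of n] in eventually_elim, simp)
    next
      show "\<forall>\<^sub>F h in at_right 0. \<forall>n. norm (C n ((1 / h) *\<^sub>R (S h z - z) - w)) \<le> (K + 1) * norm (C n w)"
        unfolding eventually_at_filter
      proof (intro always_eventually allI impI)
        fix h :: real and n assume "h \<in> {0<..}"
        then show "norm (C n ((1 / h) *\<^sub>R (S h z - z) - w)) \<le> (K + 1) * norm (C n w)"
          using norm_E_diff_quot_le[of h n "C n z"] M by (simp add: C_S)
      qed
      show "summable (\<lambda>n. ((K + 1) * norm (C n w))\<^sup>2)"
        unfolding power_mult_distrib by (intro summable_mult bessel)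
    qed simp
    then show "((\<lambda>h. (1 / h) *\<^sub>R (S h z - z)) \<longlongrightarrow> w) (at_right 0)" by (rule LIM_zero_cancel)
  }
qed

end

section \<open>Integrals of continuous functions and the Duhamel formula\<close>

lemma borel_measurable_lebesgue_on_continuous:
  fixes f :: "real \<Rightarrow> 'b::{second_countable_topology, real_normed_vector}"
  assumes "continuous_on A f" "A \<in> sets borel"
  shows "(\<lambda>x. indicator A x *\<^sub>R f x) \<in> borel_measurable lebesgue"
  using borel_measurable_continuous_on_indicator[OF assms(2,1)]
  by (intro measurable_completion) simp

lemma integrable_indicator_continuous:
  fixes f :: "real \<Rightarrow> 'b::{second_countable_topology, banach}"
  assumes "continuous_on {a..b} f"
  shows "integrable lebesgue (\<lambda>x. indicator {a<..<b} x *\<^sub>R f x)"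
proof -
  have "bounded (f ` {a..b})"
    by (intro compact_imp_bounded compact_continuous_image assms) simp
  then obtain B where B: "\<And>x. x \<in> {a..b} \<Longrightarrow> norm (f x) \<le> B"
    unfolding bounded_iff by blast
  show ?thesis
  proof (rule Bochner_Integration.integrable_bound[where f = "\<lambda>x. B * indicator {a..b} x"])
    show "integrable lebesgue (\<lambda>x. B * indicator {a..b} x :: real)"
      by (intro integrable_mult_right integrable_real_indicator) (auto simp: emeasure_lborel_Icc_eq)
    show "(\<lambda>x. indicator {a<..<b} x *\<^sub>R f x) \<in> borel_measurable lebesgue"
      by (intro borel_measurable_lebesgue_on_continuous continuous_on_subset[OF assms]) auto
    show "AE x in lebesgue. norm (indicator {a<..<b} x *\<^sub>R f x) \<le> norm (B * indicator {a..b} x)"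
      using order_trans[OF norm_ge_zero B] B by (auto intro!: AE_I2 simp: indicator_def abs_of_nonneg)
  qed
qed

lemma integrable_Ioo_continuous:
  fixes f :: "real \<Rightarrow> 'b::{second_countable_topology, banach}"
  assumes "continuous_on {a..b} f"
  shows "integrable (lebesgue_on {a<..<b}) f"
  using integrable_indicator_continuous[OF assms] by (simp add: integrable_restrict_space)

lemma integral_Ioo_square_eq_0:
  fixes h :: "real \<Rightarrow> real"
  assumes h: "continuous_on {a..b} h" and ab: "a < b" and 0: "(\<integral>s. (h s)\<^sup>2 \<partial>lebesgue_on {a<..<b}) = (0::real)"
    and s: "s \<in> {a..b}"
  shows "h s = 0"
proof -
  have c: "continuous_on {a..b} (\<lambda>s. (h s)\<^sup>2)" by (intro continuous_intros h)
  have "integral {a..b} (\<lambda>s. (h s)\<^sup>2) = 0"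
    using 0 lebesgue_integral_eq_integral[OF integrable_Ioo_continuous[OF c]] by (simp add: integral_open_interval_real)
  then have "\<forall>s\<in>{a..b}. (h s)\<^sup>2 = 0" using integral_eq_0_iff[OF c ab] by simp
  then show ?thesis using s by simp
qed

context mode_semigroup begin

lemma continuous_on_duhamel_integrand:
  "continuous_on {0..t} F \<Longrightarrow> continuous_on {0..t} (\<lambda>s. S (t - s) (F s))"
  by (rule continuous_on_S) (auto intro!: continuous_intros)

text \<open>Once the variable interval is written as an indicator, all integrals live on one measure
  space and dominated convergence applies.\<close>

lemma continuous_on_duhamel:
  fixes F :: "real \<Rightarrow> 'a"
  assumes F: "continuous_on {0..T} F"
  shows "continuous_on {0..T} (\<lambda>t. \<integral>s. S (t - s) (F s) \<partial>lebesgue_on {0<..<t})"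
proof (rule continuous_on_sequentiallyI)
  fix u t assume u: "\<forall>n. u n \<in> {0..T}" and t: "t \<in> {0..T}" and ut: "u \<longlonglongrightarrow> t"
  let ?g = "\<lambda>t s. indicator {0<..<t} s *\<^sub>R S (t - s) (F s)"
  have eq: "(\<integral>s. S (t - s) (F s) \<partial>lebesgue_on {0<..<t}) = (\<integral>s. ?g t s \<partial>lebesgue)" for t
    by (rule integral_restrict_space) simp
  have "bounded (F ` {0..T})"
    by (intro compact_imp_bounded compact_continuous_image F) simp
  then obtain B where B: "\<And>s. s \<in> {0..T} \<Longrightarrow> norm (F s) \<le> B"
    unfolding bounded_iff by blast
  have Ft: "continuous_on {0..t} F" if "t \<in> {0..T}" for t
    using that by (intro continuous_on_subset[OF F]) auto
  have meas: "?g t \<in> borel_measurable lebesgue" if "t \<in> {0..T}" for t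
    using continuous_on_duhamel_integrand[OF Ft[OF that]]
    by (intro borel_measurable_lebesgue_on_continuous) (auto intro: continuous_on_subset)
  have B0: "0 \<le> B" using order_trans[OF norm_ge_zero B[OF t]] .
  have "(\<lambda>n. \<integral>s. ?g (u n) s \<partial>lebesgue) \<longlonglongrightarrow> (\<integral>s. ?g t s \<partial>lebesgue)"
  proof (rule integral_dominated_convergence[where w = "\<lambda>s. \<bar>K\<bar> * B * indicator {0..T} s"])
    show "?g t \<in> borel_measurable lebesgue" by (rule meas[OF t])
    show "?g (u n) \<in> borel_measurable lebesgue" for n using u by (intro meas) auto
    show "integrable lebesgue (\<lambda>s. \<bar>K\<bar> * B * indicator {0..T} s :: real)"
      by (intro integrable_mult_right integrable_real_indicator) (auto simp: emeasure_lborel_Icc_eq)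
    \<comment> \<open>At \<open>s = t\<close> the indicators need not converge; a single point is a
      null set.\<close>
    have "AE s in lebesgue. s \<noteq> t"
      using AE_not_in[of "{t}" lebesgue] by (simp add: negligible_iff_null_sets[symmetric])
    then show "AE s in lebesgue. (\<lambda>n. ?g (u n) s) \<longlonglongrightarrow> ?g t s"
    proof (rule AE_mp, intro AE_I2 impI)
      fix s assume "s \<noteq> t"
      then consider "s \<le> 0" | "t < s" | "0 < s" "s < t" by linarith
      then show "(\<lambda>n. ?g (u n) s) \<longlonglongrightarrow> ?g t s"
      proof cases
        case 1
        then show ?thesis by simp
      next
        case 2
        have "\<forall>\<^sub>F n in sequentially. u n < s" using ut 2 by (rule order_tendstoD)
        then have "\<forall>\<^sub>F n in sequentially. ?g (u n) s = 0" by eventually_elim auto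
        then show ?thesis using 2 by (auto intro: tendsto_eventually)
      next
        case 3
        have "continuous_on {s..} (\<lambda>r. S (r - s) (F s))"
          by (rule continuous_on_S) (auto intro!: continuous_intros)
        then have "isCont (\<lambda>r. S (r - s) (F s)) t"
          by (rule continuous_on_interior) (use 3 in simp)
        then have "(\<lambda>n. S (u n - s) (F s)) \<longlonglongrightarrow> S (t - s) (F s)"
          using ut by (rule isCont_tendsto_compose)
        moreover have "\<forall>\<^sub>F n in sequentially. s < u n" using ut 3 by (intro order_tendstoD)
        then have "\<forall>\<^sub>F n in sequentially. S (u n - s) (F s) = ?g (u n) s"
          by eventually_elim (use 3 in simp)
        ultimately have "(\<lambda>n. ?g (u n) s) \<longlonglongrightarrow> S (t - s) (F s)"
          by (rule Lim_transform_eventually)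
        then show ?thesis using 3 by simp
      qed
    qed
    show "AE s in lebesgue. norm (?g (u n) s) \<le> \<bar>K\<bar> * B * indicator {0..T} s" for n
    proof (rule AE_I2)
      fix s :: real
      show "norm (?g (u n) s) \<le> \<bar>K\<bar> * B * indicator {0..T} s"
      proof (cases "s \<in> {0<..<u n}")
        case True
        then have s: "s \<in> {0..T}" using u[rule_format, of n] by auto
        have "norm (S (u n - s) (F s)) \<le> K * norm (F s)" using True by (intro norm_S_le) auto
        also have "\<dots> \<le> \<bar>K\<bar> * B" using B[OF s] by (intro mult_mono) auto
        finally show ?thesis using True s by simp
      next
        case False
        then have "?g (u n) s = 0" by (auto simp: indicator_def)
        then show ?thesis using B0 by (simp only: norm_zero) simp
      qed
    qed
  qed
  then show "(\<lambda>n. \<integral>s. S (u n - s) (F s) \<partial>lebesgue_on {0<..<u n}) \<longlonglongrightarrow> (\<integral>s. S (t - s) (F s) \<partial>lebesgue_on {0<..<t})"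
    unfolding eq .
qed

lemma continuous_on_S_orbit: "continuous_on {0..T} (\<lambda>t. S t z)"
  by (rule continuous_on_S) (auto intro!: continuous_intros)

lemma mild_solution_duhamel:
  fixes F :: "real \<Rightarrow> 'a"
  assumes "is_generator S D A" "continuous_on {0..T} F"
  shows "mild_solution D A F z0 T (\<lambda>t. S t z0 + (\<integral>s. S (t - s) (F s) \<partial>lebesgue_on {0<..<t}))"
  unfolding mild_solution_def
  using assms c0_semigroup_S
  by (intro conjI continuous_on_add continuous_on_S_orbit continuous_on_duhamel exI[of _ S]) auto

end

text \<open>The exponential series of \<open>t M\<close> applied to \<open>v\<close>, dominated for
  bounded \<open>t\<close> by a scalar exponential series and differentiated term by term.\<close>

lemma linear_ode_solution_ex:
  fixes M :: "'v::banach \<Rightarrow> 'v"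
  assumes M: "bounded_linear M"
  shows "\<exists>y. y 0 = v \<and> (\<forall>t. (y has_vector_derivative M (y t)) (at t))"
proof -
  interpret M: bounded_linear M by fact
  obtain L where L: "L > 0" "\<And>x. norm (M x) \<le> norm x * L" using M.pos_bounded by blast
  define u where "u k t = (t ^ k / fact k) *\<^sub>R (M ^^ k) v" for k and t :: real
  have pw: "norm ((M ^^ k) v) \<le> norm v * L ^ k" for k
  proof (induction k)
    case (Suc k)
    have "norm ((M ^^ Suc k) v) \<le> norm ((M ^^ k) v) * L" using L(2) by simp
    also have "\<dots> \<le> (norm v * L ^ k) * L" using Suc L(1) by (intro mult_right_mono) auto
    finally show ?case by (simp add: mult_ac)
  qed simp
  have u_le: "norm (u k t) \<le> norm v * ((R * L) ^ k / fact k)" if "\<bar>t\<bar> \<le> R" for k t R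
  proof -
    have "norm (u k t) = \<bar>t\<bar> ^ k / fact k * norm ((M ^^ k) v)" by (simp add: u_def power_abs)
    also have "\<dots> \<le> R ^ k / fact k * (norm v * L ^ k)"
      using that by (intro mult_mono pw divide_right_mono power_mono) auto
    finally show ?thesis by (simp add: power_mult_distrib mult_ac)
  qed
  have sum_exp: "summable (\<lambda>k. norm v * ((R * L) ^ k / fact k))" for R
    using summable_exp[of "R * L"] by (intro summable_mult) (simp add: field_simps)
  have summ: "summable (\<lambda>k. u k t)" for t
    by (rule summable_comparison_test'[OF sum_exp[of "\<bar>t\<bar>"], rule_format]) (rule u_le, simp)
  define s where "s t = (\<Sum>k. u k t)" for t
  \<comment> \<open>Differentiation maps term \<open>k + 1\<close> to \<open>M\<close> of term
    \<open>k\<close> and kills the constant term, hence the case distinction.\<close>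
  have deriv: "(u k has_derivative (\<lambda>h. h *\<^sub>R (case k of 0 \<Rightarrow> 0 | Suc k \<Rightarrow> M (u k t)))) (at t within A)" for k t A
  proof (cases k)
    case (Suc j)
    have "((\<lambda>t::real. t ^ Suc j / fact (Suc j)) has_real_derivative t ^ j / fact j) (at t within A)"
    proof (rule DERIV_cong[OF DERIV_cdivide[OF DERIV_pow]])
      show "real (Suc j) * t ^ (Suc j - Suc 0) / fact (Suc j) = t ^ j / fact j"
        by (simp add: fact_Suc del: of_nat_Suc)
    qed
    then have "((\<lambda>t. (t ^ Suc j / fact (Suc j)) *\<^sub>R (M ^^ Suc j) v) has_vector_derivative (t ^ j / fact j) *\<^sub>R (M ^^ Suc j) v) (at t within A)"
      using has_vector_derivative_scaleR[OF _ has_vector_derivative_const] by fastforce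
    then show ?thesis using Suc by (simp add: has_vector_derivative_def u_def[abs_def] M.scaleR)
  qed (simp add: u_def[abs_def])
  have "(s has_vector_derivative M (s t)) (at t)" for t
  proof -
    define R where "R = \<bar>t\<bar> + 1"
    let ?B = "ball (0::real) R"
    have ul: "uniform_limit ?B (\<lambda>n t. \<Sum>k<n. u k t) s sequentially"
      unfolding s_def[abs_def] by (rule Weierstrass_m_test[OF _ sum_exp[of R]]) (rule u_le, simp)
    have "\<exists>g. \<forall>x\<in>?B. (\<lambda>k. u k x) sums g x \<and> (g has_derivative (\<lambda>h. h *\<^sub>R M (s x))) (at x within ?B)"
    proof (rule has_derivative_series[OF _ deriv _ _ summable_sums[OF summ[of 0]]])
      fix e :: real assume e: "e > 0"
      then have "\<forall>\<^sub>F n in sequentially. \<forall>x\<in>?B. dist (\<Sum>k<n. u k x) (s x) < e / L"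
        using uniform_limitD[OF ul] L(1) by simp
      then obtain N where N: "\<And>n x. N \<le> n \<Longrightarrow> x \<in> ?B \<Longrightarrow> dist (\<Sum>k<n. u k x) (s x) < e / L"
        unfolding eventually_sequentially by blast
      \<comment> \<open>Because of this shift, the derivative of the sum of \<open>n\<close> terms
        is \<open>M\<close> of the sum of \<open>n - 1\<close> terms.\<close>
      have ev: "\<forall>\<^sub>F n in sequentially. 0 < n \<and> (\<forall>x\<in>?B. dist (\<Sum>k<n - 1. u k x) (s x) < e / L)"
        unfolding eventually_sequentially
      proof (intro exI[of _ "Suc N"] allI impI conjI ballI)
        fix n x assume n: "Suc N \<le> n" and x: "x \<in> ?B"
        have "N \<le> n - 1" using n by simp
        then show "dist (\<Sum>k<n - 1. u k x) (s x) < e / L" using x by (rule N)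
      qed simp
      show "\<forall>\<^sub>F n in sequentially. \<forall>x\<in>?B. \<forall>h. norm ((\<Sum>k<n. h *\<^sub>R (case k of 0 \<Rightarrow> 0 | Suc k \<Rightarrow> M (u k x))) - h *\<^sub>R M (s x)) \<le> e * norm h"
        using ev
      proof (rule eventually_mono, intro ballI allI)
        fix n x and h :: real assume n: "0 < n \<and> (\<forall>x\<in>?B. dist (\<Sum>k<n - 1. u k x) (s x) < e / L)" and x: "x \<in> ?B"
        then obtain m where m: "n = Suc m" using gr0_implies_Suc by blast
        have "(\<Sum>k<n. h *\<^sub>R (case k of 0 \<Rightarrow> 0 | Suc k \<Rightarrow> M (u k x))) - h *\<^sub>R M (s x) = h *\<^sub>R M ((\<Sum>k<m. u k x) - s x)"
          by (simp add: m sum.lessThan_Suc_shift M.diff M.sum scaleR_sum_right scaleR_diff_right del: sum.lessThan_Suc)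
        also have "norm \<dots> \<le> \<bar>h\<bar> * (norm ((\<Sum>k<m. u k x) - s x) * L)"
          by (simp add: L(2) mult_left_mono)
        also have "\<dots> \<le> \<bar>h\<bar> * (e / L * L)"
        proof (intro mult_left_mono mult_right_mono)
          show "norm ((\<Sum>k<m. u k x) - s x) \<le> e / L"
            using n x m by (auto simp: dist_norm intro: less_imp_le)
        qed (use L(1) in auto)
        finally show "norm ((\<Sum>k<n. h *\<^sub>R (case k of 0 \<Rightarrow> 0 | Suc k \<Rightarrow> M (u k x))) - h *\<^sub>R M (s x)) \<le> e * norm h"
          using L(1) by (simp add: mult.commute)
      qed
    qed (auto simp: R_def)
    then obtain g where g: "\<And>x. x \<in> ?B \<Longrightarrow> (\<lambda>k. u k x) sums g x"
      "\<And>x. x \<in> ?B \<Longrightarrow> (g has_derivative (\<lambda>h. h *\<^sub>R M (s x))) (at x within ?B)" by blast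
    have t: "t \<in> ?B" by (simp add: R_def)
    have "(s has_derivative (\<lambda>h. h *\<^sub>R M (s t))) (at t within ?B)"
      by (rule has_derivative_transform[OF t _ g(2)[OF t]]) (use g(1) in \<open>auto simp: s_def sums_iff\<close>)
    then show ?thesis by (simp only: has_vector_derivative_def at_within_open[OF t open_ball])
  qed
  moreover have "s 0 = v"
  proof -
    have "s 0 = (\<Sum>k. if k = 0 then v else 0)"
      unfolding s_def by (rule suminf_cong) (simp add: u_def)
    then show ?thesis using sums_single[of 0 "\<lambda>_. v"] by (simp add: sums_iff)
  qed
  ultimately show ?thesis by (intro exI[of _ s] conjI allI)
qed

section \<open>Test functions\<close>

definition smooth :: "(real \<Rightarrow> complex) \<Rightarrow> bool" where
  "smooth f \<longleftrightarrow> (\<forall>n x. (vderiv ^^ n) f differentiable (at x))"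

lemma vderiv_eqI: "(\<And>x. (f has_vector_derivative f' x) (at x)) \<Longrightarrow> vderiv f = f'"
  unfolding vderiv_def by (auto intro: vector_derivative_at)

text \<open>Coinduction: it suffices to place \<open>f\<close> in a class each of whose members has
  a derivative in the class. No formula for higher derivatives is needed.\<close>

lemma smooth_coinduct:
  assumes "Q f" and step: "\<And>f. Q f \<Longrightarrow> \<exists>f'. Q f' \<and> (\<forall>x. (f has_vector_derivative f' x) (at x))"
  shows "smooth f"
proof -
  have "Q ((vderiv ^^ n) f)" for n
  proof (induction n)
    case (Suc n)
    then show ?case using step[of "(vderiv ^^ n) f"] vderiv_eqI by fastforce
  qed (use assms in simp)
  then show ?thesis
    unfolding smooth_def using step by (blast intro: differentiableI_vector)
qed

lemma smooth_has_vderiv: "smooth f \<Longrightarrow> (f has_vector_derivative vderiv f x) (at x)"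
  unfolding smooth_def vderiv_def by (metis funpow_0 vector_derivative_works)

lemma smooth_vderiv: "smooth f \<Longrightarrow> smooth (vderiv f)"
  unfolding smooth_def by (metis comp_apply funpow_Suc_right)

lemma smooth_continuous_on: "smooth f \<Longrightarrow> continuous_on A f"
  using smooth_has_vderiv by (meson continuous_at_imp_continuous_on has_vector_derivative_continuous)

text \<open>The class for products: differentiating a product gives a sum of products, so products
  alone are not closed under differentiation.\<close>

inductive smooth_algebra :: "(real \<Rightarrow> complex) \<Rightarrow> bool" where
  base: "smooth f \<Longrightarrow> smooth_algebra f"
| add: "smooth_algebra f \<Longrightarrow> smooth_algebra g \<Longrightarrow> smooth_algebra (\<lambda>x. f x + g x)"
| mult: "smooth_algebra f \<Longrightarrow> smooth_algebra g \<Longrightarrow> smooth_algebra (\<lambda>x. f x * g x)"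

lemma smooth_algebra_imp_smooth: "smooth_algebra f \<Longrightarrow> smooth f"
proof (erule smooth_coinduct)
  fix f assume "smooth_algebra f"
  then show "\<exists>f'. smooth_algebra f' \<and> (\<forall>x. (f has_vector_derivative f' x) (at x))"
  proof induction
    case (base f)
    then show ?case using smooth_has_vderiv smooth_vderiv smooth_algebra.base by blast
  next
    case (add f g)
    then obtain f' g' where fg: "smooth_algebra f'" "smooth_algebra g'"
      "\<And>x. (f has_vector_derivative f' x) (at x)" "\<And>x. (g has_vector_derivative g' x) (at x)" by blast
    then show ?case
      by (intro exI[of _ "\<lambda>x. f' x + g' x"] conjI allI smooth_algebra.add has_vector_derivative_add)
  next
    case (mult f g)
    then obtain f' g' where fg: "smooth_algebra f'" "smooth_algebra g'"
      "\<And>x. (f has_vector_derivative f' x) (at x)" "\<And>x. (g has_vector_derivative g' x) (at x)" by blast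
    with mult.hyps show ?case
      by (intro exI[of _ "\<lambda>x. f x * g' x + f' x * g x"] conjI allI smooth_algebra.add smooth_algebra.mult
            has_vector_derivative_mult)
  qed
qed

lemma smooth_add: "smooth f \<Longrightarrow> smooth g \<Longrightarrow> smooth (\<lambda>x. f x + g x)"
  and smooth_mult: "smooth f \<Longrightarrow> smooth g \<Longrightarrow> smooth (\<lambda>x. f x * g x)"
  by (blast intro: smooth_algebra_imp_smooth smooth_algebra.intros)+

lemma smooth_const: "smooth (\<lambda>x. c)"
  by (rule smooth_coinduct[of "\<lambda>f. \<exists>c. f = (\<lambda>x. c)"]) (auto intro!: exI[of _ "\<lambda>x. 0"])

lemma smooth_cos: "smooth (\<lambda>x. of_real (cos (k * x)))"
proof (rule smooth_coinduct[of "\<lambda>f. \<exists>a b. f = (\<lambda>x. of_real (a * cos (k * x) + b * sin (k * x)))"])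
  show "\<exists>a b. (\<lambda>x. complex_of_real (cos (k * x))) = (\<lambda>x. of_real (a * cos (k * x) + b * sin (k * x)))"
    by (intro exI[of _ 1] exI[of _ 0]) simp
  fix f :: "real \<Rightarrow> complex" assume "\<exists>a b. f = (\<lambda>x. of_real (a * cos (k * x) + b * sin (k * x)))"
  then obtain a b where f: "f = (\<lambda>x. of_real (a * cos (k * x) + b * sin (k * x)))" by blast
  have "(f has_vector_derivative of_real ((b * k) * cos (k * x) + (- a * k) * sin (k * x))) (at x)" for x
    unfolding f
    by (rule has_vector_derivative_of_real)
       (auto intro!: derivative_eq_intros simp: has_real_derivative_iff_has_vector_derivative[symmetric] algebra_simps)
  then show "\<exists>f'. (\<exists>a b. f' = (\<lambda>x. of_real (a * cos (k * x) + b * sin (k * x)))) \<and> (\<forall>x. (f has_vector_derivative f' x) (at x))"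
    by blast
qed

lemma smooth_cnj: "smooth f \<Longrightarrow> smooth (\<lambda>x. cnj (f x))"
proof (rule smooth_coinduct[of "\<lambda>f. \<exists>g. smooth g \<and> f = (\<lambda>x. cnj (g x))"])
  fix f assume "\<exists>g. smooth g \<and> f = (\<lambda>x. cnj (g x))"
  then obtain g where g: "smooth g" "f = (\<lambda>x. cnj (g x))" by blast
  then have "(f has_vector_derivative cnj (vderiv g x)) (at x)" for x
    using smooth_has_vderiv[OF g(1)] by (auto intro: has_vector_derivative_cnj)
  then show "\<exists>f'. (\<exists>g. smooth g \<and> f' = (\<lambda>x. cnj (g x))) \<and> (\<forall>x. (f has_vector_derivative f' x) (at x))"
    using smooth_vderiv[OF g(1)] by blast
qed blast

lemma smooth_affine: "smooth f \<Longrightarrow> smooth (\<lambda>x. f (a * x + b))"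
proof (rule smooth_coinduct[of "\<lambda>f. \<exists>g c. smooth g \<and> f = (\<lambda>x. c *\<^sub>R g (a * x + b))"])
  assume "smooth f"
  then show "\<exists>g c. smooth g \<and> (\<lambda>x. f (a * x + b)) = (\<lambda>x. c *\<^sub>R g (a * x + b))"
    by (intro exI[of _ f] exI[of _ 1]) simp
next
  fix f assume "\<exists>g c. smooth g \<and> f = (\<lambda>x. c *\<^sub>R g (a * x + b))"
  then obtain g c where g: "smooth g" "f = (\<lambda>x. c *\<^sub>R g (a * x + b))" by blast
  have "(f has_vector_derivative (c * a) *\<^sub>R vderiv g (a * x + b)) (at x)" for x
  proof -
    have "((\<lambda>x. a * x + b) has_vector_derivative a) (at x)"
      by (auto intro!: derivative_eq_intros simp: has_real_derivative_iff_has_vector_derivative[symmetric])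
    from vector_diff_chain_at[OF this smooth_has_vderiv[OF g(1)]]
    have "((\<lambda>x. g (a * x + b)) has_vector_derivative a *\<^sub>R vderiv g (a * x + b)) (at x)" by (simp add: o_def)
    from has_vector_derivative_scaleR[OF DERIV_const this, of c] show ?thesis by (simp add: g(2))
  qed
  then show "\<exists>f'. (\<exists>g c. smooth g \<and> f' = (\<lambda>x. c *\<^sub>R g (a * x + b))) \<and> (\<forall>x. (f has_vector_derivative f' x) (at x))"
    using smooth_vderiv[OF g(1)] by blast
qed

text \<open>The classical flat function \<open>exp (- (1 / x))\<close> together with the shape of
  all its derivatives. Keeping the polynomial as a parameter closes the family under
  differentiation.\<close>

definition flat :: "real poly \<Rightarrow> real \<Rightarrow> real" where
  "flat p x = (if x \<le> 0 then 0 else poly p (1 / x) * exp (- (1 / x)))"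

lemma poly_times_exp_minus_tendsto_0: "((\<lambda>y. poly p y * exp (- y)) \<longlongrightarrow> (0::real)) at_top"
proof (induction p)
  case (pCons a p)
  have "((\<lambda>y. a * exp (- y)) \<longlongrightarrow> (0::real)) at_top" by real_asymp
  moreover have "((\<lambda>y. (y * poly p y) * exp (- y)) \<longlongrightarrow> 0) at_top"
  proof -
    have "((\<lambda>y. \<Sum>i\<le>degree p. coeff p i * (y ^ Suc i / exp y)) \<longlongrightarrow> (\<Sum>i\<le>degree p. coeff p i * 0)) at_top"
      by (intro tendsto_intros tendsto_power_div_exp_0)
    then show ?thesis
      by (simp add: poly_altdef exp_minus sum_distrib_left sum_distrib_right field_simps)
  qed
  ultimately show ?case using tendsto_add by (fastforce simp: algebra_simps)
qed simp

text \<open>With \<open>y = 1 / x\<close>, the chain rule gives the factor \<open>y\<^sup>2\<close>,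
  and the exponential turns \<open>p\<close> into \<open>p - pderiv p\<close>. At 0 the difference
  quotient is a polynomial in \<open>y\<close> times \<open>exp (- y)\<close>, which tends to
  0.\<close>

lemma flat_has_derivative:
  "(flat p has_real_derivative flat ([:0, 0, 1:] * (p - pderiv p)) x) (at x)"
proof (cases x "0::real" rule: linorder_cases)
  case less
  have "((\<lambda>x. 0) has_real_derivative 0) (at x)" by simp
  then show ?thesis
    using less by (subst DERIV_cong_ev[OF refl _ refl, of _ "\<lambda>x. 0"])
      (auto simp: flat_def intro!: eventually_nhds_in_open[of "{..<0}", THEN eventually_mono])
next
  case greater
  have "((\<lambda>x. poly p (1 / x) * exp (- (1 / x))) has_real_derivative
     poly (pderiv p) (1 / x) * (- (1 / x\<^sup>2)) * exp (- (1 / x)) + exp (- (1 / x)) * (1 / x\<^sup>2) * poly p (1 / x)) (at x)"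
    using greater
    by (auto intro!: derivative_eq_intros DERIV_chain2[OF poly_DERIV] simp: power2_eq_square)
  moreover have "poly (pderiv p) (1 / x) * (- (1 / x\<^sup>2)) * exp (- (1 / x)) + exp (- (1 / x)) * (1 / x\<^sup>2) * poly p (1 / x)
      = flat ([:0, 0, 1:] * (p - pderiv p)) x"
    using greater by (simp add: flat_def field_simps power2_eq_square)
  ultimately have "((\<lambda>x. poly p (1 / x) * exp (- (1 / x))) has_real_derivative flat ([:0, 0, 1:] * (p - pderiv p)) x) (at x)"
    by (simp only:)
  then show ?thesis
    using greater by (subst DERIV_cong_ev[OF refl _ refl, of _ "\<lambda>x. poly p (1 / x) * exp (- (1 / x))"])
      (auto simp: flat_def intro!: eventually_nhds_in_open[of "{0<..}", THEN eventually_mono])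
next
  case equal
  have "((\<lambda>h. flat p h / h) \<longlongrightarrow> 0) (at 0)"
  proof (rule filterlim_split_at)
    show "((\<lambda>h. flat p h / h) \<longlongrightarrow> 0) (at_left 0)"
      by (rule Lim_transform_eventually[of "\<lambda>_. 0"]) (auto simp: flat_def eventually_at_filter)
    have "((\<lambda>y. poly ([:0, 1:] * p) y * exp (- y)) \<longlongrightarrow> (0::real)) at_top"
      by (rule poly_times_exp_minus_tendsto_0)
    moreover have "filterlim (\<lambda>h::real. 1 / h) at_top (at_right 0)" by real_asymp
    ultimately have "((\<lambda>h. poly ([:0, 1:] * p) (1 / h) * exp (- (1 / h))) \<longlongrightarrow> 0) (at_right 0)"
      by (rule filterlim_compose)
    then show "((\<lambda>h. flat p h / h) \<longlongrightarrow> 0) (at_right 0)"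
      by (rule Lim_transform_eventually) (auto simp: flat_def eventually_at_filter)
  qed
  then show ?thesis unfolding equal by (simp add: DERIV_def flat_def)
qed

lemma smooth_flat: "smooth (\<lambda>x. of_real (flat p x))"
proof (rule smooth_coinduct[of "\<lambda>f. \<exists>p. f = (\<lambda>x. of_real (flat p x))"])
  fix f :: "real \<Rightarrow> complex" assume "\<exists>p. f = (\<lambda>x. of_real (flat p x))"
  then obtain p where f: "f = (\<lambda>x. of_real (flat p x))" by blast
  have "(f has_vector_derivative of_real (flat ([:0, 0, 1:] * (p - pderiv p)) x)) (at x)" for x
    unfolding f
    by (rule has_vector_derivative_of_real)
       (use flat_has_derivative in \<open>simp add: has_real_derivative_iff_has_vector_derivative\<close>)
  then show "\<exists>f'. (\<exists>p. f' = (\<lambda>x. of_real (flat p x))) \<and> (\<forall>x. (f has_vector_derivative f' x) (at x))"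
    by blast
qed blast

section \<open>Bump functions, supports and primitives\<close>

definition bump :: "real \<Rightarrow> real \<Rightarrow> real \<Rightarrow> real" where
  "bump a b x = flat 1 (x - a) * flat 1 (b - x)"

lemma smooth_bump: "smooth (\<lambda>x. of_real (bump a b x))"
  using smooth_mult[OF smooth_affine[OF smooth_flat[of 1], of 1 "- a"] smooth_affine[OF smooth_flat[of 1], of "- 1" b]]
  by (simp add: bump_def)

lemma bump_nonneg: "0 \<le> bump a b x"
  by (simp add: bump_def flat_def)

lemma bump_pos: "a < x \<Longrightarrow> x < b \<Longrightarrow> 0 < bump a b x"
  by (simp add: bump_def flat_def)

lemma bump_eq_0: "x \<le> a \<or> b \<le> x \<Longrightarrow> bump a b x = 0"
  by (auto simp: bump_def flat_def)

text \<open>A support contained in the open interval is compact and attains its bounds, so it keeps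
  away from both endpoints. In this form the condition is easy to check for sums, products,
  derivatives and primitives.\<close>

lemma test_function_iff:
  "test_function f \<longleftrightarrow> smooth f \<and> (\<exists>a b. 0 < a \<and> a < b \<and> b < pi \<and> (\<forall>x. x < a \<or> b < x \<longrightarrow> f x = 0))"
proof safe
  let ?S = "closure {x. f x \<noteq> 0}"
  assume "test_function f"
  then show "smooth f" and S: "\<exists>a b. 0 < a \<and> a < b \<and> b < pi \<and> (\<forall>x. x < a \<or> b < x \<longrightarrow> f x = 0)"
  proof -
    assume t: "test_function f"
    then show "smooth f" by (simp add: test_function_def smooth_def)
    have S: "?S \<subseteq> {0<..<pi}" using t by (simp add: test_function_def)
    then have "compact ?S"
      by (intro closed_closure bounded_subset[OF bounded_Ioo[of 0 pi]] compact_eq_bounded_closed[THEN iffD2] conjI) 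
    show "\<exists>a b. 0 < a \<and> a < b \<and> b < pi \<and> (\<forall>x. x < a \<or> b < x \<longrightarrow> f x = 0)"
    proof (cases "?S = {}")
      case True
      then have "f x = 0" for x using closure_subset[of "{x. f x \<noteq> 0}"] by auto
      then show ?thesis using pi_gt3 by (intro exI[of _ 1] exI[of _ 2]) auto
    next
      case False
      obtain l u where l: "l \<in> ?S" "\<And>x. x \<in> ?S \<Longrightarrow> l \<le> x" and u: "u \<in> ?S" "\<And>x. x \<in> ?S \<Longrightarrow> x \<le> u"
        using compact_attains_inf[OF \<open>compact ?S\<close> False] compact_attains_sup[OF \<open>compact ?S\<close> False] by blast
      have "l \<le> u" using l u by blast
      have "0 < l" "u < pi" using S l(1) u(1) by auto
      have "f x = 0" if "x < l \<or> u < x" for x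
        using that l(2)[of x] u(2)[of x] closure_subset[of "{x. f x \<noteq> 0}"] by force
      \<comment> \<open>Points strictly between the support and the endpoints, so that
        \<open>a < b\<close> needs no comparison beyond \<open>l \<le> u\<close>.\<close>
      then show ?thesis using \<open>0 < l\<close> \<open>u < pi\<close> \<open>l \<le> u\<close>
        by (intro exI[of _ "l / 2"] exI[of _ "(u + pi) / 2"]) auto
    qed
  qed
next
  fix a b assume f: "smooth f" "\<forall>x. x < a \<or> b < x \<longrightarrow> f x = 0" and ab: "0 < a" "b < pi"
  have "closure {x. f x \<noteq> 0} \<subseteq> {a..b}"
    by (rule closure_minimal) (use f(2) in \<open>force simp: not_less[symmetric]\<close>)+
  also have "\<dots> \<subseteq> {0<..<pi}" using ab by auto
  finally show "test_function f" using f(1) by (simp add: test_function_def smooth_def)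
qed

lemma test_function_smooth: "test_function f \<Longrightarrow> smooth f"
  by (simp add: test_function_iff)

lemma test_function_support:
  assumes "test_function f"
  obtains a b where "0 < a" "a < b" "b < pi" "\<And>x. x < a \<or> b < x \<Longrightarrow> f x = 0"
  using assms by (auto simp: test_function_iff)

lemma test_function_mult: "test_function f \<Longrightarrow> smooth g \<Longrightarrow> test_function (\<lambda>x. f x * g x)"
  unfolding test_function_iff by (auto intro: smooth_mult)

lemma test_function_add: "test_function f \<Longrightarrow> test_function g \<Longrightarrow> test_function (\<lambda>x. f x + g x)"
proof -
  assume f: "test_function f" and g: "test_function g"
  obtain a b where f': "0 < a" "a < b" "b < pi" "\<And>x. x < a \<or> b < x \<Longrightarrow> f x = 0"
    using f by (rule test_function_support) blast
  obtain c d where g': "0 < c" "c < d" "d < pi" "\<And>x. x < c \<or> d < x \<Longrightarrow> g x = 0"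
    using g by (rule test_function_support) blast
  show ?thesis unfolding test_function_iff
    using f' g' f g by (intro conjI exI[of _ "min a c"] exI[of _ "max b d"]) (auto simp: test_function_smooth smooth_add)
qed

lemma test_function_cnj: "test_function f \<Longrightarrow> test_function (\<lambda>x. cnj (f x))"
  unfolding test_function_iff by (auto intro: smooth_cnj)

lemma test_function_bump: "0 < a \<Longrightarrow> a < b \<Longrightarrow> b < pi \<Longrightarrow> test_function (\<lambda>x. of_real (bump a b x))"
  unfolding test_function_iff by (intro conjI smooth_bump exI[of _ a] exI[of _ b]) (auto simp: bump_eq_0)

lemma test_function_vderiv: "test_function f \<Longrightarrow> test_function (vderiv f)"
proof -
  assume f: "test_function f"
  obtain a b where ab: "0 < a" "a < b" "b < pi" "\<And>x. x < a \<or> b < x \<Longrightarrow> f x = 0"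
    using f by (rule test_function_support) blast
  have "vderiv f x = 0" if x: "x < a \<or> b < x" for x
  proof -
    have "(f has_vector_derivative 0) (at x)"
      by (rule has_vector_derivative_transform_within_open[of "\<lambda>_. 0" 0 x "{..<a} \<union> {b<..}"])
         (use x ab(4) in auto)
    then show ?thesis unfolding vderiv_def by (rule vector_derivative_at)
  qed
  then show ?thesis unfolding test_function_iff
    using ab f by (auto simp: test_function_smooth smooth_vderiv)
qed

text \<open>The primitive vanishes to the left of the support anyway; the zero mean makes it vanish
  to the right as well.\<close>

lemma test_function_antiderivative:
  assumes f: "test_function f" and 0: "integral {0..pi} f = 0"
  obtains F where "test_function F" "vderiv F = f"
proof -
  obtain a b where ab: "0 < a" "a < b" "b < pi" "\<And>x. x < a \<or> b < x \<Longrightarrow> f x = 0"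
    using f by (rule test_function_support) blast
  note cont = smooth_continuous_on[OF test_function_smooth[OF f]]
  \<comment> \<open>Starting at -1, outside the support, makes every \<open>x \<ge> a\<close> an
    interior point of the interval of integration, so that the derivative is two-sided.\<close>
  define F where "F x = integral {-1..x} f" for x
  have F0: "F x = 0" if "x < a" for x
  proof -
    have "F x = integral {-1..x} (\<lambda>_. 0)"
      unfolding F_def by (rule integral_cong) (use ab(4) that in auto)
    then show ?thesis by simp
  qed
  have Ib: "integral T f = integral {a..b} f" if "{a..b} \<subseteq> T" for T
    using has_integral_on_superset[OF integrable_integral[OF integrable_continuous_real[OF cont]], of a b T] ab(4) that
    by (intro integral_unique) (auto simp: not_le)
  have F1: "F x = 0" if "b < x" for x
    using Ib[of "{-1..x}"] Ib[of "{0..pi}"] 0 ab that by (auto simp: F_def)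
  have dF: "(F has_vector_derivative f x) (at x)" for x
  proof (cases "x < a")
    case True
    show ?thesis
      by (rule has_vector_derivative_transform_within_open[of "\<lambda>_. 0" "f x" x "{..<a}"])
         (use True F0 ab(4) in auto)
  next
    case False
    have "((\<lambda>u. integral {-1..u} f) has_vector_derivative f x) (at x within {-1..x + 1})"
      by (rule integral_has_vector_derivative[OF cont]) (use False ab in auto)
    moreover have "at x within {-1..x + 1} = at x"
      by (rule at_within_interior) (use False ab in \<open>auto simp: interior_atLeastAtMost_real\<close>)
    ultimately show ?thesis by (simp add: F_def[abs_def])
  qed
  have vd: "vderiv F = f" by (rule vderiv_eqI[OF dF])
  have "smooth F"
    by (rule smooth_coinduct[of "\<lambda>g. g = F \<or> smooth g"])
       (use dF test_function_smooth[OF f] smooth_has_vderiv smooth_vderiv in blast)+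
  then have "test_function F" unfolding test_function_iff using ab F0 F1 by blast
  with vd show thesis by (rule that[rotated])
qed

section \<open>Fourier series and weak derivatives\<close>

lemma continuous_sqint:
  assumes "continuous_on {0..pi} h"
  shows "sqint h"
proof -
  have "compact (h ` {0..pi})" by (intro compact_continuous_image assms) simp
  then have "bounded (h ` {0..pi})" by (rule compact_imp_bounded)
  then obtain B where B: "\<And>x. x \<in> {0..pi} \<Longrightarrow> norm (h x) \<le> B"
    unfolding bounded_iff by blast
  show ?thesis
  proof (rule sqint_bound[where w = "\<lambda>_. B\<^sup>2"])
    show "h \<in> borel_measurable Mpi"
      by (rule continuous_imp_measurable_on_sets_lebesgue) (auto intro: continuous_on_subset[OF assms])
    show "AE x in Mpi. (cmod (h x))\<^sup>2 \<le> B\<^sup>2"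
      by (rule AE_I2) (use B in \<open>auto intro!: power_mono\<close>)
  qed simp
qed

section \<open>The complex bilinear pairing\<close>

lemma sqint_cnj: "sqint f \<Longrightarrow> sqint (\<lambda>x. cnj (f x))"
proof -
  assume f: "sqint f"
  have "(\<lambda>x. cnj (f x)) \<in> borel_measurable Mpi"
    by (rule measurable_compose[OF sqint_measurable[OF f]])
       (intro borel_measurable_continuous_onI continuous_intros)
  with f show ?thesis by (simp add: sqint_def)
qed

lemma sqint_cmult: "sqint f \<Longrightarrow> sqint (\<lambda>x. c * f x)"
  by (auto simp: sqint_def norm_mult power_mult_distrib)

lemma integrable_mult_l2: "sqint f \<Longrightarrow> sqint h \<Longrightarrow> integrable Mpi (\<lambda>x. f x * h x)"
  using integrable_inner_l2[OF _ sqint_cnj, of f h] by simp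

lemma integral_Mpi_continuous:
  fixes f :: "real \<Rightarrow> 'b::euclidean_space"
  assumes "continuous_on {0..pi} f"
  shows "integral\<^sup>L Mpi f = integral {0..pi} f"
proof -
  have "compact (f ` {0..pi})" by (intro compact_continuous_image assms) simp
  then have "bounded (f ` {0..pi})" by (rule compact_imp_bounded)
  then obtain B where B: "\<And>x. x \<in> {0..pi} \<Longrightarrow> norm (f x) \<le> B"
    unfolding bounded_iff by blast
  have "integrable Mpi f"
  proof (rule Mpi.integrable_const_bound[where B = B])
    show "f \<in> borel_measurable Mpi"
      by (rule continuous_imp_measurable_on_sets_lebesgue) (auto intro: continuous_on_subset[OF assms])
  qed (use B in \<open>auto intro!: AE_I2\<close>)
  then show ?thesis
    by (subst lebesgue_integral_eq_integral) (auto simp: integral_open_interval_real)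
qed

text \<open>The inner product of \<open>l2\<close> keeps only a real part, whereas weak derivatives
  and Fourier coefficients need the whole complex integral.\<close>

definition pairing :: "l2 \<Rightarrow> (real \<Rightarrow> complex) \<Rightarrow> complex" where
  "pairing f h = (\<integral>x. rep_l2 f x * h x \<partial>Mpi)"

lemma pairing_abs: "sqint f \<Longrightarrow> sqint h \<Longrightarrow> pairing (abs_l2 f) h = (\<integral>x. f x * h x \<partial>Mpi)"
  unfolding pairing_def
  by (rule integral_cong_AE)
     (use rep_abs_l2[of f] in \<open>auto intro: borel_measurable_integrable integrable_mult_l2 sqint_rep_l2\<close>)

lemma norm_abs_l2_cmod: "sqint f \<Longrightarrow> norm (abs_l2 (\<lambda>x. complex_of_real (cmod (f x)))) = norm (abs_l2 f)"
  by (rule power2_eq_imp_eq) (simp_all add: norm_abs_l2 sqint_cmod)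

text \<open>Cauchy-Schwarz for the real inner product would bound the real part only; it is applied
  to the moduli, which have the same norms and a real integral.\<close>

lemma norm_integral_mult_le:
  assumes "sqint f" "sqint h"
  shows "norm (\<integral>x. f x * h x \<partial>Mpi) \<le> norm (abs_l2 f) * norm (abs_l2 h)"
proof -
  let ?F = "\<lambda>x. complex_of_real (cmod (f x))" and ?H = "\<lambda>x. complex_of_real (cmod (h x))"
  have e: "eqae ?F ?F" "eqae ?H ?H" using assms by (auto simp: eqae_def sqint_cmod)
  have "norm (\<integral>x. f x * h x \<partial>Mpi) \<le> (\<integral>x. norm (f x * h x) \<partial>Mpi)" by (rule integral_norm_bound)
  also have "\<dots> = Re (\<integral>x. complex_of_real (norm (f x * h x)) \<partial>Mpi)" by simp
  also have "\<dots> = inner (abs_l2 ?F) (abs_l2 ?H)"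
    by (simp only: inner_l2.abs_eq[OF e] norm_mult of_real_mult complex_cnj_complex_of_real)
  also have "\<dots> \<le> norm (abs_l2 ?F) * norm (abs_l2 ?H)" by (rule norm_cauchy_schwarz)
  finally show ?thesis by (simp only: norm_abs_l2_cmod assms)
qed

lemma pairing_add: "sqint h \<Longrightarrow> pairing (f + g) h = pairing f h + pairing g h"
proof -
  assume h: "sqint h"
  obtain f' where f: "sqint f'" "f = abs_l2 f'" by (rule l2_cases)
  obtain g' where g: "sqint g'" "g = abs_l2 g'" by (rule l2_cases)
  show ?thesis
    by (simp add: f g abs_l2_add pairing_abs h sqint_add distrib_right integrable_mult_l2)
qed

lemma pairing_scaleR: "sqint h \<Longrightarrow> pairing (r *\<^sub>R f) h = r *\<^sub>R pairing f h"
proof -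
  assume h: "sqint h"
  obtain f' where f: "sqint f'" "f = abs_l2 f'" by (rule l2_cases)
  show ?thesis
    by (simp add: f(2) abs_l2_scaleR[OF f(1)] pairing_abs f(1) h sqint_scaleR del: scaleR_conv_of_real)
qed

lemma norm_pairing_le: "sqint h \<Longrightarrow> norm (pairing f h) \<le> norm f * norm (abs_l2 h)"
  using norm_integral_mult_le[OF sqint_rep_l2[of f]] by (simp add: pairing_def abs_rep_l2)

lemma bounded_linear_pairing: "sqint h \<Longrightarrow> bounded_linear (\<lambda>f. pairing f h)"
  by (rule bounded_linear_intro[OF pairing_add pairing_scaleR norm_pairing_le])

lemma pairing_diff_right: "sqint h \<Longrightarrow> sqint k \<Longrightarrow> pairing f (\<lambda>x. h x - k x) = pairing f h - pairing f k"
  unfolding pairing_def by (simp add: right_diff_distrib integrable_mult_l2 sqint_rep_l2)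

lemma pairing_cmult: "pairing f (\<lambda>x. c * h x) = c * pairing f h"
  unfolding pairing_def by (simp add: mult.left_commute)

lemma inner_abs_l2: "sqint h \<Longrightarrow> inner f (abs_l2 h) = Re (pairing f (\<lambda>x. cnj (h x)))"
proof -
  assume h: "sqint h"
  have "inner (abs_l2 (rep_l2 f)) (abs_l2 h) = Re (\<integral>x. rep_l2 f x * cnj (h x) \<partial>Mpi)"
    by (rule inner_l2.abs_eq) (use h in \<open>auto simp: eqae_def sqint_rep_l2\<close>)
  then show ?thesis by (simp add: abs_rep_l2 pairing_def)
qed

definition fourier_coeff :: "(real \<Rightarrow> real) \<Rightarrow> l2 \<Rightarrow> complex" where
  "fourier_coeff e f = pairing f (\<lambda>x. of_real (e x))"

definition fourier_mode :: "(real \<Rightarrow> real) \<Rightarrow> complex \<Rightarrow> l2" where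
  "fourier_mode e \<alpha> = abs_l2 (\<lambda>x. \<alpha> * of_real (e x))"

lemma sqint_of_real: "continuous_on {0..pi} e \<Longrightarrow> sqint (\<lambda>x. complex_of_real (e x))"
  by (intro continuous_sqint continuous_intros)

lemma pairing_fourier_mode:
  assumes "continuous_on {0..pi} e" "sqint h"
  shows "pairing (fourier_mode e \<alpha>) h = \<alpha> * (\<integral>x. of_real (e x) * h x \<partial>Mpi)"
  unfolding fourier_mode_def by (simp add: pairing_abs assms sqint_cmult sqint_of_real mult.assoc)

lemma inner_fourier_mode: "continuous_on {0..pi} e \<Longrightarrow> inner (fourier_mode e \<alpha>) f = inner \<alpha> (fourier_coeff e f)"
proof -
  assume e: "continuous_on {0..pi} e"
  have "inner f (fourier_mode e \<alpha>) = Re (cnj \<alpha> * pairing f (\<lambda>x. of_real (e x)))"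
    unfolding fourier_mode_def by (simp add: inner_abs_l2 sqint_cmult sqint_of_real e pairing_cmult)
  then show ?thesis by (simp add: inner_commute[of _ f] fourier_coeff_def inner_complex_def)
qed

lemma fourier_coeff_mode:
  assumes "continuous_on {0..pi} e" "continuous_on {0..pi} e'"
  shows "fourier_coeff e (fourier_mode e' \<alpha>) = \<alpha> * of_real (integral {0..pi} (\<lambda>x. e' x * e x))"
proof -
  have "(\<integral>x. complex_of_real (e' x) * of_real (e x) \<partial>Mpi) = of_real (\<integral>x. e' x * e x \<partial>Mpi)"
    by (simp flip: of_real_mult)
  also have "(\<integral>x. e' x * e x \<partial>Mpi) = integral {0..pi} (\<lambda>x. e' x * e x)"
    by (intro integral_Mpi_continuous continuous_intros assms)
  finally show ?thesis
    by (simp add: fourier_coeff_def pairing_fourier_mode assms sqint_of_real)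
qed

text \<open>The alternative \<open>e n = (\<lambda>x. 0)\<close> admits the sine of index 0.\<close>

lemma mode_decomposition_l2I:
  assumes cont: "\<And>n. continuous_on {0..pi} (e n)"
    and orth: "\<And>m n. m \<noteq> n \<Longrightarrow> integral {0..pi} (\<lambda>x. e n x * e m x) = 0"
    and norm: "\<And>n. e n = (\<lambda>x. 0) \<or> integral {0..pi} (\<lambda>x. e n x * e n x) = 1"
    and complete: "\<And>f. sqint f \<Longrightarrow> (\<And>n. (\<integral>x. f x * of_real (e n x) \<partial>Mpi) = 0) \<Longrightarrow> AE x in Mpi. f x = 0"
  shows "mode_decomposition (\<lambda>n. fourier_coeff (e n)) (\<lambda>n. fourier_mode (e n))"
proof (rule mode_decomposition.intro)
  show "bounded_linear (fourier_coeff (e n))" for n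
    unfolding fourier_coeff_def[abs_def] by (intro bounded_linear_pairing sqint_of_real cont)
  show "inner (fourier_mode (e n) \<alpha>) z = inner \<alpha> (fourier_coeff (e n) z)" for n \<alpha> z by (rule inner_fourier_mode[OF cont])
  show "m \<noteq> n \<Longrightarrow> fourier_coeff (e m) (fourier_mode (e n) \<alpha>) = 0" for m n \<alpha> by (simp add: fourier_coeff_mode cont orth)
  show "fourier_coeff (e n) (fourier_mode (e n) (fourier_coeff (e n) z)) = fourier_coeff (e n) z" for n z
    using norm[of n] by (auto simp: fourier_coeff_mode cont) (simp_all add: fourier_coeff_def pairing_def)
  fix z assume z: "\<And>n. fourier_coeff (e n) z = 0"
  have "AE x in Mpi. rep_l2 z x = 0"
    by (rule complete[OF sqint_rep_l2]) (use z in \<open>simp add: fourier_coeff_def pairing_def\<close>)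
  then have "abs_l2 (rep_l2 z) = abs_l2 (\<lambda>x. 0)" by (simp add: abs_l2_eq_iff sqint_rep_l2 sqint_zero)
  then show "z = 0" by (simp add: abs_rep_l2 zero_l2.abs_eq)
qed

section \<open>The cosine and sine bases and their completeness\<close>

definition cos_basis :: "nat \<Rightarrow> real \<Rightarrow> real" where
  "cos_basis n x = (if n = 0 then sqrt (1 / pi) else sqrt (2 / pi) * cos (real n * x))"

text \<open>\<open>sin_basis 0\<close> vanishes, so that \<open>n\<close> can range over all natural numbers for both families.\<close>

definition sin_basis :: "nat \<Rightarrow> real \<Rightarrow> real" where
  "sin_basis n x = sqrt (2 / pi) * sin (real n * x)"

lemma continuous_on_cos_basis [continuous_intros]: "continuous_on A (cos_basis n)"
  unfolding cos_basis_def[abs_def] by (cases "n = 0") (auto intro!: continuous_intros)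

lemma continuous_on_sin_basis [continuous_intros]: "continuous_on A (sin_basis n)"
  unfolding sin_basis_def[abs_def] by (intro continuous_intros)

lemma integral_cos_int: "integral {0..pi} (\<lambda>x. cos (of_int k * x)) = (if k = 0 then pi else 0)"
proof (cases "k = 0")
  case False
  have "((\<lambda>x. cos (of_int k * x)) has_integral sin (of_int k * pi) / of_int k - sin (of_int k * 0) / of_int k) {0..pi}"
    by (rule fundamental_theorem_of_calculus)
       (use False in \<open>auto intro!: derivative_eq_intros simp: has_real_derivative_iff_has_vector_derivative[symmetric]\<close>)
  moreover have "sin (of_int k * pi) = 0" by (simp add: sin_zero_iff_int2)
  ultimately show ?thesis using False by (simp add: integral_unique)
qed simp

lemma integral_cos_mult_cos:
  "integral {0..pi} (\<lambda>x. cos (real m * x) * cos (real n * x)) = (if m = n then if n = 0 then pi else pi / 2 else 0)"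
proof -
  have eq: "(\<lambda>x. cos (real m * x) * cos (real n * x)) = (\<lambda>x. (1/2) * cos (of_int (int m - int n) * x) + (1/2) * cos (of_int (int m + int n) * x))"
    by (rule ext) (simp add: cos_times_cos field_simps)
  have i: "(\<lambda>x. (1/2) * cos (of_int k * x)) integrable_on {0..pi}" for k
    by (intro integrable_continuous_real continuous_intros)
  show ?thesis unfolding eq integral_add[OF i i] integral_mult_right integral_cos_int by auto
qed

lemma integral_sin_mult_sin:
  "integral {0..pi} (\<lambda>x. sin (real m * x) * sin (real n * x)) = (if m = n \<and> n \<noteq> 0 then pi / 2 else 0)"
proof -
  have eq: "(\<lambda>x. sin (real m * x) * sin (real n * x)) = (\<lambda>x. (1/2) * cos (of_int (int m - int n) * x) - (1/2) * cos (of_int (int m + int n) * x))"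
    by (rule ext) (simp add: sin_times_sin field_simps)
  have i: "(\<lambda>x. (1/2) * cos (of_int k * x)) integrable_on {0..pi}" for k
    by (intro integrable_continuous_real continuous_intros)
  show ?thesis unfolding eq integral_diff[OF i i] integral_mult_right integral_cos_int by auto
qed

lemma integral_cos_basis: "integral {0..pi} (\<lambda>x. cos_basis m x * cos_basis n x) = (if m = n then 1 else 0)"
proof -
  define k where "k n = (if n = 0 then sqrt (1 / pi) else sqrt (2 / pi))" for n :: nat
  have cb: "cos_basis n x = k n * cos (real n * x)" for n x by (simp add: cos_basis_def k_def)
  have "(\<lambda>x. cos_basis m x * cos_basis n x) = (\<lambda>x. (k m * k n) * (cos (real m * x) * cos (real n * x)))"
    by (simp add: cb mult_ac)
  then show ?thesis by (simp only: integral_mult_right integral_cos_mult_cos) (simp add: k_def real_sqrt_mult[symmetric])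
qed

lemma integral_sin_basis: "integral {0..pi} (\<lambda>x. sin_basis m x * sin_basis n x) = (if m = n \<and> n \<noteq> 0 then 1 else 0)"
proof -
  have "sqrt (2 / pi) * sqrt (2 / pi) = 2 / pi" by simp
  then have "(\<lambda>x. sin_basis m x * sin_basis n x) = (\<lambda>x. (2 / pi) * (sin (real m * x) * sin (real n * x)))"
    unfolding sin_basis_def by (metis (no_types, opaque_lifting) mult.assoc mult.left_commute)
  then show ?thesis by (simp only: integral_mult_right integral_sin_mult_sin) simp
qed

text \<open>The product formula trades one factor \<open>cos x\<close> for the frequencies
  \<open>n + 1\<close> and \<open>n - 1\<close>. In particular \<open>f\<close> is orthogonal to all
  polynomials in \<open>cos x\<close>.\<close>

lemma integral_mult_cos_power_eq_0:
  assumes f: "sqint f" and 0: "\<And>n. (\<integral>x. f x * of_real (cos (real n * x)) \<partial>Mpi) = 0"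
  shows "(\<integral>x. f x * of_real (cos (real n * x) * cos x ^ k) \<partial>Mpi) = 0"
proof (induction k arbitrary: n)
  case (Suc k)
  have I: "integrable Mpi (\<lambda>x. f x * of_real (cos (real n * x) * cos x ^ k))" for n
    by (intro integrable_mult_l2 f sqint_of_real continuous_intros)
  show ?case
  proof (cases n)
    case 0
    \<comment> \<open>At frequency 0 there is no \<open>n - 1\<close>; one factor
      \<open>cos x\<close> is itself the frequency 1.\<close>
    then show ?thesis using Suc[of 1] by simp
  next
    case (Suc m)
    have "f x * of_real (cos (real n * x) * cos x ^ Suc k)
      = (1/2) * (f x * of_real (cos (real (Suc n) * x) * cos x ^ k)) + (1/2) * (f x * of_real (cos (real m * x) * cos x ^ k))" for x
    proof -
      have "cos (real n * x) * cos x = (1/2) * cos (real (Suc n) * x) + (1/2) * cos (real m * x)"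
        unfolding cos_times_cos by (simp add: Suc algebra_simps)
      then have "cos (real n * x) * cos x ^ Suc k = (1/2) * (cos (real (Suc n) * x) * cos x ^ k) + (1/2) * (cos (real m * x) * cos x ^ k)"
        by (simp add: mult.assoc[symmetric] distrib_right)
      then show ?thesis by (simp only: of_real_add of_real_mult) (simp add: algebra_simps)
    qed
    then show ?thesis
      using I[of "Suc n"] I[of m] Suc.IH[of "Suc n"] Suc.IH[of m] by (simp del: of_real_mult of_nat_Suc)
  qed
qed (use 0 in simp)

text \<open>Weierstrass approximation after the substitution \<open>y = cos x\<close>: polynomials
  in \<open>cos x\<close> approximate \<open>h\<close> uniformly on the interval.\<close>

lemma integral_mult_continuous_eq_0:
  assumes f: "sqint f" and 0: "\<And>n. (\<integral>x. f x * of_real (cos (real n * x)) \<partial>Mpi) = 0"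
    and h: "continuous_on {0..pi} h"
  shows "(\<integral>x. f x * of_real (h x) \<partial>Mpi) = 0"
proof -
  let ?F = "\<integral>x. norm (f x) \<partial>Mpi"
  have intf: "integrable Mpi f" by (rule integrable_sqint[OF f])
  have F: "0 < ?F + 1" by (simp add: add_nonneg_pos)
  have bound: "norm (\<integral>x. f x * of_real (h x) \<partial>Mpi) \<le> e * ?F" if e: "e > 0" for e
  proof -
    have "continuous_on {-1..1} (\<lambda>y. h (arccos y))"
      by (rule continuous_on_compose2[OF h]) (auto intro!: continuous_intros arccos_lbound arccos_ubound)
    then obtain g where g: "real_polynomial_function g" "\<And>y. y \<in> {-1..1} \<Longrightarrow> \<bar>h (arccos y) - g y\<bar> < e"
      using Stone_Weierstrass_real_polynomial_function[of "{-1..1}" "\<lambda>y. h (arccos y)" e] e by auto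
    obtain a N where gN: "g = (\<lambda>y. \<Sum>i\<le>N. a i * y ^ i)"
      using g(1) by (auto simp: real_polynomial_function_iff_sum)
    have contg: "continuous_on A (\<lambda>x. g (cos x))" for A unfolding gN by (intro continuous_intros)
    have "(\<integral>x. f x * of_real (g (cos x)) \<partial>Mpi) = (\<integral>x. (\<Sum>i\<le>N. of_real (a i) * (f x * of_real (cos (real 0 * x) * cos x ^ i))) \<partial>Mpi)"
      by (simp add: gN sum_distrib_left mult_ac)
    also have "\<dots> = (\<Sum>i\<le>N. (\<integral>x. of_real (a i) * (f x * of_real (cos (real 0 * x) * cos x ^ i)) \<partial>Mpi))"
      by (intro Bochner_Integration.integral_sum integrable_mult_right integrable_mult_l2 f sqint_of_real continuous_intros)
    also have "\<dots> = 0"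
      by (simp only: integral_mult_right_zero integral_mult_cos_power_eq_0[OF f 0] mult_zero_right sum.neutral_const)
    finally have g0: "(\<integral>x. f x * of_real (g (cos x)) \<partial>Mpi) = 0" .
    have Ih: "integrable Mpi (\<lambda>x. f x * of_real (h x))" and Ig: "integrable Mpi (\<lambda>x. f x * of_real (g (cos x)))"
      by (intro integrable_mult_l2 f sqint_of_real h contg)+
    have "(\<integral>x. f x * of_real (h x) \<partial>Mpi) = (\<integral>x. f x * of_real (h x) - f x * of_real (g (cos x)) \<partial>Mpi)"
      by (simp add: Bochner_Integration.integral_diff[OF Ih Ig] g0)
    also have "norm \<dots> \<le> (\<integral>x. e * norm (f x) \<partial>Mpi)"
    proof (rule order_trans[OF integral_norm_bound], rule integral_mono)
      show "integrable Mpi (\<lambda>x. norm (f x * of_real (h x) - f x * of_real (g (cos x))))"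
        using Ih Ig by simp
      show "integrable Mpi (\<lambda>x. e * norm (f x))" using intf by simp
      fix x assume "x \<in> space Mpi"
      then have x: "0 < x" "x < pi" by auto
      then have "\<bar>h x - g (cos x)\<bar> \<le> e" using g(2)[of "cos x"] by (simp add: arccos_cos)
      then have "norm (f x) * \<bar>h x - g (cos x)\<bar> \<le> norm (f x) * e" by (intro mult_left_mono) auto
      then show "norm (f x * of_real (h x) - f x * of_real (g (cos x))) \<le> e * norm (f x)"
        unfolding right_diff_distrib[symmetric] of_real_diff[symmetric] norm_mult norm_of_real by (simp add: mult.commute)
    qed
    finally show ?thesis by simp
  qed
  have "norm (\<integral>x. f x * of_real (h x) \<partial>Mpi) \<le> 0"
  proof (rule field_le_epsilon)
    fix d :: real assume d: "d > 0"
    have "norm (\<integral>x. f x * of_real (h x) \<partial>Mpi) \<le> d / (?F + 1) * ?F"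
      by (rule bound[OF divide_pos_pos[OF d F]])
    also have "\<dots> = d * (?F / (?F + 1))" by simp
    also have "\<dots> \<le> d * 1"
    proof (rule mult_left_mono)
      show "?F / (?F + 1) \<le> 1" unfolding divide_le_eq_1_pos[OF F] by simp
    qed (use d in simp)
    finally show "norm (\<integral>x. f x * of_real (h x) \<partial>Mpi) \<le> 0 + d" by simp
  qed
  then show ?thesis by simp
qed

text \<open>Testing with \<open>cnj (f x) / (1 + cmod (f x))\<close> makes the integrand
  nonnegative, and zero only where \<open>f\<close> is. This test function is bounded and an almost
  everywhere limit of continuous ones, for which the integral vanishes.\<close>

lemma AE_eq_0_if_orthogonal_cos:
  assumes f: "sqint f" and 0: "\<And>n. (\<integral>x. f x * of_real (cos (real n * x)) \<partial>Mpi) = 0"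
  shows "AE x in Mpi. f x = 0"
proof -
  let ?I = "{0<..<pi}"
  have fm: "f \<in> borel_measurable Mpi" by (rule sqint_measurable[OF f])
  define k where "k x = cnj (f x) / of_real (1 + cmod (f x))" for x
  have km: "k \<in> borel_measurable Mpi"
  proof -
    have "(\<lambda>w. cnj w / of_real (1 + cmod w)) \<in> borel_measurable borel"
      by (intro borel_measurable_continuous_onI continuous_intros)
         (metis add_pos_nonneg norm_ge_zero of_real_eq_0_iff order_less_irrefl zero_less_one)
    from measurable_compose[OF fm this] show ?thesis by (simp add: k_def[abs_def])
  qed
  have k1: "norm (k x) \<le> 1" for x
  proof -
    have "0 < 1 + cmod (f x)" by (simp add: add_pos_nonneg)
    then show ?thesis unfolding k_def norm_divide norm_of_real complex_mod_cnj by simp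
  qed
  have "(\<lambda>x. if x \<in> ?I then k x else 0) \<in> borel_measurable lebesgue"
    using km by (subst borel_measurable_if) auto
  then have "(\<lambda>x. if x \<in> ?I then k x else 0) measurable_on ?I"
    by (rule lebesgue_measurable_imp_measurable_on) auto
  then obtain N g where N: "negligible N" and g: "\<And>n::nat. continuous_on UNIV (g n)"
    "\<And>x. x \<notin> N \<Longrightarrow> (\<lambda>n. g n x) \<longlonglongrightarrow> (if x \<in> ?I then if x \<in> ?I then k x else 0 else 0)"
    unfolding measurable_on_def by blast
  \<comment> \<open>Truncation to the unit disc supplies the bound for dominated convergence. It
    leaves the limit alone, since \<open>k\<close> takes its values in the disc.\<close>
  define G where "G n x = g n x / of_real (max 1 (cmod (g n x)))" for n x
  have Gc: "continuous_on A (G n)" for A n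
    unfolding G_def[abs_def]
    by (intro continuous_intros continuous_on_subset[OF g(1)]) auto
  have G1: "norm (G n x) \<le> 1" for n x
    by (simp add: G_def norm_divide divide_le_eq)
  have Glim: "(\<lambda>n. G n x) \<longlonglongrightarrow> k x" if "x \<notin> N" "x \<in> ?I" for x
  proof -
    have lim: "(\<lambda>n. g n x) \<longlonglongrightarrow> k x" using g(2)[OF that(1)] that(2) by simp
    have "(\<lambda>n. G n x) \<longlonglongrightarrow> k x / of_real (max 1 (cmod (k x)))"
      unfolding G_def by (intro tendsto_intros lim) auto
    then show ?thesis using k1[of x] by (simp add: max_absorb1)
  qed
  have int0: "(\<integral>x. f x * G n x \<partial>Mpi) = 0" for n
  proof -
    have c: "continuous_on {0..pi} (\<lambda>x. Re (G n x))" "continuous_on {0..pi} (\<lambda>x. Im (G n x))"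
      by (intro continuous_intros Gc)+
    have "f x * G n x = f x * of_real (Re (G n x)) + \<i> * (f x * of_real (Im (G n x)))" for x
      by (subst complex_eq[of "G n x"]) (simp add: algebra_simps)
    then have "(\<integral>x. f x * G n x \<partial>Mpi) = (\<integral>x. f x * of_real (Re (G n x)) \<partial>Mpi) + \<i> * (\<integral>x. f x * of_real (Im (G n x)) \<partial>Mpi)"
      using integrable_mult_l2[OF f sqint_of_real[OF c(1)]] integrable_mult_l2[OF f sqint_of_real[OF c(2)]] by simp
    then show ?thesis using integral_mult_continuous_eq_0[OF f 0 c(1)] integral_mult_continuous_eq_0[OF f 0 c(2)] by simp
  qed
  have Nn: "AE x in Mpi. x \<notin> N"
  proof -
    have "N \<in> null_sets lebesgue" using N by (simp add: negligible_iff_null_sets)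
    then have "AE x in lebesgue. x \<notin> N" by (rule AE_not_in)
    then show ?thesis by (subst AE_restrict_space_iff) auto
  qed
  have "(\<lambda>n. \<integral>x. f x * G n x \<partial>Mpi) \<longlonglongrightarrow> (\<integral>x. f x * k x \<partial>Mpi)"
  proof (rule integral_dominated_convergence[where w = "\<lambda>x. norm (f x)"])
    show "(\<lambda>x. f x * k x) \<in> borel_measurable Mpi" using fm km by measurable
    show "(\<lambda>x. f x * G n x) \<in> borel_measurable Mpi" for n
      using integrable_mult_l2[OF f continuous_sqint[OF Gc]] by (rule borel_measurable_integrable)
    show "integrable Mpi (\<lambda>x. norm (f x))" using integrable_sqint[OF f] by simp
    show "AE x in Mpi. (\<lambda>n. f x * G n x) \<longlonglongrightarrow> f x * k x"
      using Nn by (rule AE_mp) (auto intro!: AE_I2 tendsto_intros Glim)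
    show "AE x in Mpi. norm (f x * G n x) \<le> norm (f x)" for n
      using mult_left_mono[OF G1[of n] norm_ge_zero] by (auto simp: norm_mult intro!: AE_I2)
  qed
  then have k0: "(\<integral>x. f x * k x \<partial>Mpi) = 0" unfolding int0 by (simp add: LIMSEQ_const_iff)
  have fk: "f x * k x = of_real ((cmod (f x))\<^sup>2 / (1 + cmod (f x)))" for x
    by (simp add: k_def complex_norm_square[symmetric] flip: of_real_add)
  have "integrable Mpi (\<lambda>x. f x * k x)"
    by (rule Bochner_Integration.integrable_bound[OF integrable_norm[OF integrable_sqint[OF f]]])
       (use fm km mult_left_mono[OF k1 norm_ge_zero] in \<open>auto simp: norm_mult intro!: AE_I2\<close>)
  then have "integrable Mpi (\<lambda>x. (cmod (f x))\<^sup>2 / (1 + cmod (f x)))"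
    unfolding fk using integrable_Re by fastforce
  moreover have "(\<integral>x. (cmod (f x))\<^sup>2 / (1 + cmod (f x)) \<partial>Mpi) = 0"
    using k0 unfolding fk by (simp only: integral_complex_of_real of_real_eq_0_iff)
  ultimately have "AE x in Mpi. (cmod (f x))\<^sup>2 / (1 + cmod (f x)) = 0"
    by (subst (asm) integral_nonneg_eq_0_iff_AE) auto
  then show ?thesis
    by (rule AE_mp) (auto intro!: AE_I2 simp: add_nonneg_eq_0_iff)
qed

text \<open>The products \<open>sin x * cos (n x)\<close> are combinations of sines, so
  \<open>f * sin\<close> is orthogonal to all cosines; and \<open>sin\<close> is positive inside the
  interval.\<close>

lemma AE_eq_0_if_orthogonal_sin:
  assumes f: "sqint f" and 0: "\<And>n. (\<integral>x. f x * of_real (sin (real n * x)) \<partial>Mpi) = 0"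
  shows "AE x in Mpi. f x = 0"
proof -
  have I: "integrable Mpi (\<lambda>x. f x * of_real (sin (real n * x)))" for n
    by (intro integrable_mult_l2 f sqint_of_real continuous_intros)
  have sq: "sqint (\<lambda>x. f x * of_real (sin x))"
  proof (rule sqint_bound[OF _ sqint_integrable[OF f]])
    show "(\<lambda>x. f x * of_real (sin x)) \<in> borel_measurable Mpi"
      using I[of 1] by (simp add: borel_measurable_integrable)
    show "AE x in Mpi. (cmod (f x * of_real (sin x)))\<^sup>2 \<le> (cmod (f x))\<^sup>2"
    proof (rule AE_I2, rule power_mono)
      fix x :: real
      show "cmod (f x * of_real (sin x)) \<le> cmod (f x)"
        using mult_left_mono[OF abs_sin_le_one norm_ge_zero] by (simp add: norm_mult)
    qed simp
  qed
  have "AE x in Mpi. f x * of_real (sin x) = 0"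
  proof (rule AE_eq_0_if_orthogonal_cos[OF sq])
    fix n
    show "(\<integral>x. f x * of_real (sin x) * of_real (cos (real n * x)) \<partial>Mpi) = 0"
    proof (cases n)
      case zero: 0
      then show ?thesis using 0[of 1] by simp
    next
      case (Suc m)
      have "f x * of_real (sin x) * of_real (cos (real n * x))
        = (1/2) * (f x * of_real (sin (real (Suc n) * x))) - (1/2) * (f x * of_real (sin (real m * x)))" for x
      proof -
        have "sin x * cos (real n * x) = (1/2) * sin (real (Suc n) * x) - (1/2) * sin (real m * x)"
        proof -
          have "sin (real (Suc n) * x) = sin x * cos (real n * x) + cos x * sin (real n * x)"
            using sin_add[of x "real n * x"] by (simp add: algebra_simps)
          moreover have "sin (real m * x) = sin (real n * x) * cos x - cos (real n * x) * sin x"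
            using sin_diff[of "real n * x" x] by (simp add: Suc algebra_simps)
          ultimately show ?thesis by (simp add: field_simps)
        qed
        then show ?thesis by (simp only: mult.assoc of_real_mult[symmetric]) (simp add: algebra_simps)
      qed
      then show ?thesis
        using I[of "Suc n"] I[of m] 0[of "Suc n"] 0[of m] by (simp del: of_real_mult of_nat_Suc)
    qed
  qed
  then show ?thesis
  proof (rule AE_mp, intro AE_I2 impI)
    fix x assume "x \<in> space Mpi" "f x * of_real (sin x) = 0"
    moreover from this have "sin x > 0" by (intro sin_gt_zero) auto
    ultimately show "f x = 0" by simp
  qed
qed

abbreviation "ccoeff n \<equiv> fourier_coeff (cos_basis n)"
abbreviation "scoeff n \<equiv> fourier_coeff (sin_basis n)"
abbreviation "cmode n \<equiv> fourier_mode (cos_basis n)"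
abbreviation "smode n \<equiv> fourier_mode (sin_basis n)"

interpretation cos_modes: mode_decomposition ccoeff cmode
proof (rule mode_decomposition_l2I)
  show "integral {0..pi} (\<lambda>x. cos_basis n x * cos_basis m x) = 0" if "m \<noteq> n" for m n :: nat
    using that by (simp add: integral_cos_basis)
  show "cos_basis n = (\<lambda>x. 0) \<or> integral {0..pi} (\<lambda>x. cos_basis n x * cos_basis n x) = 1" for n :: nat
    by (simp add: integral_cos_basis)
  fix f assume f: "sqint f" and 0: "\<And>n. (\<integral>x. f x * of_real (cos_basis n x) \<partial>Mpi) = 0"
  show "AE x in Mpi. f x = 0"
  proof (rule AE_eq_0_if_orthogonal_cos[OF f])
    fix n :: nat
    define k where "k = (if n = 0 then sqrt (1 / pi) else sqrt (2 / pi))"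
    have "complex_of_real k \<noteq> 0" by (simp add: k_def)
    moreover have "(\<integral>x. f x * of_real (cos_basis n x) \<partial>Mpi) = of_real k * (\<integral>x. f x * of_real (cos (real n * x)) \<partial>Mpi)"
      by (subst integral_mult_right_zero[symmetric]) (simp add: cos_basis_def k_def mult_ac)
    ultimately show "(\<integral>x. f x * of_real (cos (real n * x)) \<partial>Mpi) = 0" using 0[of n] by simp
  qed
qed (intro continuous_intros)

interpretation sin_modes: mode_decomposition scoeff smode
proof (rule mode_decomposition_l2I)
  show "integral {0..pi} (\<lambda>x. sin_basis n x * sin_basis m x) = 0" if "m \<noteq> n" for m n :: nat
    using that by (simp add: integral_sin_basis)
  show "sin_basis n = (\<lambda>x. 0) \<or> integral {0..pi} (\<lambda>x. sin_basis n x * sin_basis n x) = 1" for n :: nat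
  proof (cases "n = 0")
    case True
    then show ?thesis by (intro disjI1) (simp add: sin_basis_def[abs_def])
  qed (simp add: integral_sin_basis)
  fix f assume f: "sqint f" and 0: "\<And>n. (\<integral>x. f x * of_real (sin_basis n x) \<partial>Mpi) = 0"
  show "AE x in Mpi. f x = 0"
  proof (rule AE_eq_0_if_orthogonal_sin[OF f])
    fix n
    have "(\<integral>x. f x * of_real (sin_basis n x) \<partial>Mpi) = of_real (sqrt (2 / pi)) * (\<integral>x. f x * of_real (sin (real n * x)) \<partial>Mpi)"
      by (subst integral_mult_right_zero[symmetric]) (simp add: sin_basis_def mult_ac)
    then show "(\<integral>x. f x * of_real (sin (real n * x)) \<partial>Mpi) = 0" using 0[of n] by simp
  qed
qed (intro continuous_intros)

lemma cos_basis_has_derivative: "(cos_basis n has_real_derivative - (n * sin_basis n x)) (at x within A)"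
  unfolding cos_basis_def[abs_def] sin_basis_def
  by (cases "n = 0") (auto intro!: derivative_eq_intros)

lemma sin_basis_has_derivative: "(sin_basis n has_real_derivative n * cos_basis n x) (at x within A)"
  unfolding sin_basis_def[abs_def] cos_basis_def
  by (cases "n = 0") (auto intro!: derivative_eq_intros)

section \<open>Weak derivatives in terms of Fourier coefficients\<close>

lemma test_function_sqint: "test_function f \<Longrightarrow> sqint f"
  by (intro continuous_sqint smooth_continuous_on test_function_smooth)

lemma integral_vderiv_mult:
  assumes f: "test_function f"
    and h: "\<And>x. (h has_real_derivative h' x) (at x within {0..pi})" "continuous_on {0..pi} h'"
  shows "(\<integral>x. vderiv f x * of_real (h x) \<partial>Mpi) = - (\<integral>x. f x * of_real (h' x) \<partial>Mpi)"
proof -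
  obtain a b where ab: "0 < a" "a < b" "b < pi" "\<And>x. x < a \<or> b < x \<Longrightarrow> f x = 0"
    using f by (rule test_function_support) blast
  have hc: "continuous_on {0..pi} h" using h(1) by (rule DERIV_continuous_on)
  note cont = smooth_continuous_on[OF test_function_smooth[OF f]]
    smooth_continuous_on[OF test_function_smooth[OF test_function_vderiv[OF f]]]
  have "((\<lambda>x. f x * of_real (h' x) + vderiv f x * of_real (h x)) has_integral
      f pi * of_real (h pi) - f 0 * of_real (h 0)) {0..pi}"
  proof (rule fundamental_theorem_of_calculus)
    fix x assume "x \<in> {0..pi}"
    have "((\<lambda>x. complex_of_real (h x)) has_vector_derivative of_real (h' x)) (at x within {0..pi})"
      by (rule has_vector_derivative_of_real) (use h(1) in \<open>simp add: has_real_derivative_iff_has_vector_derivative\<close>)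
    from has_vector_derivative_mult[OF has_vector_derivative_at_within[OF smooth_has_vderiv[OF test_function_smooth[OF f]]] this]
    show "((\<lambda>x. f x * of_real (h x)) has_vector_derivative (f x * of_real (h' x) + vderiv f x * of_real (h x))) (at x within {0..pi})" .
  qed simp
  then have "integral {0..pi} (\<lambda>x. f x * of_real (h' x) + vderiv f x * of_real (h x)) = 0"
    using ab by (simp add: integral_unique)
  then have "integral {0..pi} (\<lambda>x. f x * of_real (h' x)) + integral {0..pi} (\<lambda>x. vderiv f x * of_real (h x)) = 0"
    by (subst integral_add[symmetric]) (auto intro!: integrable_continuous_real continuous_intros cont hc h(2))
  moreover have "(\<integral>x. vderiv f x * of_real (h x) \<partial>Mpi) = integral {0..pi} (\<lambda>x. vderiv f x * of_real (h x))"
    "(\<integral>x. f x * of_real (h' x) \<partial>Mpi) = integral {0..pi} (\<lambda>x. f x * of_real (h' x))"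
    by (intro integral_Mpi_continuous continuous_intros cont hc h(2))+
  ultimately show ?thesis by (simp add: add_eq_0_iff)
qed

lemma integral_vderiv_cos_basis:
  "test_function f \<Longrightarrow> (\<integral>x. vderiv f x * of_real (cos_basis n x) \<partial>Mpi) = of_nat n * (\<integral>x. f x * of_real (sin_basis n x) \<partial>Mpi)"
  by (subst integral_vderiv_mult[OF _ cos_basis_has_derivative])
     (auto intro!: continuous_intros simp: mult.left_commute)

lemma integral_vderiv_sin_basis:
  "test_function f \<Longrightarrow> (\<integral>x. vderiv f x * of_real (sin_basis n x) \<partial>Mpi) = - (of_nat n * (\<integral>x. f x * of_real (cos_basis n x) \<partial>Mpi))"
  by (subst integral_vderiv_mult[OF _ sin_basis_has_derivative])
     (auto intro!: continuous_intros simp: mult.left_commute)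

lemma fourier_coeff_abs: "sqint f \<Longrightarrow> continuous_on {0..pi} e \<Longrightarrow> fourier_coeff e (abs_l2 f) = (\<integral>x. f x * of_real (e x) \<partial>Mpi)"
  by (simp add: fourier_coeff_def pairing_abs sqint_of_real)

lemma ccoeff_vderiv: "test_function f \<Longrightarrow> ccoeff n (abs_l2 (vderiv f)) = of_nat n * scoeff n (abs_l2 f)"
  by (simp add: fourier_coeff_abs test_function_sqint test_function_vderiv integral_vderiv_cos_basis continuous_intros)

lemma pairing_sums_cos: "sqint h \<Longrightarrow> (\<lambda>n. ccoeff n f * (\<integral>x. h x * of_real (cos_basis n x) \<partial>Mpi)) sums pairing f h"
  using bounded_linear.sums[OF bounded_linear_pairing cos_modes.expansion, of h f]
  by (simp add: pairing_fourier_mode continuous_on_cos_basis mult.commute)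

lemma pairing_sums_sin: "sqint h \<Longrightarrow> (\<lambda>n. scoeff n f * (\<integral>x. h x * of_real (sin_basis n x) \<partial>Mpi)) sums pairing f h"
  using bounded_linear.sums[OF bounded_linear_pairing sin_modes.expansion, of h f]
  by (simp add: pairing_fourier_mode continuous_on_sin_basis mult.commute)

lemma has_wderiv_iff: "has_wderiv f g \<longleftrightarrow> (\<forall>\<phi>. test_function \<phi> \<longrightarrow> pairing f (vderiv \<phi>) = - pairing g \<phi>)"
  by (simp add: has_wderiv_def pairing_def)

text \<open>Both pairings are expanded, \<open>u\<close> in sines and \<open>w\<close> in cosines,
  and compared term by term. The hypothesis says more than weak differentiability: it contains the
  Dirichlet condition as well, see \<open>H10_iff\<close>.\<close>

lemma has_wderiv_if_cos_coeffs:
  assumes "\<And>n. ccoeff n w = of_nat n * scoeff n u"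
  shows "has_wderiv u w"
  unfolding has_wderiv_iff
proof (intro allI impI)
  fix \<phi> assume \<phi>: "test_function \<phi>"
  have "(\<lambda>n. - (ccoeff n w * (\<integral>x. \<phi> x * of_real (cos_basis n x) \<partial>Mpi))) sums pairing u (vderiv \<phi>)"
    using pairing_sums_sin[OF test_function_sqint[OF test_function_vderiv[OF \<phi>]], of u]
    by (simp add: integral_vderiv_sin_basis[OF \<phi>] assms mult_ac)
  from sums_unique2[OF this sums_minus[OF pairing_sums_cos[OF test_function_sqint[OF \<phi>]]]]
  show "pairing u (vderiv \<phi>) = - pairing w \<phi>" .
qed

lemma has_wderiv_if_sin_coeffs:
  assumes "\<And>n. scoeff n p = - (of_nat n * ccoeff n q)"
  shows "has_wderiv q p"
  unfolding has_wderiv_iff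
proof (intro allI impI)
  fix \<phi> assume \<phi>: "test_function \<phi>"
  have "(\<lambda>n. - (scoeff n p * (\<integral>x. \<phi> x * of_real (sin_basis n x) \<partial>Mpi))) sums pairing q (vderiv \<phi>)"
    using pairing_sums_cos[OF test_function_sqint[OF test_function_vderiv[OF \<phi>]], of q]
    by (simp add: integral_vderiv_cos_basis[OF \<phi>] assms mult_ac)
  from sums_unique2[OF this sums_minus[OF pairing_sums_sin[OF test_function_sqint[OF \<phi>]]]]
  show "pairing q (vderiv \<phi>) = - pairing p \<phi>" .
qed

text \<open>The fundamental lemma of the calculus of variations. A bump times a cosine is a test
  function, so \<open>f\<close> times a bump is orthogonal to all cosines and vanishes; countably
  many bumps exhaust the interval.\<close>

lemma eq_0_if_pairing_test_functions_0:
  assumes 0: "\<And>\<phi>. test_function \<phi> \<Longrightarrow> pairing f \<phi> = 0"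
  shows "f = 0"
proof -
  let ?f = "rep_l2 f"
  define a where "a k = inverse (real (Suc (Suc k)))" for k
  have a: "0 < a k" "a k \<le> 1 / 2" for k by (auto simp: a_def field_simps)
  have t: "test_function (\<lambda>x. of_real (bump (a k) (pi - a k) x))" for k
    using a[of k] pi_gt3 by (intro test_function_bump) linarith+
  have "AE x in Mpi. ?f x * of_real (bump (a k) (pi - a k) x) = 0" for k
  proof (rule AE_eq_0_if_orthogonal_cos)
    have "continuous_on {0..pi} (\<lambda>x. complex_of_real (bump (a k) (pi - a k) x))"
      by (rule smooth_continuous_on[OF smooth_bump])
    then have "bounded ((\<lambda>x. complex_of_real (bump (a k) (pi - a k) x)) ` {0..pi})"
      by (intro compact_imp_bounded compact_continuous_image) simp_all
    then obtain B where B: "\<And>x. x \<in> {0..pi} \<Longrightarrow> norm (complex_of_real (bump (a k) (pi - a k) x)) \<le> B"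
      unfolding bounded_iff by blast
    show "sqint (\<lambda>x. ?f x * of_real (bump (a k) (pi - a k) x))"
    proof (rule sqint_bound)
      show "(\<lambda>x. ?f x * of_real (bump (a k) (pi - a k) x)) \<in> borel_measurable Mpi"
        by (intro borel_measurable_integrable integrable_mult_l2 sqint_rep_l2 test_function_sqint t)
      show "integrable Mpi (\<lambda>x. B\<^sup>2 * (cmod (?f x))\<^sup>2)"
        by (intro integrable_mult_right sqint_integrable sqint_rep_l2)
      show "AE x in Mpi. (cmod (?f x * of_real (bump (a k) (pi - a k) x)))\<^sup>2 \<le> B\<^sup>2 * (cmod (?f x))\<^sup>2"
      proof (rule AE_I2)
        fix x assume "x \<in> space Mpi"
        then have "(norm (complex_of_real (bump (a k) (pi - a k) x)))\<^sup>2 \<le> B\<^sup>2" by (intro power_mono B) auto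
        from mult_right_mono[OF this, of "(cmod (?f x))\<^sup>2"]
        show "(cmod (?f x * of_real (bump (a k) (pi - a k) x)))\<^sup>2 \<le> B\<^sup>2 * (cmod (?f x))\<^sup>2"
          by (simp add: norm_mult power_mult_distrib mult.commute)
      qed
    qed
    fix n
    have "pairing f (\<lambda>x. of_real (bump (a k) (pi - a k) x) * of_real (cos (real n * x))) = 0"
      by (intro 0 test_function_mult t smooth_cos)
    then show "(\<integral>x. ?f x * of_real (bump (a k) (pi - a k) x) * of_real (cos (real n * x)) \<partial>Mpi) = 0"
      by (simp add: pairing_def mult.assoc)
  qed
  then have "AE x in Mpi. \<forall>k. ?f x * of_real (bump (a k) (pi - a k) x) = 0"
    by (rule AE_all_countable[THEN iffD2, OF allI])
  then have "AE x in Mpi. ?f x = 0"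
  proof (rule AE_mp, intro AE_I2 impI)
    fix x assume x: "x \<in> space Mpi" and z: "\<forall>k. ?f x * of_real (bump (a k) (pi - a k) x) = 0"
    obtain k where k: "inverse (real (Suc k)) < min x (pi - x)"
      using reals_Archimedean[of "min x (pi - x)"] x by auto
    have "a k \<le> inverse (real (Suc k))" unfolding a_def by (rule le_imp_inverse_le) auto
    then have "a k < x" "x < pi - a k" using k by auto
    then have "bump (a k) (pi - a k) x > 0" by (rule bump_pos)
    then show "?f x = 0" using z by (metis mult_eq_0_iff of_real_eq_0_iff less_irrefl)
  qed
  then have "abs_l2 ?f = abs_l2 (\<lambda>x. 0)" by (simp add: abs_l2_eq_iff sqint_rep_l2 sqint_zero)
  then show "f = 0" by (simp add: abs_rep_l2 zero_l2.abs_eq)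
qed

lemma has_wderiv_diff: "has_wderiv f f' \<Longrightarrow> has_wderiv g g' \<Longrightarrow> has_wderiv (f - g) (f' - g')"
  unfolding has_wderiv_iff
  by (simp add: linear_diff[OF bounded_linear.linear[OF bounded_linear_pairing]] test_function_sqint test_function_vderiv)

lemma has_wderiv_unique:
  assumes "has_wderiv f g" "has_wderiv f g'"
  shows "g = g'"
proof -
  have "has_wderiv 0 (g - g')" using has_wderiv_diff[OF assms] by simp
  then have "pairing (g - g') \<phi> = 0" if "test_function \<phi>" for \<phi>
    using that linear_0[OF bounded_linear.linear[OF bounded_linear_pairing]]
    by (simp add: has_wderiv_iff test_function_sqint test_function_vderiv)
  then have "g - g' = 0" by (rule eq_0_if_pairing_test_functions_0)
  then show ?thesis by simp
qed

lemma wderiv_eqI: "has_wderiv f g \<Longrightarrow> wderiv f = g"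
  unfolding wderiv_def using has_wderiv_unique by (intro the_equality)

lemma has_wderiv_wderiv: "f \<in> H1 \<Longrightarrow> has_wderiv f (wderiv f)"
  unfolding H1_def using wderiv_eqI by auto

lemma has_wderiv_test_function: "test_function f \<Longrightarrow> has_wderiv (abs_l2 f) (abs_l2 (vderiv f))"
  by (rule has_wderiv_if_cos_coeffs) (rule ccoeff_vderiv)

text \<open>The orthogonal complement is trivial: real orthogonality to the conjugates of
  \<open>\<phi>\<close> and of \<open>\<i> \<phi>\<close> makes the complex pairing with
  \<open>\<phi>\<close> vanish.\<close>

lemma test_functions_dense: "e > 0 \<Longrightarrow> \<exists>\<phi>. test_function \<phi> \<and> norm (abs_l2 \<phi> - w) < e"
proof -
  let ?T = "abs_l2 ` {\<phi>. test_function \<phi>}"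
  have 0: "0 \<in> ?T"
  proof
    show "0 = abs_l2 (\<lambda>x. 0)" by (simp add: zero_l2.abs_eq)
    have "test_function (\<lambda>x. of_real (bump 1 2 x) * 0)"
      using pi_gt3 by (intro test_function_mult test_function_bump smooth_const) auto
    then show "(\<lambda>x. 0) \<in> {\<phi>. test_function \<phi>}" by simp
  qed
  have add: "x + y \<in> ?T" if "x \<in> ?T" "y \<in> ?T" for x y
    using that by (auto simp: abs_l2_add test_function_sqint intro: test_function_add)
  have scale: "r *\<^sub>R x \<in> ?T" if x: "x \<in> ?T" for r x
  proof -
    obtain \<phi> where \<phi>: "test_function \<phi>" "x = abs_l2 \<phi>" using x by blast
    have "r *\<^sub>R x = abs_l2 (\<lambda>x. \<phi> x * of_real r)"
      using abs_l2_scaleR[OF test_function_sqint[OF \<phi>(1)], of r] by (simp add: \<phi>(2) scaleR_conv_of_real mult.commute)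
    then show ?thesis using test_function_mult[OF \<phi>(1) smooth_const] by blast
  qed
  have "subspace ?T" using 0 add scale by (intro subspaceI)
  then have sub: "subspace (closure ?T)" by (rule subspace_closure)
  obtain p where p: "p \<in> closure ?T" "\<And>v. v \<in> closure ?T \<Longrightarrow> inner (w - p) v = 0"
    using exists_orthogonal_projection[OF sub closed_closure] by blast
  have "w - p = 0"
  proof (rule eq_0_if_pairing_test_functions_0)
    fix \<phi> assume \<phi>: "test_function \<phi>"
    have re: "Re (pairing (w - p) \<psi>) = 0" if \<psi>: "test_function \<psi>" for \<psi>
    proof -
      have t: "test_function (\<lambda>x. cnj (\<psi> x))" by (rule test_function_cnj[OF \<psi>])
      then have "abs_l2 (\<lambda>x. cnj (\<psi> x)) \<in> closure ?T"
        by (intro subsetD[OF closure_subset] imageI) simp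
      from p(2)[OF this] show ?thesis by (simp add: inner_abs_l2[OF test_function_sqint[OF t]])
    qed
    have "test_function (\<lambda>x. \<phi> x * \<i>)" by (intro test_function_mult \<phi> smooth_const)
    then have "Re (\<i> * pairing (w - p) \<phi>) = 0"
      using re[of "\<lambda>x. \<phi> x * \<i>"] pairing_cmult[of "w - p" \<i> \<phi>] by (simp add: mult.commute)
    then show "pairing (w - p) \<phi> = 0" using re[OF \<phi>] by (simp add: complex_eq_iff)
  qed
  then have "w \<in> closure ?T" using p(1) by simp
  moreover assume "e > 0"
  ultimately show ?thesis unfolding closure_approachable by (auto simp: dist_norm)
qed

text \<open>The derivative is approximated rather than the function: a test function near
  \<open>w\<close> is corrected to mean zero by a multiple of a fixed bump and then integrated.
  Closeness of the primitives follows from closeness of the derivatives.\<close>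

lemma test_functions_H1_dense:
  assumes uw: "\<And>n. ccoeff n w = of_nat n * scoeff n u" and e: "e > 0"
  shows "\<exists>\<phi>. test_function \<phi> \<and> norm (u - abs_l2 \<phi>) < e \<and> norm (w - abs_l2 (vderiv \<phi>)) < e"
proof -
  define \<psi> where "\<psi> x = complex_of_real (bump 1 2 x)" for x
  have \<psi>: "test_function \<psi>" unfolding \<psi>_def[abs_def] using pi_gt3 by (intro test_function_bump) auto
  let ?c = "sqrt (1 / pi)"
  have cc0: "ccoeff 0 (abs_l2 f) = of_real ?c * integral {0..pi} f" if "test_function f" for f
    using integral_Mpi_continuous[OF smooth_continuous_on[OF test_function_smooth[OF that]]]
    by (simp add: fourier_coeff_abs test_function_sqint[OF that] continuous_on_cos_basis cos_basis_def del: real_sqrt_divide)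
  have "ccoeff 0 (abs_l2 \<psi>) \<noteq> 0"
  proof -
    have c: "continuous_on {0..pi} (bump 1 2)"
      using continuous_on_Re[OF smooth_continuous_on[OF smooth_bump[of 1 2]], of "{0..pi}"] by simp
    have "integral {0..pi} (bump 1 2) \<noteq> 0"
    proof
      assume "integral {0..pi} (bump 1 2) = 0"
      then have "\<forall>x\<in>{0..pi}. bump 1 2 x = 0"
        using integral_eq_0_iff[of 0 pi "bump 1 2"] c by (simp add: bump_nonneg)
      then have "bump 1 2 (3/2) = 0" using pi_gt3 by auto
      then show False using bump_pos[of 1 "3/2" 2] by simp
    qed
    moreover have "integral {0..pi} \<psi> = of_real (integral {0..pi} (bump 1 2))"
      unfolding \<psi>_def[abs_def]
      by (rule integral_linear[OF integrable_continuous_real[OF c] bounded_linear_of_real, unfolded o_def])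
    ultimately show ?thesis by (simp add: cc0[OF \<psi>])
  qed
  then have \<psi>0: "norm (ccoeff 0 (abs_l2 \<psi>)) > 0" by simp
  \<comment> \<open>The factor by which the correction of the mean may enlarge the error.\<close>
  define L where "L = 1 + norm (abs_l2 \<psi>) / norm (ccoeff 0 (abs_l2 \<psi>))"
  have L: "L > 0" unfolding L_def by (simp add: add_pos_nonneg)
  obtain \<theta> where \<theta>: "test_function \<theta>" "norm (abs_l2 \<theta> - w) < e / L"
    using test_functions_dense[of "e / L" w] e L by auto
  define m where "m = ccoeff 0 (abs_l2 \<theta>) / ccoeff 0 (abs_l2 \<psi>)"
  have "test_function (\<lambda>x. \<theta> x + \<psi> x * (- m))"
    by (intro test_function_add test_function_mult \<theta> \<psi> smooth_const)
  moreover define \<eta> where "\<eta> = (\<lambda>x. \<theta> x + \<psi> x * (- m))"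
  ultimately have \<eta>: "test_function \<eta>" by simp
  have ab\<eta>: "abs_l2 \<eta> = abs_l2 \<theta> + abs_l2 (\<lambda>x. (- m) * \<psi> x)"
    unfolding \<eta>_def by (subst abs_l2_add) (auto simp: test_function_sqint \<theta> \<psi> sqint_cmult sqint_uminus mult.commute)
  have "ccoeff 0 (abs_l2 (\<lambda>x. (- m) * \<psi> x)) = - m * ccoeff 0 (abs_l2 \<psi>)"
    by (simp only: fourier_coeff_abs sqint_cmult test_function_sqint[OF \<psi>] continuous_on_cos_basis mult.assoc integral_mult_right_zero)
  then have "ccoeff 0 (abs_l2 \<eta>) = 0" using \<psi>0 by (simp add: ab\<eta> m_def)
  then have "integral {0..pi} \<eta> = 0" using cc0[OF \<eta>] by simp
  then obtain \<phi> where \<phi>: "test_function \<phi>" "vderiv \<phi> = \<eta>"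
    by (rule test_function_antiderivative[OF \<eta>])
  have nm: "norm (abs_l2 (\<lambda>x. (- m) * \<psi> x)) = norm m * norm (abs_l2 \<psi>)"
    by (rule power2_eq_imp_eq)
       (simp_all add: norm_abs_l2 sqint_cmult sqint_uminus test_function_sqint[OF \<psi>] norm_mult power_mult_distrib)
  \<comment> \<open>For \<open>n = 0\<close> the hypothesis says that \<open>w\<close> has mean
    zero, so the mean to be corrected is as small as the distance from \<open>\<theta>\<close> to
    \<open>w\<close>.\<close>
  have "ccoeff 0 (abs_l2 \<theta>) = ccoeff 0 (abs_l2 \<theta> - w)" using uw[of 0] by simp
  then have "norm (ccoeff 0 (abs_l2 \<theta>)) \<le> norm (abs_l2 \<theta> - w)" by (metis cos_modes.norm_C_le)
  then have "norm m \<le> norm (abs_l2 \<theta> - w) / norm (ccoeff 0 (abs_l2 \<psi>))"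
    unfolding m_def norm_divide by (rule divide_right_mono) simp
  then have "norm m * norm (abs_l2 \<psi>) \<le> norm (abs_l2 \<theta> - w) / norm (ccoeff 0 (abs_l2 \<psi>)) * norm (abs_l2 \<psi>)"
    by (rule mult_right_mono) simp
  moreover have weq: "w - abs_l2 \<eta> = (w - abs_l2 \<theta>) - abs_l2 (\<lambda>x. (- m) * \<psi> x)" by (simp add: ab\<eta>)
  have "norm (w - abs_l2 \<eta>) \<le> norm (abs_l2 \<theta> - w) + norm m * norm (abs_l2 \<psi>)"
    unfolding weq nm[symmetric] norm_minus_commute[of "abs_l2 \<theta>" w] by (rule norm_triangle_ineq4)
  ultimately have "norm (w - abs_l2 \<eta>) \<le> norm (abs_l2 \<theta> - w) * L"
    by (simp add: L_def distrib_left)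
  also have "\<dots> < e" using \<theta>(2) L by (simp add: pos_less_divide_eq)
  finally have w\<eta>: "norm (w - abs_l2 \<eta>) < e" .
  \<comment> \<open>The Poincare inequality, read off from coefficients: those of the derivative are
    larger by the factor \<open>n \<ge> 1\<close>, and the sine of index 0 is void.\<close>
  have "norm (u - abs_l2 \<phi>) \<le> norm (w - abs_l2 \<eta>)"
  proof (rule power2_le_imp_le)
    have "(norm (scoeff n (u - abs_l2 \<phi>)))\<^sup>2 \<le> (norm (ccoeff n (w - abs_l2 \<eta>)))\<^sup>2" for n
    proof (cases "n = 0")
      case True
      have "scoeff 0 z = 0" for z by (simp add: fourier_coeff_def sin_basis_def pairing_def)
      then show ?thesis using True by simp
    next
      case False
      have "ccoeff n (w - abs_l2 \<eta>) = of_nat n * scoeff n (u - abs_l2 \<phi>)"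
        using ccoeff_vderiv[OF \<phi>(1), of n] by (simp add: \<phi>(2) uw right_diff_distrib)
      then have "norm (ccoeff n (w - abs_l2 \<eta>)) = real n * norm (scoeff n (u - abs_l2 \<phi>))" by (simp add: norm_mult)
      then have "norm (scoeff n (u - abs_l2 \<phi>)) \<le> norm (ccoeff n (w - abs_l2 \<eta>))"
        using False mult_right_mono[of 1 "real n" "norm (scoeff n (u - abs_l2 \<phi>))"] by simp
      then show ?thesis by (rule power_mono) simp
    qed
    from suminf_le[OF this sin_modes.bessel cos_modes.bessel]
    show "(norm (u - abs_l2 \<phi>))\<^sup>2 \<le> (norm (w - abs_l2 \<eta>))\<^sup>2"
      using sin_modes.parseval[of "u - abs_l2 \<phi>"] cos_modes.parseval[of "w - abs_l2 \<eta>"] by (simp add: sums_iff)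
  qed simp
  then show ?thesis using \<phi> w\<eta> by auto
qed

lemma H1_norm_ge: "norm f \<le> H1_norm f" "norm (wderiv f) \<le> H1_norm f"
  unfolding H1_norm_def by (auto intro: real_le_rsqrt)

text \<open>For test functions the relation is integration by parts, and it passes to limits in the
  \<open>H1\<close> norm; the converse is \<open>test_functions_H1_dense\<close>. The cosines do not
  vanish at the endpoints, so a boundary value of \<open>u\<close> would show up in the relation:
  this is how it encodes the Dirichlet condition.\<close>

lemma H10_iff: "u \<in> H10 \<and> w = wderiv u \<longleftrightarrow> (\<forall>n. ccoeff n w = of_nat n * scoeff n u)"
proof safe
  fix n assume u: "u \<in> H10"
  then have uH: "u \<in> H1" by (simp add: H10_def)
  have "norm (ccoeff n (wderiv u) - of_nat n * scoeff n u) \<le> 0"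
  proof (rule field_le_epsilon)
    fix e :: real assume e: "e > 0"
    obtain \<phi> where \<phi>: "test_function \<phi>" "H1_norm (u - abs_l2 \<phi>) < e / (1 + real n)"
    proof -
      have "\<forall>d>0. \<exists>\<phi>. test_function \<phi> \<and> H1_norm (u - abs_l2 \<phi>) < d" using u by (simp add: H10_def)
      moreover have "0 < e / (1 + real n)" using e by (simp add: add_pos_nonneg)
      ultimately show thesis using that by blast
    qed
    have wd: "wderiv (u - abs_l2 \<phi>) = wderiv u - abs_l2 (vderiv \<phi>)"
      by (intro wderiv_eqI has_wderiv_diff has_wderiv_wderiv uH has_wderiv_test_function \<phi>)
    have "ccoeff n (wderiv u) - of_nat n * scoeff n u = ccoeff n (wderiv (u - abs_l2 \<phi>)) - of_nat n * scoeff n (u - abs_l2 \<phi>)"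
      by (simp add: wd ccoeff_vderiv \<phi>(1) right_diff_distrib)
    also have "norm \<dots> \<le> norm (ccoeff n (wderiv (u - abs_l2 \<phi>))) + real n * norm (scoeff n (u - abs_l2 \<phi>))"
      using norm_triangle_ineq4[of "ccoeff n (wderiv (u - abs_l2 \<phi>))" "of_nat n * scoeff n (u - abs_l2 \<phi>)"] by (simp add: norm_mult)
    also have "\<dots> \<le> H1_norm (u - abs_l2 \<phi>) + real n * H1_norm (u - abs_l2 \<phi>)"
      by (intro add_mono mult_left_mono order_trans[OF cos_modes.norm_C_le] order_trans[OF sin_modes.norm_C_le] H1_norm_ge) auto
    also have "\<dots> = (1 + real n) * H1_norm (u - abs_l2 \<phi>)" by (simp add: distrib_right)
    also have "\<dots> \<le> (1 + real n) * (e / (1 + real n))" using \<phi>(2) by (intro mult_left_mono) auto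
    finally show "norm (ccoeff n (wderiv u) - of_nat n * scoeff n u) \<le> 0 + e" by simp
  qed
  then show "ccoeff n (wderiv u) = of_nat n * scoeff n u" by simp
next
  assume *: "\<forall>n. ccoeff n w = of_nat n * scoeff n u"
  then have hw: "has_wderiv u w" by (intro has_wderiv_if_cos_coeffs) auto
  then show "w = wderiv u" by (simp add: wderiv_eqI)
  show "u \<in> H10" unfolding H10_def
  proof (intro CollectI conjI allI impI)
    show "u \<in> H1" using hw by (auto simp: H1_def)
    fix e :: real assume e: "e > 0"
    obtain \<phi> where \<phi>: "test_function \<phi>" "norm (u - abs_l2 \<phi>) < e / 2" "norm (w - abs_l2 (vderiv \<phi>)) < e / 2"
      using test_functions_H1_dense[of w u "e / 2"] * e by auto
    have wd: "wderiv (u - abs_l2 \<phi>) = w - abs_l2 (vderiv \<phi>)"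
      by (intro wderiv_eqI has_wderiv_diff hw has_wderiv_test_function \<phi>)
    have "H1_norm (u - abs_l2 \<phi>) \<le> norm (u - abs_l2 \<phi>) + norm (w - abs_l2 (vderiv \<phi>))"
      unfolding H1_norm_def wd by (rule sqrt_sum_squares_le_sum) auto
    then show "\<exists>\<phi>. test_function \<phi> \<and> H1_norm (u - abs_l2 \<phi>) < e" using \<phi> by (intro exI[of _ \<phi>]) auto
  qed
qed

text \<open>A sine is not a test function, but together with its derivative it is a limit of test
  functions, so it may be inserted into the definition of the weak derivative. As it vanishes at the
  endpoints, \<open>q\<close> is subject to no boundary condition.\<close>

lemma has_wderiv_iff_sin_coeffs: "has_wderiv q p \<longleftrightarrow> (\<forall>n. scoeff n p = - (of_nat n * ccoeff n q))"
proof safe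
  fix n assume qp: "has_wderiv q p"
  let ?s = "\<lambda>x. complex_of_real (sin_basis n x)" and ?c = "\<lambda>x. of_nat n * complex_of_real (cos_basis n x)"
  have s: "sqint ?s" "sqint ?c" by (intro sqint_of_real sqint_cmult continuous_intros)+
  have coeffs: "ccoeff k (abs_l2 ?c) = of_nat k * scoeff k (abs_l2 ?s)" for k
  proof -
    have "ccoeff k (abs_l2 ?c) = of_nat n * of_real (\<integral>x. cos_basis n x * cos_basis k x \<partial>Mpi)"
      by (simp add: fourier_coeff_abs s continuous_on_cos_basis mult.assoc flip: of_real_mult)
    moreover have "scoeff k (abs_l2 ?s) = of_real (\<integral>x. sin_basis n x * sin_basis k x \<partial>Mpi)"
      by (simp add: fourier_coeff_abs s continuous_on_sin_basis flip: of_real_mult)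
    ultimately show ?thesis
      by (simp add: integral_Mpi_continuous continuous_intros integral_cos_basis integral_sin_basis)
  qed
  have "norm (of_nat n * ccoeff n q + scoeff n p) \<le> 0"
  proof (rule field_le_epsilon)
    fix e :: real assume e: "e > 0"
    let ?K = "norm q + norm p + 1"
    have K: "?K > 0" by (simp add: add_nonneg_pos)
    obtain \<phi> where \<phi>: "test_function \<phi>" "norm (abs_l2 ?s - abs_l2 \<phi>) < e / ?K" "norm (abs_l2 ?c - abs_l2 (vderiv \<phi>)) < e / ?K"
      using test_functions_H1_dense[OF coeffs divide_pos_pos[OF e K]] by blast
    note sq = test_function_sqint[OF \<phi>(1)] test_function_sqint[OF test_function_vderiv[OF \<phi>(1)]]
    have "of_nat n * ccoeff n q + scoeff n p = pairing q ?c + pairing p ?s"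
      by (simp add: fourier_coeff_def pairing_cmult)
    also have "\<dots> = pairing q (\<lambda>x. ?c x - vderiv \<phi> x) + pairing p (\<lambda>x. ?s x - \<phi> x)"
      using qp \<phi>(1) by (simp add: pairing_diff_right s sq has_wderiv_iff)
    also have "norm \<dots> \<le> norm q * norm (abs_l2 ?c - abs_l2 (vderiv \<phi>)) + norm p * norm (abs_l2 ?s - abs_l2 \<phi>)"
      unfolding abs_l2_diff[OF s(2) sq(2)] abs_l2_diff[OF s(1) sq(1)]
      by (intro norm_triangle_le add_mono norm_pairing_le sqint_diff s sq)
    also have "\<dots> \<le> norm q * (e / ?K) + norm p * (e / ?K)"
      using \<phi> by (intro add_mono mult_left_mono) auto
    also have "\<dots> \<le> ?K * (e / ?K)" using e K by (simp only: distrib_right) (simp add: divide_pos_pos less_imp_le)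
    also have "\<dots> = e" using K by simp
    finally show "norm (of_nat n * ccoeff n q + scoeff n p) \<le> 0 + e" by simp
  qed
  then show "scoeff n p = - (of_nat n * ccoeff n q)" by (simp add: eq_neg_iff_add_eq_0 add.commute)
qed (intro has_wderiv_if_sin_coeffs, blast)

section \<open>The semigroup of the linearized system\<close>

lemma scoeff_0: "scoeff 0 f = 0"
  by (simp add: fourier_coeff_def sin_basis_def pairing_def)

lemma ccoeff_cmode: "ccoeff n (cmode n \<alpha>) = \<alpha>"
  by (simp add: fourier_coeff_mode continuous_on_cos_basis integral_cos_basis)

lemma scoeff_smode: "scoeff n (smode n \<alpha>) = (if n = 0 then 0 else \<alpha>)"
  by (simp add: fourier_coeff_mode continuous_on_sin_basis integral_sin_basis)

lemma ccoeff_0_eq_0_iff: "ccoeff 0 f = 0 \<longleftrightarrow> f \<in> L2m"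
proof -
  have "ccoeff 0 f = of_real (sqrt (1 / pi)) * (\<integral>x. rep_l2 f x \<partial>Mpi)"
    by (simp add: fourier_coeff_def pairing_def cos_basis_def mult.commute del: real_sqrt_divide)
  then show ?thesis by (simp add: L2m_def)
qed

type_synonym mode_vector = "complex \<times> complex \<times> complex"

definition state_coeff :: "nat \<Rightarrow> state \<Rightarrow> mode_vector" where
  "state_coeff n = (\<lambda>(\<rho>, u, s). (ccoeff n \<rho>, scoeff n u, ccoeff n s))"

definition state_mode :: "nat \<Rightarrow> mode_vector \<Rightarrow> state" where
  "state_mode n = (\<lambda>(\<alpha>, \<beta>, \<delta>). (cmode n \<alpha>, smode n \<beta>, cmode n \<delta>))"

interpretation state_modes: mode_decomposition state_coeff state_mode
proof (rule mode_decomposition.intro)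
  show "bounded_linear (state_coeff n)" for n
  proof -
    have "bounded_linear (\<lambda>z. (ccoeff n (fst z), scoeff n (fst (snd z)), ccoeff n (snd (snd z))))"
      by (intro bounded_linear_Pair
          bounded_linear_compose[OF cos_modes.C_bounded_linear] bounded_linear_compose[OF sin_modes.C_bounded_linear]
          bounded_linear_fst bounded_linear_snd bounded_linear_compose[OF bounded_linear_fst] bounded_linear_compose[OF bounded_linear_snd])
    then show ?thesis by (simp add: state_coeff_def case_prod_unfold)
  qed
  show "inner (state_mode n v) z = inner v (state_coeff n z)" for n v z
    by (simp add: state_mode_def state_coeff_def case_prod_beta inner_prod_def cos_modes.J_adjoint sin_modes.J_adjoint)
  show "state_coeff m (state_mode n v) = 0" if "m \<noteq> n" for m n v
    using that by (simp add: state_mode_def state_coeff_def case_prod_beta cos_modes.C_J_neq sin_modes.C_J_neq zero_prod_def)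
  show "state_coeff n (state_mode n (state_coeff n z)) = state_coeff n z" for n z
    by (simp add: state_mode_def state_coeff_def case_prod_beta cos_modes.C_J_C sin_modes.C_J_C)
  show "z = 0" if "\<And>n. state_coeff n z = 0" for z
    using that by (cases z) (auto simp: state_coeff_def zero_prod_def intro: cos_modes.C_complete sin_modes.C_complete)
qed

locale maxwell_system =
  fixes a \<gamma> \<rho>\<^sub>s \<mu> \<kappa> :: real
  assumes pos: "0 < a" "1 \<le> \<gamma>" "0 < \<rho>\<^sub>s" "0 < \<mu>" "0 < \<kappa>"
begin

abbreviation b :: real where "b \<equiv> bcoef a \<gamma> \<rho>\<^sub>s"

lemma b_pos: "0 < b"
  using pos by (simp add: bcoef_def)

text \<open>The operator \<open>A_op\<close> on one mode: differentiation multiplies a sine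
  coefficient by \<open>n\<close> and a cosine coefficient by \<open>- n\<close>.\<close>

definition M :: "nat \<Rightarrow> mode_vector \<Rightarrow> mode_vector" where
  "M n = (\<lambda>(\<alpha>, \<beta>, \<delta>). ((- \<rho>\<^sub>s * n) *\<^sub>R \<beta>, real n *\<^sub>R (b *\<^sub>R \<alpha> - (1 / \<rho>\<^sub>s) *\<^sub>R \<delta>), (\<mu> / \<kappa> * n) *\<^sub>R \<beta> - (1 / \<kappa>) *\<^sub>R \<delta>))"

lemma bounded_linear_M: "bounded_linear (M n)"
  unfolding linear_conv_bounded_linear[symmetric]
  by (rule linearI) (auto simp: M_def scaleR_add_right scaleR_diff_right mult_ac)

lemma M_add: "M n (v + w) = M n v + M n w" and M_diff: "M n (v - w) = M n v - M n w"
  and M_scaleR: "M n (r *\<^sub>R v) = r *\<^sub>R M n v"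
  using bounded_linear.linear[OF bounded_linear_M[of n]] by (simp_all add: linear_add linear_diff linear_scale)

definition solution :: "nat \<Rightarrow> (real \<Rightarrow> mode_vector) \<Rightarrow> bool" where
  "solution n y \<longleftrightarrow> (\<forall>t. (y has_vector_derivative M n (y t)) (at t))"

text \<open>A weighting that makes every mode matrix dissipative, uniformly in \<open>n\<close>.\<close>

definition energy :: "mode_vector \<Rightarrow> real" where
  "energy = (\<lambda>(\<alpha>, \<beta>, \<delta>). b / \<rho>\<^sub>s * inner \<alpha> \<alpha> + inner \<beta> \<beta> + \<kappa> / (\<mu> * \<rho>\<^sub>s) * inner \<delta> \<delta>)"

text \<open>With these weights the coupling terms, which carry the factor \<open>n\<close>, cancel
  in pairs. Only the relaxation of the stress remains, and it has the right sign.\<close>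

lemma energy_decreasing:
  assumes y: "solution n y" and t: "0 \<le> t"
  shows "energy (y t) \<le> energy (y 0)"
proof (rule DERIV_nonpos_imp_nonincreasing[OF t])
  fix s :: real
  let ?M = "M n (y s)"
  have d: "(y has_vector_derivative ?M) (at s)" using y by (simp add: solution_def)
  have d1: "((\<lambda>s. fst (y s)) has_vector_derivative fst ?M) (at s)"
    by (rule bounded_linear.has_vector_derivative[OF bounded_linear_fst d])
  have d': "((\<lambda>s. snd (y s)) has_vector_derivative snd ?M) (at s)"
    by (rule bounded_linear.has_vector_derivative[OF bounded_linear_snd d])
  have d2: "((\<lambda>s. fst (snd (y s))) has_vector_derivative fst (snd ?M)) (at s)"
    by (rule bounded_linear.has_vector_derivative[OF bounded_linear_fst d'])
  have d3: "((\<lambda>s. snd (snd (y s))) has_vector_derivative snd (snd ?M)) (at s)"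
    by (rule bounded_linear.has_vector_derivative[OF bounded_linear_snd d'])
  note di = bounded_bilinear.has_vector_derivative[OF bounded_bilinear_inner]
  have "((\<lambda>s. energy (y s)) has_vector_derivative
     b / \<rho>\<^sub>s * (inner (fst (y s)) (fst ?M) + inner (fst ?M) (fst (y s)))
     + (inner (fst (snd (y s))) (fst (snd ?M)) + inner (fst (snd ?M)) (fst (snd (y s))))
     + \<kappa> / (\<mu> * \<rho>\<^sub>s) * (inner (snd (snd (y s))) (snd (snd ?M)) + inner (snd (snd ?M)) (snd (snd (y s))))) (at s)"
    unfolding energy_def case_prod_unfold
    by (intro has_vector_derivative_add has_vector_derivative_mult_right di[OF d1 d1] di[OF d2 d2] di[OF d3 d3])
  moreover have "b / \<rho>\<^sub>s * (inner (fst (y s)) (fst ?M) + inner (fst ?M) (fst (y s)))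
     + (inner (fst (snd (y s))) (fst (snd ?M)) + inner (fst (snd ?M)) (fst (snd (y s))))
     + \<kappa> / (\<mu> * \<rho>\<^sub>s) * (inner (snd (snd (y s))) (snd (snd ?M)) + inner (snd (snd ?M)) (snd (snd (y s))))
     = - (2 / (\<mu> * \<rho>\<^sub>s)) * inner (snd (snd (y s))) (snd (snd (y s)))"
    using pos by (simp add: M_def case_prod_unfold inner_simps inner_commute) (simp add: field_simps)
  ultimately have "((\<lambda>s. energy (y s)) has_real_derivative - (2 / (\<mu> * \<rho>\<^sub>s)) * inner (snd (snd (y s))) (snd (snd (y s)))) (at s)"
    by (simp only: has_real_derivative_iff_has_vector_derivative)
  moreover have "- (2 / (\<mu> * \<rho>\<^sub>s)) * inner (snd (snd (y s))) (snd (snd (y s))) \<le> 0"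
    using pos by (intro mult_nonpos_nonneg) auto
  ultimately show "\<exists>d. ((\<lambda>s. energy (y s)) has_real_derivative d) (at s) \<and> d \<le> 0" by blast
qed

lemma energy_bounds:
  obtains l u where "0 < l" "0 < u" "\<And>v. l * (norm v)\<^sup>2 \<le> energy v" "\<And>v. energy v \<le> u * (norm v)\<^sup>2"
proof
  let ?c = "b / \<rho>\<^sub>s" and ?d = "\<kappa> / (\<mu> * \<rho>\<^sub>s)"
  let ?l = "min ?c (min 1 ?d)" and ?u = "max ?c (max 1 ?d)"
  have cd: "0 < ?c" "0 < ?d" using b_pos pos by auto
  then show "0 < ?l" "0 < ?u" by auto
  have n: "(norm v)\<^sup>2 = inner (fst v) (fst v) + inner (fst (snd v)) (fst (snd v)) + inner (snd (snd v)) (snd (snd v))"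
    for v :: mode_vector by (simp add: power2_norm_eq_inner inner_prod_def)
  have en: "energy v = ?c * inner (fst v) (fst v) + 1 * inner (fst (snd v)) (fst (snd v)) + ?d * inner (snd (snd v)) (snd (snd v))" for v
    by (simp add: energy_def case_prod_unfold)
  show "?l * (norm v)\<^sup>2 \<le> energy v" for v
    unfolding n en distrib_left by (intro add_mono mult_right_mono) auto
  show "energy v \<le> ?u * (norm v)\<^sup>2" for v
    unfolding n en distrib_left by (intro add_mono mult_right_mono) auto
qed

lemma solution_diff: "solution n y \<Longrightarrow> solution n z \<Longrightarrow> solution n (\<lambda>t. y t - z t)"
  unfolding solution_def M_diff by (intro allI has_vector_derivative_diff) auto

lemma solution_add: "solution n y \<Longrightarrow> solution n z \<Longrightarrow> solution n (\<lambda>t. y t + z t)"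
  unfolding solution_def M_add by (intro allI has_vector_derivative_add) auto

lemma solution_linear_image:
  assumes y: "solution n y" and L: "bounded_linear L" "\<And>v. M n (L v) = L (M n v)"
  shows "solution n (\<lambda>t. L (y t))"
  using y unfolding solution_def L(2) by (intro allI bounded_linear.has_vector_derivative[OF L(1)]) auto

lemma solution_unique:
  assumes "solution n y" "solution n z" "y 0 = z 0" "0 \<le> t"
  shows "y t = z t"
proof -
  obtain l u where lu: "0 < l" "\<And>v. l * (norm v)\<^sup>2 \<le> energy v" "\<And>v. energy v \<le> u * (norm v)\<^sup>2"
    by (rule energy_bounds) blast
  have "l * (norm (y t - z t))\<^sup>2 \<le> energy (y t - z t)" by (rule lu)
  also have "\<dots> \<le> energy (y 0 - z 0)" by (rule energy_decreasing[OF solution_diff[OF assms(1,2)] assms(4)])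
  also have "\<dots> \<le> u * (norm (y 0 - z 0))\<^sup>2" by (rule lu)
  also have "\<dots> = 0" using assms(3) by simp
  finally show ?thesis using lu(1) by (simp add: mult_le_0_iff)
qed

definition E :: "nat \<Rightarrow> real \<Rightarrow> mode_vector \<Rightarrow> mode_vector" where
  "E n t v = (SOME y. y 0 = v \<and> solution n y) t"

lemma E_initial: "E n 0 v = v" and solution_E: "solution n (\<lambda>t. E n t v)"
proof -
  have "\<exists>y. y 0 = v \<and> solution n y"
    unfolding solution_def by (rule linear_ode_solution_ex[OF bounded_linear_M])
  from someI_ex[OF this] show "E n 0 v = v" "solution n (\<lambda>t. E n t v)" by (simp_all add: E_def)
qed

lemma E_eqI: "solution n y \<Longrightarrow> 0 \<le> t \<Longrightarrow> E n t (y 0) = y t"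
  by (rule solution_unique[OF solution_E]) (simp_all add: E_initial)

text \<open>By uniqueness, whatever commutes with \<open>M n\<close> commutes with the flow. This is
  used for \<open>M n\<close> itself, for real scalars and for projections that commute with
  \<open>M 0\<close>.\<close>

lemma E_linear_image:
  "bounded_linear L \<Longrightarrow> (\<And>v. M n (L v) = L (M n v)) \<Longrightarrow> 0 \<le> t \<Longrightarrow> E n t (L v) = L (E n t v)"
  using E_eqI[OF solution_linear_image[OF solution_E]] by (simp add: E_initial)

lemma norm_E_le: obtains K where "0 < K" "\<And>n t v. 0 \<le> t \<Longrightarrow> norm (E n t v) \<le> K * norm v"
proof -
  obtain l u where lu: "0 < l" "0 < u" "\<And>v. l * (norm v)\<^sup>2 \<le> energy v" "\<And>v. energy v \<le> u * (norm v)\<^sup>2"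
    by (rule energy_bounds) blast
  show thesis
  proof
    show "0 < sqrt (u / l)" using lu by simp
    fix n t v assume t: "0 \<le> (t::real)"
    have "l * (norm (E n t v))\<^sup>2 \<le> energy (E n t v)" by (rule lu)
    also have "\<dots> \<le> energy v" using energy_decreasing[OF solution_E t] by (simp add: E_initial)
    also have "\<dots> \<le> u * (norm v)\<^sup>2" by (rule lu)
    finally have "(norm (E n t v))\<^sup>2 \<le> (sqrt (u / l) * norm v)\<^sup>2"
      using lu(1,2) by (simp add: power_mult_distrib field_simps)
    then show "norm (E n t v) \<le> sqrt (u / l) * norm v"
      by (rule power2_le_imp_le) (use lu in simp)
  qed
qed

definition K :: real where
  "K = (SOME K. 0 < K \<and> (\<forall>n t v. 0 \<le> t \<longrightarrow> norm (E n t v) \<le> K * norm v))"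

lemma K: "0 < K" "0 \<le> t \<Longrightarrow> norm (E n t v) \<le> K * norm v"
proof -
  have "\<exists>K>0. \<forall>n t v. 0 \<le> t \<longrightarrow> norm (E n t v) \<le> K * norm v" using norm_E_le by metis
  from someI_ex[OF this] show "0 < K" "0 \<le> t \<Longrightarrow> norm (E n t v) \<le> K * norm v"
    unfolding K_def by blast+
qed

lemma state_coeff_mode: "state_coeff n (state_mode n v) = (fst v, if n = 0 then 0 else fst (snd v), snd (snd v))"
  by (simp add: state_coeff_def state_mode_def case_prod_unfold ccoeff_cmode scoeff_smode)

sublocale semigroup: mode_semigroup state_coeff state_mode M E K
proof unfold_locales
  fix n and s t :: real and v w :: mode_vector and r
  show "0 \<le> t \<Longrightarrow> E n t (v + w) = E n t v + E n t w"
    using E_eqI[OF solution_add[OF solution_E solution_E]] by (simp add: E_initial)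
  show "0 \<le> t \<Longrightarrow> E n t (r *\<^sub>R v) = r *\<^sub>R E n t v"
    by (rule E_linear_image) (auto simp: M_scaleR bounded_linear_scaleR_right)
  show "0 \<le> t \<Longrightarrow> norm (E n t v) \<le> K * norm v" by (rule K)
  show "E n 0 v = v" by (rule E_initial)
  show "E n (s + t) v = E n s (E n t v)" if "0 \<le> s" "0 \<le> t"
  proof -
    have "solution n (\<lambda>s. E n (s + t) v)"
      unfolding solution_def
    proof
      fix s
      have "((\<lambda>s. s + t) has_vector_derivative 1) (at s)"
        by (auto intro!: derivative_eq_intros simp: has_real_derivative_iff_has_vector_derivative[symmetric])
      from vector_diff_chain_at[OF this, of "\<lambda>t. E n t v" "M n (E n (s + t) v)"]
      show "((\<lambda>s. E n (s + t) v) has_vector_derivative M n (E n (s + t) v)) (at s)"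
        using solution_E[of n v] by (simp add: solution_def o_def)
    qed
    from E_eqI[OF this that(1)] show ?thesis by simp
  qed
  show "((\<lambda>t. E n t v) has_vector_derivative M n (E n t v)) (at t within {0..})" if "0 \<le> t"
    using solution_E[of n v] by (simp add: solution_def has_vector_derivative_at_within)
  show "M n (E n t v) = E n t (M n v)" if "0 \<le> t"
    by (rule E_linear_image[OF bounded_linear_M _ that, symmetric]) simp
  show "state_coeff n (state_mode n (E n t v)) = E n t v" if t: "0 \<le> t" and v: "state_coeff n (state_mode n v) = v"
  proof (cases "n = 0")
    case True
    \<comment> \<open>In mode 0 the velocity coefficient is always 0. The projection that removes it
      commutes with \<open>M 0\<close>, which does not couple the components.\<close>
    let ?P = "\<lambda>v :: mode_vector. (fst v, 0 :: complex, snd (snd v))"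
    have P: "bounded_linear ?P"
      by (intro bounded_linear_Pair bounded_linear_fst bounded_linear_zero bounded_linear_compose[OF bounded_linear_snd] bounded_linear_snd)
    have "E n t (?P v) = ?P (E n t v)"
      by (rule E_linear_image[OF P _ t]) (simp add: M_def True case_prod_unfold)
    moreover have "?P v = v" using v by (simp add: state_coeff_mode True)
    ultimately show ?thesis by (simp add: state_coeff_mode True)
  qed (simp add: state_coeff_mode)
qed

abbreviation S :: "real \<Rightarrow> state \<Rightarrow> state" where "S \<equiv> semigroup.S"

text \<open>The mode equations fall into three families. The density equation is
  \<open>H10_iff\<close> for the velocity, the velocity equation is
  \<open>has_wderiv_iff_sin_coeffs\<close> for the combination of density and stress, and the stress
  equation only prescribes a value. This reproduces the domain, in which neither density nor stress
  needs to be differentiable by itself.\<close>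

lemma is_generator_S: "is_generator S (A_dom a \<gamma> \<rho>\<^sub>s) (A_op a \<gamma> \<rho>\<^sub>s \<mu> \<kappa>)"
  unfolding is_generator_def semigroup.diff_quot_S_tendsto_iff
proof (intro allI)
  fix z w :: state
  obtain \<rho> u s where z: "z = (\<rho>, u, s)" by (cases z)
  obtain w1 w2 w3 where w: "w = (w1, w2, w3)" by (cases w)
  let ?q = "- b *\<^sub>R \<rho> + (1 / \<rho>\<^sub>s) *\<^sub>R s"
  have "(\<forall>n. M n (state_coeff n z) = state_coeff n w) \<longleftrightarrow>
      (\<forall>n. (- \<rho>\<^sub>s * n) *\<^sub>R scoeff n u = ccoeff n w1) \<and>
      (\<forall>n. real n *\<^sub>R (b *\<^sub>R ccoeff n \<rho> - (1 / \<rho>\<^sub>s) *\<^sub>R ccoeff n s) = scoeff n w2) \<and>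
      (\<forall>n. (\<mu> / \<kappa> * n) *\<^sub>R scoeff n u - (1 / \<kappa>) *\<^sub>R ccoeff n s = ccoeff n w3)"
    unfolding z w state_coeff_def M_def by auto
  also have "(\<forall>n. (- \<rho>\<^sub>s * n) *\<^sub>R scoeff n u = ccoeff n w1) \<longleftrightarrow> u \<in> H10 \<and> w1 = - \<rho>\<^sub>s *\<^sub>R wderiv u"
  proof -
    have "(\<forall>n. (- \<rho>\<^sub>s * n) *\<^sub>R scoeff n u = ccoeff n w1) \<longleftrightarrow> (\<forall>n. ccoeff n ((- 1 / \<rho>\<^sub>s) *\<^sub>R w1) = of_nat n * scoeff n u)"
    proof (intro all_cong1)
      fix n
      have "(- \<rho>\<^sub>s * n) *\<^sub>R scoeff n u = ccoeff n w1 \<longleftrightarrow> (- 1 / \<rho>\<^sub>s) *\<^sub>R ccoeff n w1 = (- 1 / \<rho>\<^sub>s) *\<^sub>R (- \<rho>\<^sub>s * n) *\<^sub>R scoeff n u"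
        using pos(3) by (subst scaleR_cancel_left) auto
      also have "(- 1 / \<rho>\<^sub>s) *\<^sub>R (- \<rho>\<^sub>s * n) *\<^sub>R scoeff n u = of_nat n * scoeff n u"
        using pos(3) by (simp add: scaleR_conv_of_real)
      finally show "(- \<rho>\<^sub>s * n) *\<^sub>R scoeff n u = ccoeff n w1 \<longleftrightarrow> ccoeff n ((- 1 / \<rho>\<^sub>s) *\<^sub>R w1) = of_nat n * scoeff n u"
        by (simp only: cos_modes.C_simps)
    qed
    also have "\<dots> \<longleftrightarrow> u \<in> H10 \<and> (- 1 / \<rho>\<^sub>s) *\<^sub>R w1 = wderiv u" by (rule H10_iff[symmetric])
    also have "(- 1 / \<rho>\<^sub>s) *\<^sub>R w1 = wderiv u \<longleftrightarrow> w1 = - \<rho>\<^sub>s *\<^sub>R wderiv u"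
    proof
      assume eq: "(- 1 / \<rho>\<^sub>s) *\<^sub>R w1 = wderiv u"
      show "w1 = - \<rho>\<^sub>s *\<^sub>R wderiv u" unfolding eq[symmetric] using pos(3) by simp
    next
      assume eq: "w1 = - \<rho>\<^sub>s *\<^sub>R wderiv u"
      show "(- 1 / \<rho>\<^sub>s) *\<^sub>R w1 = wderiv u" unfolding eq using pos(3) by simp
    qed
    finally show ?thesis .
  qed
  also have "(\<forall>n. real n *\<^sub>R (b *\<^sub>R ccoeff n \<rho> - (1 / \<rho>\<^sub>s) *\<^sub>R ccoeff n s) = scoeff n w2) \<longleftrightarrow> ?q \<in> H1 \<and> w2 = wderiv ?q"
  proof -
    have "(\<forall>n. real n *\<^sub>R (b *\<^sub>R ccoeff n \<rho> - (1 / \<rho>\<^sub>s) *\<^sub>R ccoeff n s) = scoeff n w2) \<longleftrightarrow> has_wderiv ?q w2"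
      unfolding has_wderiv_iff_sin_coeffs cos_modes.C_simps by (intro all_cong1) (auto simp: scaleR_conv_of_real algebra_simps)
    also have "\<dots> \<longleftrightarrow> ?q \<in> H1 \<and> w2 = wderiv ?q"
      using has_wderiv_wderiv wderiv_eqI by (auto simp: H1_def)
    finally show ?thesis .
  qed
  also have "(u \<in> H10 \<and> w1 = - \<rho>\<^sub>s *\<^sub>R wderiv u) \<and> (?q \<in> H1 \<and> w2 = wderiv ?q) \<and>
      (\<forall>n. (\<mu> / \<kappa> * n) *\<^sub>R scoeff n u - (1 / \<kappa>) *\<^sub>R ccoeff n s = ccoeff n w3)
    \<longleftrightarrow> (u \<in> H10 \<and> w1 = - \<rho>\<^sub>s *\<^sub>R wderiv u) \<and> (?q \<in> H1 \<and> w2 = wderiv ?q) \<and>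
      w3 = (\<mu> / \<kappa>) *\<^sub>R wderiv u - (1 / \<kappa>) *\<^sub>R s"
  proof (intro conj_cong refl)
    \<comment> \<open>The first condition is what turns \<open>n\<close> times a sine coefficient of
      \<open>u\<close> into a cosine coefficient of its derivative.\<close>
    assume "u \<in> H10 \<and> w1 = - \<rho>\<^sub>s *\<^sub>R wderiv u"
    then have wd: "ccoeff n (wderiv u) = of_nat n * scoeff n u" for n using H10_iff by blast
    have "(\<mu> / \<kappa> * n) *\<^sub>R scoeff n u - (1 / \<kappa>) *\<^sub>R ccoeff n s = ccoeff n ((\<mu> / \<kappa>) *\<^sub>R wderiv u - (1 / \<kappa>) *\<^sub>R s)" for n
      by (simp add: wd scaleR_conv_of_real)
    then show "(\<forall>n. (\<mu> / \<kappa> * n) *\<^sub>R scoeff n u - (1 / \<kappa>) *\<^sub>R ccoeff n s = ccoeff n w3) \<longleftrightarrow> w3 = (\<mu> / \<kappa>) *\<^sub>R wderiv u - (1 / \<kappa>) *\<^sub>R s"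
      using cos_modes.eq_if_C_eq by metis
  qed
  also have "\<dots> \<longleftrightarrow> z \<in> A_dom a \<gamma> \<rho>\<^sub>s \<and> w = A_op a \<gamma> \<rho>\<^sub>s \<mu> \<kappa> z"
    unfolding z w A_dom_def A_op_def by auto
  finally show "(\<forall>n. M n (state_coeff n z) = state_coeff n w) \<longleftrightarrow> z \<in> A_dom a \<gamma> \<rho>\<^sub>s \<and> w = A_op a \<gamma> \<rho>\<^sub>s \<mu> \<kappa> z" .
qed

end

section \<open>Approximate controllability\<close>

lemma scoeff_vderiv: "test_function f \<Longrightarrow> scoeff n (abs_l2 (vderiv f)) = - (of_nat n * ccoeff n (abs_l2 f))"
  by (simp add: fourier_coeff_abs test_function_sqint test_function_vderiv integral_vderiv_sin_basis continuous_intros)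

text \<open>Four derivatives yield the factor \<open>n ^ 4\<close>, with cosine and sine
  coefficients alternating. The undifferentiated coefficient supplies the bound for small
  \<open>n\<close>.\<close>

lemma ccoeff_test_function_decay:
  assumes f: "test_function f"
  obtains C where "\<And>n. norm (ccoeff n (abs_l2 f)) \<le> C / (1 + real n) ^ 4"
proof
  fix n
  let ?f4 = "vderiv (vderiv (vderiv (vderiv f)))"
  let ?c = "norm (ccoeff n (abs_l2 f))"
  have "ccoeff n (abs_l2 ?f4) = of_nat n ^ 4 * ccoeff n (abs_l2 f)"
    by (simp add: ccoeff_vderiv scoeff_vderiv test_function_vderiv f power4_eq_xxxx)
  then have "real n ^ 4 * ?c = norm (ccoeff n (abs_l2 ?f4))" by (simp add: norm_mult norm_power)
  also have "\<dots> \<le> norm (abs_l2 ?f4)" by (rule cos_modes.norm_C_le)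
  finally have 4: "real n ^ 4 * ?c \<le> norm (abs_l2 ?f4)" .
  \<comment> \<open>The inequality \<open>(x + y)\<^sup>2 \<le> 2 (x\<^sup>2 + y\<^sup>2)\<close>
    used twice; the first constant 2 gets squared.\<close>
  have "(1 + real n) ^ 4 \<le> 8 * (1 + real n ^ 4)"
  proof -
    have "(1 + real n)\<^sup>2 \<le> 2 * (1 + (real n)\<^sup>2)"
      using zero_le_power2[of "1 - real n"] by (simp add: power2_eq_square algebra_simps)
    then have "((1 + real n)\<^sup>2)\<^sup>2 \<le> (2 * (1 + (real n)\<^sup>2))\<^sup>2" by (rule power_mono) simp
    also have "\<dots> \<le> 8 * (1 + real n ^ 4)"
      using zero_le_power2[of "1 - (real n)\<^sup>2"] by (simp add: power2_eq_square power4_eq_xxxx algebra_simps)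
    finally show ?thesis by simp
  qed
  then have "(1 + real n) ^ 4 * ?c \<le> 8 * (1 + real n ^ 4) * ?c" by (rule mult_right_mono) simp
  also have "\<dots> = 8 * (?c + real n ^ 4 * ?c)" by (simp add: algebra_simps)
  also have "\<dots> \<le> 8 * (norm (abs_l2 f) + norm (abs_l2 ?f4))"
    using 4 cos_modes.norm_C_le[of n "abs_l2 f"] by simp
  finally show "?c \<le> 8 * (norm (abs_l2 f) + norm (abs_l2 ?f4)) / (1 + real n) ^ 4"
    by (simp add: pos_le_divide_eq mult.commute)
qed

text \<open>On an interval of zeros the derivative vanishes too, while sine and cosine have no
  common zero.\<close>

lemma cos_zero_free: "p < q \<Longrightarrow> \<exists>x\<in>{p<..<q}. cos (real m * x) \<noteq> 0"
proof (rule ccontr)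
  assume pq: "p < q" and "\<not> (\<exists>x\<in>{p<..<q}. cos (real m * x) \<noteq> 0)"
  then have 0: "cos (real m * x) = 0" if "x \<in> {p<..<q}" for x using that by blast
  let ?x = "(p + q) / 2"
  have x: "?x \<in> {p<..<q}" using pq by auto
  have "((\<lambda>x. cos (real m * x)) has_real_derivative - sin (real m * ?x) * real m) (at ?x)"
    by (auto intro!: derivative_eq_intros)
  moreover have "((\<lambda>x. cos (real m * x)) has_real_derivative 0) (at ?x)"
    by (rule has_field_derivative_transform_within_open[of "\<lambda>_. 0" _ _ "{p<..<q}"])
       (use x 0 in auto)
  ultimately have "- sin (real m * ?x) * real m = 0" by (rule DERIV_unique)
  moreover have "m \<noteq> 0"
  proof
    assume "m = 0"
    then show False using 0[OF x] by simp
  qed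
  ultimately have "sin (real m * ?x) = 0" by simp
  then show False using 0[OF x] sin_cos_squared_add[of "real m * ?x"] by simp
qed

text \<open>A plain bump may well have a vanishing coefficient of order \<open>m\<close>. Modulated
  by \<open>cos (m x)\<close>, it leads to a nonnegative integrand containing
  \<open>cos\<^sup>2\<close>.\<close>

lemma ccoeff_bump_cos_nz:
  assumes pq: "0 < p" "p < q" "q < pi"
  shows "ccoeff m (abs_l2 (\<lambda>x. of_real (bump p q x) * of_real (cos (real m * x)))) \<noteq> 0"
proof -
  let ?h = "\<lambda>x. bump p q x * cos (real m * x) * cos_basis m x"
  define k where "k = (if m = 0 then sqrt (1 / pi) else sqrt (2 / pi))"
  have k: "k > 0" by (simp add: k_def)
  have cb: "cos_basis m x = k * cos (real m * x)" for x by (simp add: cos_basis_def k_def)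
  have bc: "continuous_on {0..pi} (bump p q)"
    using continuous_on_Re[OF smooth_continuous_on[OF smooth_bump[of p q]], of "{0..pi}"] by simp
  have hc: "continuous_on {0..pi} ?h" by (intro continuous_intros bc)
  have t: "test_function (\<lambda>x. of_real (bump p q x) * of_real (cos (real m * x)))"
    by (intro test_function_mult test_function_bump smooth_cos pq)
  have "ccoeff m (abs_l2 (\<lambda>x. of_real (bump p q x) * of_real (cos (real m * x)))) = of_real (\<integral>x. ?h x \<partial>Mpi)"
    unfolding fourier_coeff_abs[OF test_function_sqint[OF t] continuous_on_cos_basis]
    by (simp flip: of_real_mult)
  also have "(\<integral>x. ?h x \<partial>Mpi) = integral {0..pi} ?h" by (rule integral_Mpi_continuous[OF hc])
  finally have eq: "ccoeff m (abs_l2 (\<lambda>x. of_real (bump p q x) * of_real (cos (real m * x)))) = of_real (integral {0..pi} ?h)" .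
  have nonneg: "0 \<le> ?h x" for x
  proof -
    have heq: "?h x = bump p q x * k * (cos (real m * x))\<^sup>2" by (simp add: cb power2_eq_square)
    show ?thesis unfolding heq using bump_nonneg k by simp
  qed
  have "integral {0..pi} ?h \<noteq> 0"
  proof
    assume "integral {0..pi} ?h = 0"
    then have "\<forall>x\<in>{0..pi}. ?h x = 0" using integral_eq_0_iff[OF hc] nonneg by simp
    moreover obtain x where x: "x \<in> {p<..<q}" "cos (real m * x) \<noteq> 0" using cos_zero_free[OF pq(2)] by blast
    ultimately have "?h x = 0" using pq by auto
    then show False using bump_pos[of p x q] k x by (simp add: cb)
  qed
  with eq show ?thesis by simp
qed

section \<open>Continuous controls and the reachable space\<close>

lemma L2_on_add: "f \<in> L2_on U \<Longrightarrow> g \<in> L2_on U \<Longrightarrow> f + g \<in> L2_on U"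
proof -
  assume f: "f \<in> L2_on U" and g: "g \<in> L2_on U"
  have "f + g = abs_l2 (\<lambda>x. rep_l2 f x + rep_l2 g x)"
    using abs_l2_add[OF sqint_rep_l2 sqint_rep_l2, of f g] by (simp add: abs_rep_l2)
  then have "AE x in Mpi. rep_l2 (f + g) x = rep_l2 f x + rep_l2 g x"
    using rep_abs_l2[OF sqint_add[OF sqint_rep_l2 sqint_rep_l2]] by simp
  with f g show ?thesis unfolding L2_on_def mem_Collect_eq by eventually_elim auto
qed

lemma L2_on_scaleR: "f \<in> L2_on U \<Longrightarrow> r *\<^sub>R f \<in> L2_on U"
proof -
  assume f: "f \<in> L2_on U"
  have "r *\<^sub>R f = abs_l2 (\<lambda>x. r *\<^sub>R rep_l2 f x)"
    using abs_l2_scaleR[OF sqint_rep_l2, of r f] by (simp add: abs_rep_l2)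
  then have "AE x in Mpi. rep_l2 (r *\<^sub>R f) x = r *\<^sub>R rep_l2 f x"
    using rep_abs_l2[OF sqint_scaleR[OF sqint_rep_l2]] by simp
  with f show ?thesis unfolding L2_on_def mem_Collect_eq by eventually_elim auto
qed

lemma abs_l2_in_L2_on: "sqint f \<Longrightarrow> (\<And>x. x \<notin> U \<Longrightarrow> f x = 0) \<Longrightarrow> abs_l2 f \<in> L2_on U"
  using rep_abs_l2[of f] unfolding L2_on_def mem_Collect_eq by (auto elim: eventually_mono)

text \<open>Enough controls for approximation, and such that the Duhamel integrand is continuous in
  time and hence integrable.\<close>

definition continuous_controls :: "real \<Rightarrow> real set \<Rightarrow> (real \<Rightarrow> l2) set" where
  "continuous_controls T U = {f. continuous_on {0..T} f \<and> (\<forall>t. f t \<in> L2_on U)}"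

lemma continuous_controls_subset: "continuous_controls T U \<subseteq> controls T U"
proof
  fix f assume "f \<in> continuous_controls T U"
  then have f: "continuous_on {0..T} f" "\<forall>t. f t \<in> L2_on U" by (auto simp: continuous_controls_def)
  have "integrable (lebesgue_on {0<..<T}) (\<lambda>t. (norm (f t))\<^sup>2)"
    by (intro integrable_Ioo_continuous continuous_intros f)
  moreover have "f \<in> borel_measurable (lebesgue_on {0<..<T})"
    using borel_measurable_integrable[OF integrable_Ioo_continuous[OF f(1)]] .
  ultimately show "f \<in> controls T U" using f(2) by (simp add: controls_def)
qed

context maxwell_system begin

definition reached :: "real \<Rightarrow> (real \<Rightarrow> l2) \<Rightarrow> state" where
  "reached T f = (\<integral>s. S (T - s) (f s, 0, 0) \<partial>lebesgue_on {0<..<T})"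

lemma continuous_on_control_integrand:
  "continuous_on {0..T} f \<Longrightarrow> continuous_on {0..T} (\<lambda>s. S (T - s) (f s, 0, 0))"
  by (intro semigroup.continuous_on_duhamel_integrand continuous_intros)

lemma integrable_control_integrand:
  "continuous_on {0..T} f \<Longrightarrow> integrable (lebesgue_on {0<..<T}) (\<lambda>s. S (T - s) (f s, 0, 0))"
  by (intro integrable_Ioo_continuous continuous_on_control_integrand)

lemma subspace_reached: "subspace (reached T ` continuous_controls T U)"
proof (rule subspaceI)
  have L: "bounded_linear (S (T - s))" if "s \<in> space (lebesgue_on {0<..<T})" for s
    using that by (intro semigroup.bounded_linear_S) simp
  have "(\<lambda>_. 0) \<in> continuous_controls T U"
    using abs_l2_in_L2_on[OF sqint_zero, of U] by (simp add: continuous_controls_def zero_l2.abs_eq)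
  moreover have "reached T (\<lambda>_. 0) = 0"
  proof -
    have "reached T (\<lambda>_. 0) = (\<integral>s. 0 \<partial>lebesgue_on {0<..<T})"
      unfolding reached_def
      by (rule Bochner_Integration.integral_cong[OF refl])
         (use linear_0[OF bounded_linear.linear[OF L]] in \<open>simp add: zero_prod_def\<close>)
    then show ?thesis by simp
  qed
  ultimately show "0 \<in> reached T ` continuous_controls T U" by (metis image_eqI)
next
  have L: "linear (S (T - s))" if "s \<in> space (lebesgue_on {0<..<T})" for s
    using that by (intro bounded_linear.linear semigroup.bounded_linear_S) simp
  {
    fix x y assume "x \<in> reached T ` continuous_controls T U" "y \<in> reached T ` continuous_controls T U"
    then obtain f g where fg: "f \<in> continuous_controls T U" "x = reached T f" "g \<in> continuous_controls T U" "y = reached T g"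
      by blast
    then have c: "continuous_on {0..T} f" "continuous_on {0..T} g" by (auto simp: continuous_controls_def)
    have "x + y = (\<integral>s. S (T - s) (f s, 0, 0) + S (T - s) (g s, 0, 0) \<partial>lebesgue_on {0<..<T})"
      unfolding fg reached_def
      by (rule Bochner_Integration.integral_add[symmetric]; rule integrable_control_integrand; rule c)
    also have "\<dots> = reached T (\<lambda>s. f s + g s)"
      unfolding reached_def
      by (rule Bochner_Integration.integral_cong[OF refl]) (simp add: linear_add[OF L, symmetric])
    finally have "x + y = reached T (\<lambda>s. f s + g s)" .
    moreover have "(\<lambda>s. f s + g s) \<in> continuous_controls T U"
      using fg by (auto simp: continuous_controls_def intro!: continuous_intros L2_on_add)
    ultimately show "x + y \<in> reached T ` continuous_controls T U" by blast
  next
    fix r and x assume "x \<in> reached T ` continuous_controls T U"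
    then obtain f where f: "f \<in> continuous_controls T U" "x = reached T f" by blast
    have "r *\<^sub>R x = (\<integral>s. r *\<^sub>R S (T - s) (f s, 0, 0) \<partial>lebesgue_on {0<..<T})"
      unfolding f reached_def by simp
    also have "\<dots> = reached T (\<lambda>s. r *\<^sub>R f s)"
      unfolding reached_def
      by (rule Bochner_Integration.integral_cong[OF refl]) (simp add: linear_scale[OF L, symmetric])
    finally have "r *\<^sub>R x = reached T (\<lambda>s. r *\<^sub>R f s)" .
    moreover have "(\<lambda>s. r *\<^sub>R f s) \<in> continuous_controls T U"
      using f by (auto simp: continuous_controls_def intro!: continuous_intros L2_on_scaleR)
    ultimately show "r *\<^sub>R x \<in> reached T ` continuous_controls T U" by blast
  }
qed

text \<open>For \<open>n = 0\<close> the matrix merely damps the stress, without any coupling. A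
  control of the density therefore cannot influence the mean of the stress, which accounts for the
  space \<open>L2m\<close>.\<close>

lemma stress_mean_S:
  assumes z: "snd (snd (state_coeff 0 z)) = 0" and t: "0 \<le> t"
  shows "snd (snd (state_coeff 0 (S t z))) = 0"
proof -
  let ?P = "\<lambda>v :: mode_vector. (fst v, fst (snd v), 0 :: complex)"
  have P: "bounded_linear ?P"
    by (intro bounded_linear_Pair bounded_linear_fst bounded_linear_zero bounded_linear_compose[OF bounded_linear_fst] bounded_linear_snd)
  have "E 0 t (?P (state_coeff 0 z)) = ?P (E 0 t (state_coeff 0 z))"
    by (rule E_linear_image[OF P _ t]) (simp add: M_def case_prod_unfold)
  moreover have "?P (state_coeff 0 z) = state_coeff 0 z" using z by (simp add: prod_eq_iff)
  ultimately have "E 0 t (state_coeff 0 z) = ?P (E 0 t (state_coeff 0 z))" by simp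
  then have "snd (snd (E 0 t (state_coeff 0 z))) = snd (snd (?P (E 0 t (state_coeff 0 z))))"
    by (rule arg_cong[where f = "\<lambda>v. snd (snd v)"])
  then show ?thesis by (simp add: semigroup.C_S[OF t])
qed

text \<open>The control is \<open>f\<close> with an amplitude equal to the very function that has to
  vanish. Orthogonality to the state it reaches then says that the integral of the square of this
  function is 0.\<close>

lemma orthogonal_reached_imp:
  assumes T: "0 < T" and orth: "\<And>f. f \<in> continuous_controls T U \<Longrightarrow> inner \<zeta> (reached T f) = 0"
    and f: "f \<in> L2_on U" and t: "t \<in> {0..T}"
  shows "inner \<zeta> (S t (f, 0, 0)) = 0"
proof -
  define h where "h s = inner \<zeta> (S \<bar>T - s\<bar> (f, 0, 0))" for s
  have h: "continuous_on {0..T} h"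
    unfolding h_def[abs_def] by (intro continuous_intros semigroup.continuous_on_S) auto
  have c: "(\<lambda>s. h s *\<^sub>R f) \<in> continuous_controls T U"
    using f h by (auto simp: continuous_controls_def intro!: continuous_intros L2_on_scaleR)
  then have cc: "continuous_on {0..T} (\<lambda>s. h s *\<^sub>R f)" by (simp add: continuous_controls_def)
  have "(\<integral>s. (h s)\<^sup>2 \<partial>lebesgue_on {0<..<T}) = (\<integral>s. inner \<zeta> (S (T - s) (h s *\<^sub>R f, 0, 0)) \<partial>lebesgue_on {0<..<T})"
  proof (rule Bochner_Integration.integral_cong[OF refl])
    fix s assume "s \<in> space (lebesgue_on {0<..<T})"
    then have s: "0 \<le> T - s" by simp
    have "S (T - s) (h s *\<^sub>R f, 0, 0) = h s *\<^sub>R S (T - s) (f, 0, 0)"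
      using linear_scale[OF bounded_linear.linear[OF semigroup.bounded_linear_S[OF s]], of "h s" "(f, 0, 0)"] by simp
    then show "(h s)\<^sup>2 = inner \<zeta> (S (T - s) (h s *\<^sub>R f, 0, 0))"
      using s by (simp add: h_def power2_eq_square)
  qed
  also have "\<dots> = inner \<zeta> (reached T (\<lambda>s. h s *\<^sub>R f))"
    unfolding reached_def by (rule integral_inner_right) (rule integrable_control_integrand[OF cc])
  also have "\<dots> = 0" by (rule orth[OF c])
  finally have "h (T - t) = 0"
    by (rule integral_Ioo_square_eq_0[OF h T]) (use t in simp)
  then show ?thesis using t by (simp add: h_def)
qed

end

context maxwell_system begin

section \<open>From observed modes to unique continuation\<close>

definition c :: real where "c = sqrt (b * \<rho>\<^sub>s + \<mu> / (\<kappa> * \<rho>\<^sub>s))"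

lemma c_pos: "0 < c" and c_square: "c\<^sup>2 = b * \<rho>\<^sub>s + \<mu> / (\<kappa> * \<rho>\<^sub>s)"
proof -
  have "0 < b * \<rho>\<^sub>s + \<mu> / (\<kappa> * \<rho>\<^sub>s)" using pos b_pos by (simp add: add_pos_pos)
  then show "0 < c" "c\<^sup>2 = b * \<rho>\<^sub>s + \<mu> / (\<kappa> * \<rho>\<^sub>s)" by (simp_all add: c_def)
qed

text \<open>Turns every scalar observation of a mode into a solution of the third-order equation,
  with \<open>p = 1 / \<kappa>\<close> and
  \<open>\<omega> = b * \<rho>\<^sub>s / (\<kappa> * c\<^sup>2)\<close>. The coefficient
  \<open>(n * c)\<^sup>2\<close> shows \<open>c\<close> to be the speed at which high frequencies
  travel.\<close>

lemma cayley_hamilton: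
  "M n (M n (M n v)) = - ((1 / \<kappa>) *\<^sub>R M n (M n v) + (n * c)\<^sup>2 *\<^sub>R M n v + ((n * c)\<^sup>2 * (b * \<rho>\<^sub>s / (\<kappa> * c\<^sup>2))) *\<^sub>R v)"
proof -
  obtain \<alpha> \<beta> \<delta> where v: "v = (\<alpha>, \<beta>, \<delta>)" by (cases v)
  have n2: "(n * c)\<^sup>2 = (real n)\<^sup>2 * (b * \<rho>\<^sub>s + \<mu> / (\<kappa> * \<rho>\<^sub>s))" by (simp add: power_mult_distrib c_square)
  have n3: "(n * c)\<^sup>2 * (b * \<rho>\<^sub>s / (\<kappa> * c\<^sup>2)) = (real n)\<^sup>2 * (b * \<rho>\<^sub>s / \<kappa>)"
    using c_pos by (simp add: power_mult_distrib)
  show ?thesis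
    unfolding n3 unfolding n2 v M_def using pos
    by (simp add: complex_eq_iff field_simps power2_eq_square)
qed

text \<open>As \<open>M n\<close> is \<open>n\<close> times a fixed matrix plus a fixed matrix, each
  application costs one power of \<open>1 + n\<close>.\<close>

lemma norm_M_le:
  obtains L where "0 \<le> L" "\<And>n v. norm (M n v) \<le> L * (1 + real n) * norm v"
proof
  let ?A = "\<lambda>v :: mode_vector. ((- \<rho>\<^sub>s) *\<^sub>R fst (snd v), b *\<^sub>R fst v - (1 / \<rho>\<^sub>s) *\<^sub>R snd (snd v), (\<mu> / \<kappa>) *\<^sub>R fst (snd v))"
  let ?B = "\<lambda>v :: mode_vector. (0 :: complex, 0 :: complex, - ((1 / \<kappa>) *\<^sub>R snd (snd v)))"
  have A: "bounded_linear ?A" and B: "bounded_linear ?B"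
    unfolding linear_conv_bounded_linear[symmetric]
    by (rule linearI; simp add: scaleR_add_right scaleR_diff_right mult.commute)+
  let ?L = "onorm ?A + onorm ?B"
  show "0 \<le> ?L" using onorm_pos_le[OF A] onorm_pos_le[OF B] by simp
  fix n v
  have "M n v = real n *\<^sub>R ?A v + ?B v"
    by (simp add: M_def case_prod_unfold mult_ac)
  also have "norm \<dots> \<le> real n * norm (?A v) + norm (?B v)"
    by (rule order_trans[OF norm_triangle_ineq]) (simp only: norm_scaleR abs_of_nat order_refl)
  also have "\<dots> \<le> real n * (onorm ?A * norm v) + onorm ?B * norm v"
    by (intro add_mono mult_left_mono onorm[OF A] onorm[OF B]) simp
  also have "\<dots> \<le> (1 + real n) * (onorm ?A * norm v) + (1 + real n) * (onorm ?B * norm v)"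
    using onorm_pos_le[OF A] onorm_pos_le[OF B] mult_right_mono[of 1 "1 + real n" "onorm ?B * norm v"]
    by (intro add_mono mult_right_mono) auto
  also have "\<dots> = ?L * (1 + real n) * norm v" by (simp add: algebra_simps)
  finally show "norm (M n v) \<le> ?L * (1 + real n) * norm v" .
qed

text \<open>One and the same vector \<open>v\<close> starts all modes, and the control profile is
  confined to \<open>g\<close>. The three initial values then are the observations of
  \<open>v\<close> and of its first two images under \<open>M m\<close>.\<close>

lemma third_order_modes_inner:
  fixes g :: "nat \<Rightarrow> complex"
  assumes T: "2 * pi / c < T"
    and g: "\<And>n. norm (g n) \<le> Cg / (1 + real n) ^ 4"
    and 0: "\<And>t. t \<in> {0..T} \<Longrightarrow> (\<lambda>n. g n * of_real (inner (state_coeff n \<zeta>) (E n t v))) sums 0"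
    and gm: "g m \<noteq> 0"
  shows "inner (state_coeff m \<zeta>) v = 0 \<and> inner (state_coeff m \<zeta>) (M m v) = 0 \<and> inner (state_coeff m \<zeta>) (M m (M m v)) = 0"
proof -
  let ?x = "\<lambda>n. state_coeff n \<zeta>"
  let ?f0 = "\<lambda>n t. complex_of_real (inner (?x n) (E n t v))"
  let ?f1 = "\<lambda>n t. complex_of_real (inner (?x n) (M n (E n t v)))"
  let ?f2 = "\<lambda>n t. complex_of_real (inner (?x n) (M n (M n (E n t v))))"
  let ?\<omega> = "b * \<rho>\<^sub>s / (\<kappa> * c\<^sup>2)"
  obtain L where L: "0 \<le> L" "\<And>n v. norm (M n v) \<le> L * (1 + real n) * norm v" by (rule norm_M_le) blast
  define B where "B = norm \<zeta> * (K * norm v)"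
  \<comment> \<open>A common constant for all bounds of the locale: at most two applications of
    \<open>M n\<close>, and the constant of \<open>g\<close>.\<close>
  define K' where "K' = B * (1 + L)\<^sup>2 + Cg"
  have Cg: "0 \<le> Cg" using order_trans[OF norm_ge_zero g[of 0]] by simp
  have B: "0 \<le> B" using K(1) by (simp add: B_def)
  have dE: "((\<lambda>t. E n t v) has_vector_derivative M n (E n t v)) (at t within A)" for n t A
    using solution_E[of n v] by (simp add: solution_def has_vector_derivative_at_within)
  have dinner: "((\<lambda>t. complex_of_real (inner (?x n) (y t))) has_vector_derivative of_real (inner (?x n) y')) (at t within A)"
    if "(y has_vector_derivative y') (at t within A)" for n y y' t A
    using bounded_linear.has_vector_derivative[OF bounded_linear_inner_right that]
    by (intro has_vector_derivative_of_real) (simp only: has_real_derivative_iff_has_vector_derivative)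
  have xn: "norm (?x n) \<le> norm \<zeta>" for n by (rule state_modes.norm_C_le)
  have En: "norm (E n t v) \<le> K * norm v" if "t \<in> {0..T}" for n t using K(2) that by simp
  have M1: "norm (M n w) \<le> (1 + L) * (1 + real n) * norm w" for n w
    by (rule order_trans[OF L(2)]) (intro mult_right_mono, auto)
  have inn: "norm (complex_of_real (inner (?x n) w)) \<le> norm \<zeta> * r" if "norm w \<le> r" for n w r
  proof -
    have "\<bar>inner (?x n) w\<bar> \<le> norm (?x n) * norm w" by (rule Cauchy_Schwarz_ineq2)
    also have "\<dots> \<le> norm \<zeta> * r" using that by (intro mult_mono xn) auto
    finally show ?thesis by simp
  qed
  have Ble: "B * (1 + L) ^ j * d \<le> K' * d" if "j \<le> 2" "0 \<le> d" for j d
  proof -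
    have "B * (1 + L) ^ j \<le> B * (1 + L)\<^sup>2" using L(1) B that by (intro mult_left_mono power_increasing) auto
    then show ?thesis using Cg that unfolding K'_def by (intro mult_right_mono) auto
  qed
  interpret third_order_modes c "1 / \<kappa>" ?\<omega> T K' ?f0 ?f1 ?f2 g
  proof
    show "0 < c" by (rule c_pos)
    show "0 < ?\<omega>" using pos b_pos c_pos by simp
    \<comment> \<open>Strict because of the part of \<open>c\<^sup>2\<close> that Maxwell's law
      contributes; this is what separates \<open>\<omega>\<close> from \<open>p\<close>.\<close>
    have "b * \<rho>\<^sub>s < c\<^sup>2" using pos by (simp add: c_square)
    then show "?\<omega> < 1 / \<kappa>" using pos c_pos by (simp add: field_simps)
    show "2 * pi / c < T" by (rule T)
    show "norm (g n) \<le> K' / (1 + real n) ^ 4" for n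
      by (rule order_trans[OF g]) (use B in \<open>auto intro!: divide_right_mono simp: K'_def\<close>)
    fix n t assume t: "t \<in> {0..T}"
    show "(?f0 n has_vector_derivative ?f1 n t) (at t within {0..T})" by (intro dinner dE)
    show "(?f1 n has_vector_derivative ?f2 n t) (at t within {0..T})"
      by (intro dinner bounded_linear.has_vector_derivative[OF bounded_linear_M] dE)
    have "(?f2 n has_vector_derivative of_real (inner (?x n) (M n (M n (M n (E n t v)))))) (at t within {0..T})"
      by (intro dinner bounded_linear.has_vector_derivative[OF bounded_linear_M] dE)
    then show "(?f2 n has_vector_derivative - (of_real (1 / \<kappa>) * ?f2 n t + of_real ((n * c)\<^sup>2) * ?f1 n t + of_real ((n * c)\<^sup>2 * ?\<omega>) * ?f0 n t)) (at t within {0..T})"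
      by (rule has_vector_derivative_eq_rhs) (simp only: cayley_hamilton inner_simps inner_minus_right of_real_add of_real_mult of_real_minus)
    have "norm (?f0 n t) \<le> norm \<zeta> * (K * norm v)" by (rule inn[OF En[OF t]])
    then show "norm (?f0 n t) \<le> K'" using Ble[of 0 1] by (simp add: B_def)
    have e1: "norm (M n (E n t v)) \<le> (1 + L) * (1 + real n) * (K * norm v)"
      by (rule order_trans[OF M1]) (use L(1) En[OF t] in \<open>intro mult_left_mono, auto\<close>)
    have "norm (?f1 n t) \<le> norm \<zeta> * ((1 + L) * (1 + real n) * (K * norm v))" by (rule inn[OF e1])
    also have "\<dots> = B * (1 + L) ^ 1 * (1 + real n)" by (simp add: B_def mult_ac)
    also have "\<dots> \<le> K' * (1 + real n)" by (rule Ble) auto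
    finally show "norm (?f1 n t) \<le> K' * (1 + real n)" .
    have e2: "norm (M n (M n (E n t v))) \<le> (1 + L) * (1 + real n) * ((1 + L) * (1 + real n) * (K * norm v))"
      by (rule order_trans[OF M1]) (use L(1) e1 in \<open>intro mult_left_mono, auto\<close>)
    have "norm (?f2 n t) \<le> norm \<zeta> * ((1 + L) * (1 + real n) * ((1 + L) * (1 + real n) * (K * norm v)))" by (rule inn[OF e2])
    also have "\<dots> = B * (1 + L)\<^sup>2 * (1 + real n)\<^sup>2" by (simp add: B_def mult_ac power2_eq_square)
    also have "\<dots> \<le> K' * (1 + real n)\<^sup>2" by (rule Ble) auto
    finally show "norm (?f2 n t) \<le> K' * (1 + real n)\<^sup>2" .
    show "(\<lambda>n. g n * ?f0 n t) sums 0" by (rule 0[OF t])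
  qed
  show ?thesis using initial_values_eq_0[OF gm] by (simp add: E_initial)
qed

text \<open>The controls \<open>\<phi>\<close> and \<open>\<i> \<phi>\<close> with a real bump \<open>\<phi>\<close> detect the real and the imaginary part of each coefficient.\<close>

lemma unique_continuation:
  assumes T: "2 * pi / c < T" and U: "open U" "U \<noteq> {}" "U \<subseteq> {0<..<pi}"
    and mean: "snd (snd (state_coeff 0 \<zeta>)) = 0"
    and orth: "\<And>f t. f \<in> L2_on U \<Longrightarrow> t \<in> {0..T} \<Longrightarrow> inner \<zeta> (S t (f, 0, 0)) = 0"
  shows "\<zeta> = 0"
proof (rule state_modes.C_complete)
  fix m
  obtain x r where r: "r > 0" "cball x r \<subseteq> U"
    using U(1,2) open_contains_cball by blast
  define p q where "p = x - r" and "q = x + r"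
  have pqU: "{p..q} \<subseteq> U" using r(2) by (simp add: p_def q_def cball_eq_atLeastAtMost)
  have "p \<in> {p..q}" "q \<in> {p..q}" using r(1) by (auto simp: p_def q_def)
  then have "p \<in> {0<..<pi}" "q \<in> {0<..<pi}" using pqU U(3) by blast+
  then have pq: "0 < p" "p < q" "q < pi" using r(1) by (auto simp: p_def q_def)
  define \<phi> where "\<phi> = (\<lambda>x. complex_of_real (bump p q x) * of_real (cos (real m * x)))"
  have \<phi>: "test_function \<phi>"
    unfolding \<phi>_def by (intro test_function_mult test_function_bump smooth_cos pq)
  obtain Cg where Cg: "\<And>n. norm (ccoeff n (abs_l2 \<phi>)) \<le> Cg / (1 + real n) ^ 4"
    by (rule ccoeff_test_function_decay[OF \<phi>]) blast
  \<comment> \<open>Real coefficients can be pulled out of the real inner product and of the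
    real-linear flow.\<close>
  have real: "ccoeff n (abs_l2 \<phi>) = of_real (Re (ccoeff n (abs_l2 \<phi>)))" for n
  proof -
    have "ccoeff n (abs_l2 \<phi>) = (\<integral>x. \<phi> x * of_real (cos_basis n x) \<partial>Mpi)"
      by (rule fourier_coeff_abs[OF test_function_sqint[OF \<phi>] continuous_on_cos_basis])
    also have "\<dots> = of_real (\<integral>x. bump p q x * cos (real m * x) * cos_basis n x \<partial>Mpi)"
      unfolding \<phi>_def by (simp flip: of_real_mult)
    finally show ?thesis by simp
  qed
  have key: "inner (state_coeff m \<zeta>) (e, 0, 0) = 0 \<and> inner (state_coeff m \<zeta>) (M m (e, 0, 0)) = 0
     \<and> inner (state_coeff m \<zeta>) (M m (M m (e, 0, 0))) = 0" for e
  proof (rule third_order_modes_inner[OF T Cg])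
    fix t assume t: "t \<in> {0..T}"
    let ?f = "abs_l2 (\<lambda>x. e * \<phi> x)"
    have sq: "sqint (\<lambda>x. e * \<phi> x)" by (intro sqint_cmult test_function_sqint \<phi>)
    have "?f \<in> L2_on U"
    proof (rule abs_l2_in_L2_on[OF sq])
      fix x assume "x \<notin> U"
      then have "x \<notin> {p..q}" using pqU by blast
      then have "x \<le> p \<or> q \<le> x" by auto
      then show "e * \<phi> x = 0" by (simp add: \<phi>_def bump_eq_0)
    qed
    then have "inner \<zeta> (S t (?f, 0, 0)) = 0" using t by (rule orth)
    \<comment> \<open>In every mode the control points in the same direction
      \<open>(e, 0, 0)\<close>; only a real factor depends on \<open>n\<close>.\<close>
    moreover have cf: "state_coeff n (?f, 0, 0) = Re (ccoeff n (abs_l2 \<phi>)) *\<^sub>R (e, 0, 0)" for n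
    proof -
      have "ccoeff n ?f = e * ccoeff n (abs_l2 \<phi>)"
        unfolding fourier_coeff_abs[OF sq continuous_on_cos_basis] fourier_coeff_abs[OF test_function_sqint[OF \<phi>] continuous_on_cos_basis]
        by (simp add: mult.assoc)
      also have "\<dots> = Re (ccoeff n (abs_l2 \<phi>)) *\<^sub>R e" by (subst real) (simp add: scaleR_conv_of_real)
      finally show ?thesis by (simp add: state_coeff_def)
    qed
    have "(\<lambda>n. inner (state_coeff n \<zeta>) (state_coeff n (S t (?f, 0, 0)))) sums inner \<zeta> (S t (?f, 0, 0))"
      by (rule state_modes.inner_sums)
    moreover have "inner (state_coeff n \<zeta>) (state_coeff n (S t (?f, 0, 0)))
        = Re (ccoeff n (abs_l2 \<phi>)) * inner (state_coeff n \<zeta>) (E n t (e, 0, 0))" for n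
      using t by (simp only: semigroup.C_S cf linear_scale[OF semigroup.E_linear] inner_scaleR_right atLeastAtMost_iff)
    ultimately have "(\<lambda>n. Re (ccoeff n (abs_l2 \<phi>)) * inner (state_coeff n \<zeta>) (E n t (e, 0, 0))) sums 0" by simp
    from sums_of_real[OF this, where 'a = complex]
    show "(\<lambda>n. ccoeff n (abs_l2 \<phi>) * of_real (inner (state_coeff n \<zeta>) (E n t (e, 0, 0)))) sums 0"
      by (simp add: real[symmetric])
  next
    show "ccoeff m (abs_l2 \<phi>) \<noteq> 0" unfolding \<phi>_def by (rule ccoeff_bump_cos_nz[OF pq])
  qed
  obtain \<alpha> \<beta> \<delta> where \<zeta>: "state_coeff m \<zeta> = (\<alpha>, \<beta>, \<delta>)" by (cases "state_coeff m \<zeta>")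
  have inner_0: "w = 0" if "inner w 1 = 0" "inner w \<i> = 0" for w
    using that by (simp add: inner_complex_def complex_eq_iff)
  have \<alpha>: "\<alpha> = 0" using key[of 1] key[of \<i>] by (intro inner_0) (simp_all add: \<zeta>)
  show "state_coeff m \<zeta> = 0"
  proof (cases "m = 0")
    case True
    \<comment> \<open>In mode 0 the observations see the density alone: the velocity has no such
      mode, and the mean of the stress is zero by assumption.\<close>
    have "\<beta> = 0" using \<zeta> by (simp add: state_coeff_def True scoeff_0 case_prod_unfold)
    moreover have "\<delta> = 0" using mean \<zeta> True by simp
    ultimately show ?thesis using \<alpha> by (simp add: \<zeta> zero_prod_def)
  next
    case False
    \<comment> \<open>The first image \<open>M m (e, 0, 0)\<close> is a nonzero multiple of
      \<open>(0, e, 0)\<close> and observes the velocity.\<close>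
    have "\<beta> = 0"
      using key[of 1] key[of \<i>] False b_pos by (intro inner_0) (simp_all add: \<zeta> M_def)
    \<comment> \<open>The second image has a density and a stress component; with
      \<open>\<alpha> = 0\<close> it observes the stress.\<close>
    moreover have "\<delta> = 0"
      using key[of 1] key[of \<i>] False b_pos pos by (intro inner_0) (simp_all add: \<zeta> M_def \<alpha>)
    ultimately show ?thesis using \<alpha> by (simp add: \<zeta> zero_prod_def)
  qed
qed

text \<open>The target, corrected by the free evolution, is projected onto the closure of the
  reachable space. The remainder is orthogonal to all reachable states, hence to all orbits of
  localized densities, and unique continuation annihilates it.\<close>

lemma approx_controllable_if_large_time:
  assumes T: "2 * pi / c < T" and U: "open U" "U \<noteq> {}" "U \<subseteq> {0<..<pi}"
  shows "approx_controllable a \<gamma> \<rho>\<^sub>s \<mu> \<kappa> U T"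
  unfolding approx_controllable_def
proof (intro ballI allI impI)
  fix z0 zT :: state and \<epsilon> :: real
  assume z0: "z0 \<in> UNIV \<times> UNIV \<times> L2m" and zT: "zT \<in> UNIV \<times> UNIV \<times> L2m" and \<epsilon>: "\<epsilon> > 0"
  have "0 < 2 * pi / c" using c_pos by simp
  then have T0: "0 < T" using T by linarith
  \<comment> \<open>The mean of the stress, up to a factor. Initial state, target and reachable
    states lie in the kernel of this continuous functional, hence so do the projection and the
    remainder.\<close>
  let ?m = "\<lambda>z. snd (snd (state_coeff 0 z))"
  have m: "bounded_linear ?m"
    by (intro bounded_linear_compose[OF bounded_linear_snd] bounded_linear_compose[OF bounded_linear_snd state_modes.C_bounded_linear] state_modes.C_bounded_linear)
  have mz: "?m z0 = 0" "?m zT = 0"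
    using z0 zT by (auto simp: state_coeff_def ccoeff_0_eq_0_iff)
  let ?R = "reached T ` continuous_controls T U"
  define d where "d = zT - S T z0"
  have md: "?m d = 0"
    using mz stress_mean_S[OF mz(1), of T] T0 by (simp add: d_def)
  have mR: "?m z = 0" if "z \<in> ?R" for z
  proof -
    obtain f where f: "continuous_on {0..T} f" "z = reached T f" using \<open>z \<in> ?R\<close> by (auto simp: continuous_controls_def)
    have "?m z = (\<integral>s. ?m (S (T - s) (f s, 0, 0)) \<partial>lebesgue_on {0<..<T})"
      unfolding f(2) reached_def by (rule integral_bounded_linear[OF m integrable_control_integrand[OF f(1)], symmetric])
    also have "\<dots> = (\<integral>s. 0 \<partial>lebesgue_on {0<..<T})"
      by (rule Bochner_Integration.integral_cong[OF refl], rule stress_mean_S)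
         (auto simp: state_coeff_def linear_0[OF bounded_linear.linear[OF cos_modes.C_bounded_linear]])
    finally show ?thesis by simp
  qed
  obtain p where p: "p \<in> closure ?R" "\<And>v. v \<in> closure ?R \<Longrightarrow> inner (d - p) v = 0"
    using exists_orthogonal_projection[OF subspace_closure[OF subspace_reached] closed_closure] by blast
  have "closed {z. ?m z = 0}"
    by (intro closed_Collect_eq continuous_on_const linear_continuous_on m)
  then have "closure ?R \<subseteq> {z. ?m z = 0}" by (intro closure_minimal) (auto simp: mR)
  then have mp: "?m p = 0" using p(1) by auto
  have "d - p = 0"
  proof (rule unique_continuation[OF T U])
    show "?m (d - p) = 0" using md mp by simp
    show "inner (d - p) (S t (f, 0, 0)) = 0" if "f \<in> L2_on U" "t \<in> {0..T}" for f t
      by (rule orthogonal_reached_imp[OF T0 _ that]) (use p(2) closure_subset in blast)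
  qed
  then have "d \<in> closure ?R" using p(1) by simp
  then obtain f where f: "f \<in> continuous_controls T U" "dist (reached T f) d < \<epsilon>"
    using \<epsilon> unfolding closure_approachable by blast
  let ?z = "\<lambda>t. S t z0 + (\<integral>s. S (t - s) (f s, 0, 0) \<partial>lebesgue_on {0<..<t})"
  have "mild_solution (A_dom a \<gamma> \<rho>\<^sub>s) (A_op a \<gamma> \<rho>\<^sub>s \<mu> \<kappa>) (\<lambda>t. (f t, 0, 0)) z0 T ?z"
    using f(1) by (intro semigroup.mild_solution_duhamel is_generator_S continuous_intros) (simp add: continuous_controls_def)
  moreover have "?z T - zT = reached T f - d" by (simp add: d_def reached_def)
  then have "norm (?z T - zT) < \<epsilon>" using f(2) by (simp add: dist_norm)
  moreover have "f \<in> controls T U" using f(1) continuous_controls_subset by blast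
  ultimately show "\<exists>f\<in>controls T U. \<exists>z. mild_solution (A_dom a \<gamma> \<rho>\<^sub>s) (A_op a \<gamma> \<rho>\<^sub>s \<mu> \<kappa>) (\<lambda>t. (f t, 0, 0)) z0 T z \<and> norm (z T - zT) < \<epsilon>"
    by blast
qed

end

theorem theorem1p8:
  fixes a \<gamma> \<rho>\<^sub>s \<mu> \<kappa> T :: real and \<O>\<^sub>1 :: "real set"
  assumes "a > 0" and "\<gamma> \<ge> 1" and "\<rho>\<^sub>s > 0" and "\<mu> > 0" and "\<kappa> > 0"
    and "open \<O>\<^sub>1" and "\<O>\<^sub>1 \<noteq> {}" and "\<O>\<^sub>1 \<subseteq> {0<..<pi}"
    and "T > 4 * pi / sqrt (a * \<gamma> * \<rho>\<^sub>s powr (\<gamma> - 1) + \<mu> / (\<kappa> * \<rho>\<^sub>s))"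
  shows "approx_controllable a \<gamma> \<rho>\<^sub>s \<mu> \<kappa> \<O>\<^sub>1 T"
proof -
  interpret maxwell_system a \<gamma> \<rho>\<^sub>s \<mu> \<kappa>
    by unfold_locales (use assms in auto)
  \<comment> \<open>Identifies \<open>b * \<rho>\<^sub>s\<close> with
    \<open>a * \<gamma> * \<rho>\<^sub>s powr (\<gamma> - 1)\<close>, so that \<open>c\<close> is
    the square root in the bound on the time.\<close>
  have "\<rho>\<^sub>s powr (\<gamma> - 1) = \<rho>\<^sub>s powr (\<gamma> - 2) * \<rho>\<^sub>s"
    using powr_add[of \<rho>\<^sub>s "\<gamma> - 2" 1] assms(3) by simp
  then have "c = sqrt (a * \<gamma> * \<rho>\<^sub>s powr (\<gamma> - 1) + \<mu> / (\<kappa> * \<rho>\<^sub>s))"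
    by (simp add: c_def bcoef_def mult.assoc)
  moreover have "2 * pi / c \<le> 4 * pi / c"
    using c_pos by (intro divide_right_mono) auto
  ultimately have "2 * pi / c < T" using assms(9) by simp
  then show ?thesis using assms(6-8) by (rule approx_controllable_if_large_time)
qed

end
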